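(* (1) The class of all free type $W$ distributions is a proper subset of $I_s^{\boxplus}$. (2) The intersection of the class of all free type $W$ distributions and the class of all free type $G$ distributions is not empty. (3) The class of all free type $W$ distributions does not coincide with the class of all free type $G$ distributions.
   Context: $\mathcal{P}_+$ is the set of Borel probability measures supported in $\mathbb{R}_+=[0,\infty)$; $\mathcal{P}_s$ is the set of symmetric Borel probability measures on $\mathbb{R}$. $\mathrm{w}(\mathrm{d}x)=\frac{1}{2\pi}\sqrt{4-x^2}\,1_{(-2,2)}(x)\mathrm{d}x$ is the Wigner measure. Free infinite divisibility: $F_\mu=1/G_\mu$ with $G_\mu(z)=\int\frac{1}{z-x}\mu(\mathrm{d}x)$, $z\in\mathbb{C}^+$, and $\mathcal{C}_\mu^{\boxplus}(z)=zF_\mu^{-1}(z^{-1})-1$ where the right inverse $F_\mu^{-1}$ exists on a region $\{|\mathrm{Re}\,z|<\eta\,\mathrm{Im}\,z,\ \mathrm{Im}\,z>M\}$. $\mu_1\boxplus\mu_2$ is defined by $\mathcal{C}_{\mu_1\boxplus\mu_2}^{\boxplus}=\mathcal{C}_{\mu_1}^{\boxplus}+\mathcal{C}_{\mu_2}^{\boxplus}$. $I^{\boxplus}$ is the set of $\mu$ that are, for every $n$, an $n$-fold $\boxplus$-convolution of some probability measure; equivalently $\mathcal{C}_\mu^{\boxplus}(z)=b_\mu z+a_\mu z^2+\int_{\mathbb{R}}(\frac{1}{1-zx}-1-zx1_{[-1,1]}(x))\nu_\mu(\mathrm{d}x)$, $z\in\mathbb{C}^-$, with $b_\mu\in\mathbb{R}$,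 $a_\mu\ge0$, $\nu_\mu(\{0\})=0$, $\int\min(1,x^2)\nu_\mu(\mathrm{d}x)<\infty$; $(a_\mu,\nu_\mu,b_\mu)$ is the free triplet. $I_s^{\boxplus}=I^{\boxplus}\cap\mathcal{P}_s$. Free multiplicative convolution: let $\Psi_\mu(z)=\int\frac{zx}{1-zx}\mu(\mathrm{d}x)$. If $\mu\in\mathcal{P}_+$, $\mu\ne\delta_0$, $\Psi_\mu$ has an inverse $\chi_\mu$ on $\Psi_\mu(i\mathbb{C}^+)$ with values in the left half-plane $i\mathbb{C}^+$; if $\mu\in\mathcal{P}_s$, $\mu\neq\delta_0$, $\Psi_\mu$ has an inverse $\chi_\mu:\Psi_\mu(H)\to H$, $H=\{z\in\mathbb{C}^-:|\mathrm{Re}\,z|<|\mathrm{Im}\,z|\}$. In both cases $S_\mu(z)=\chi_\mu(z)\frac{1+z}{z}$. For $\mu_1\in\mathcal{P}_+$ and $\mu_2\in\mathcal{P}_+$ (resp. $\mu_2\in\mathcal{P}_s$), $\mu_1\boxtimes\mu_2$ is the measure in $\mathcal{P}_+$ (resp. $\mathcal{P}_s$) with $S_{\mu_1\boxtimes\mu_2}=S_{\mu_1}S_{\mu_2}$ on a common domain (and $\delta_0$ if one factor is $\delta_0$). A free type $W$ distribution is a measure of the form $\mu=\lambda\boxtimes\mathrm{w}$ with $\lambda\in\mathcal{P}_+$ such that $\mu\in I^{\boxplus}$. The Bercovici–Pata bijection $\Lambda$ sends the classical infinitely divisible distribution with Lévy–Khintchine exponent $ibt-\frac12at^2+\int_{\mathbb{R}}(e^{itx}-1-itx1_{|x|\le1})\nu(\mathrm{d}x)$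 to the measure in $I^{\boxplus}$ with free triplet $(a,\nu,b)$. A classical type $G$ distribution is the law of $VZ$ with $V\ge0$ and $Z$ independent, $Z$ standard Gaussian, and $V^2$ having a classical infinitely divisible law on $\mathbb{R}_+$. A free type $G$ distribution is $\Lambda(\mu)$ for a classical type $G$ distribution $\mu$. *)

theory Defs
  imports "HOL-Complex_Analysis.Complex_Analysis" "HOL-Probability.Probability"
begin

section \<open>Classes of probability measures on the real line\<close>

definition prob_R :: "real measure set" where
  "prob_R = {M. real_distribution M}"

definition prob_pos :: "real measure set" where
  "prob_pos = {M \<in> prob_R. measure M {0..} = 1}"

definition prob_sym :: "real measure set" where
  "prob_sym = {M \<in> prob_R. distr M borel uminus = M}"

abbreviation dirac0 :: "real measure" where
  "dirac0 \<equiv> return borel 0"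

definition wigner :: "real measure" where
  "wigner = density lborel
     (\<lambda>x. ennreal (1 / (2 * pi) * sqrt (4 - x\<^sup>2) * indicator {-2<..<2} x))"


section \<open>Free cumulant transform and free additive convolution\<close>

definition cauchy_transform :: "real measure \<Rightarrow> complex \<Rightarrow> complex" where
  "cauchy_transform M z = (LINT x|M. 1 / (z - of_real x))"

definition recip_cauchy :: "real measure \<Rightarrow> complex \<Rightarrow> complex" where
  "recip_cauchy M z = 1 / cauchy_transform M z"

definition trunc_cone :: "real \<Rightarrow> real \<Rightarrow> complex set" where
  "trunc_cone \<eta> R = {z. \<bar>Re z\<bar> < \<eta> * Im z \<and> R < Im z}"

text \<open>
  The reciprocal Cauchy transform need not be injective on the upper half-plane
  (for the symmetric Bernoulli law it is \<open>z - 1/z\<close>), so being a right inverse does not determine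
  a function.  The right inverse meant is the holomorphic one asymptotic to the
  identity at infinity.
\<close>

definition right_inverse_on :: "real measure \<Rightarrow> real \<Rightarrow> real \<Rightarrow> (complex \<Rightarrow> complex) \<Rightarrow> bool" where
  "right_inverse_on M \<eta> R g \<longleftrightarrow> \<eta> > 0 \<and> R > 0 \<and>
     g holomorphic_on trunc_cone \<eta> R \<and>
     (\<forall>z\<in>trunc_cone \<eta> R. Im (g z) > 0 \<and> recip_cauchy M (g z) = z) \<and>
     ((\<lambda>z. g z / z) \<longlongrightarrow> 1) (inf at_infinity (principal (trunc_cone \<eta> R)))"

text \<open>
  Any two such right inverses agree where both are defined, so the pointwise definite
  description below is independent of the cone.
\<close>

definition recip_cauchy_inv :: "real measure \<Rightarrow> complex \<Rightarrow> complex" where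
  "recip_cauchy_inv M z =
     (THE w. \<exists>\<eta> R g. right_inverse_on M \<eta> R g \<and> z \<in> trunc_cone \<eta> R \<and> w = g z)"

definition free_cumulant :: "real measure \<Rightarrow> complex \<Rightarrow> complex" where
  "free_cumulant M z = z * recip_cauchy_inv M (1 / z) - 1"

definition free_cumulant_dom :: "real measure \<Rightarrow> complex set" where
  "free_cumulant_dom M = {z. \<exists>\<eta> R g. right_inverse_on M \<eta> R g \<and> 1 / z \<in> trunc_cone \<eta> R}"

text \<open>\<open>is_free_add_conv M1 M2 M\<close> says that \<open>M\<close> is the free additive convolution of \<open>M1\<close> and \<open>M2\<close>.\<close>

definition is_free_add_conv :: "real measure \<Rightarrow> real measure \<Rightarrow> real measure \<Rightarrow> bool" where
  "is_free_add_conv M1 M2 M \<longleftrightarrow> M1 \<in> prob_R \<and> M2 \<in> prob_R \<and> M \<in> prob_R \<and>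
     (\<exists>\<eta>>0. \<exists>R>0. \<forall>z. 1 / z \<in> trunc_cone \<eta> R \<longrightarrow>
        z \<in> free_cumulant_dom M1 \<and> z \<in> free_cumulant_dom M2 \<and> z \<in> free_cumulant_dom M \<and>
        free_cumulant M z = free_cumulant M1 z + free_cumulant M2 z)"

text \<open>\<open>is_free_add_power L n M\<close>: \<open>M\<close> is the \<open>n\<close>-fold free additive convolution of \<open>L\<close> with itself.\<close>

inductive is_free_add_power :: "real measure \<Rightarrow> nat \<Rightarrow> real measure \<Rightarrow> bool" for L where
  one: "L \<in> prob_R \<Longrightarrow> is_free_add_power L 1 L"
| step: "is_free_add_power L n K \<Longrightarrow> is_free_add_conv K L M \<Longrightarrow> is_free_add_power L (Suc n) M"

definition free_inf_div :: "real measure set" where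
  "free_inf_div = {M \<in> prob_R. \<forall>n\<ge>1. \<exists>L\<in>prob_R. is_free_add_power L n M}"

definition free_inf_div_sym :: "real measure set" where
  "free_inf_div_sym = free_inf_div \<inter> prob_sym"

definition levy_measure :: "real measure \<Rightarrow> bool" where
  "levy_measure \<nu> \<longleftrightarrow> sets \<nu> = sets borel \<and> emeasure \<nu> {0} = 0 \<and>
     (\<integral>\<^sup>+x. ennreal (min 1 (x\<^sup>2)) \<partial>\<nu>) < \<infinity>"

text \<open>
  The right-hand side of the formula is analytic on the whole lower half-plane, so
  the formula near zero identifies it as the analytic continuation of the free cumulant transform.
\<close>

definition has_free_triplet :: "real measure \<Rightarrow> real \<Rightarrow> real measure \<Rightarrow> real \<Rightarrow> bool" where
  "has_free_triplet M a \<nu> b \<longleftrightarrow> a \<ge> 0 \<and> levy_measure \<nu> \<and>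
     (\<exists>\<eta>>0. \<exists>R>0. \<forall>z. 1 / z \<in> trunc_cone \<eta> R \<longrightarrow>
        z \<in> free_cumulant_dom M \<and>
        free_cumulant M z = of_real b * z + of_real a * z\<^sup>2 +
          (LINT x|\<nu>. 1 / (1 - z * of_real x) - 1 - z * of_real x * of_real (indicator {-1..1} x)))"


section \<open>Free multiplicative convolution\<close>

definition psi_transform :: "real measure \<Rightarrow> complex \<Rightarrow> complex" where
  "psi_transform M z = (LINT x|M. z * of_real x / (1 - z * of_real x))"

definition chi_region :: "real measure \<Rightarrow> complex set" where
  "chi_region M = (if M \<in> prob_pos then {z. Re z < 0} else {z. Im z < 0 \<and> \<bar>Re z\<bar> < \<bar>Im z\<bar>})"

definition chi_transform :: "real measure \<Rightarrow> complex \<Rightarrow> complex" where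
  "chi_transform M = the_inv_into (chi_region M) (psi_transform M)"

definition S_transform :: "real measure \<Rightarrow> complex \<Rightarrow> complex" where
  "S_transform M z = chi_transform M z * ((1 + z) / z)"

definition S_dom :: "real measure \<Rightarrow> complex set" where
  "S_dom M = psi_transform M ` chi_region M"

text \<open>
  \<open>is_free_mult_conv M1 M2 M\<close> says that \<open>M\<close> is the free multiplicative convolution of \<open>M1\<close> and \<open>M2\<close>.
  The common domain is a connected open set containing \<open>(-\<epsilon>, 0)\<close>: each \<open>S_dom\<close> of a measure other
  than \<open>dirac0\<close> contains such an interval.
\<close>

definition is_free_mult_conv :: "real measure \<Rightarrow> real measure \<Rightarrow> real measure \<Rightarrow> bool" where
  "is_free_mult_conv M1 M2 M \<longleftrightarrow> M1 \<in> prob_pos \<and>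
     (M2 \<in> prob_pos \<and> M \<in> prob_pos \<or> M2 \<in> prob_sym \<and> M \<in> prob_sym) \<and>
     (if M1 = dirac0 \<or> M2 = dirac0 then M = dirac0
      else M \<noteq> dirac0 \<and>
        (\<exists>U. open U \<and> connected U \<and> (\<exists>\<epsilon>>0. of_real ` {-\<epsilon><..<0} \<subseteq> U) \<and>
             U \<subseteq> S_dom M1 \<inter> S_dom M2 \<inter> S_dom M \<and>
             (\<forall>z\<in>U. S_transform M z = S_transform M1 z * S_transform M2 z)))"

definition free_type_W :: "real measure set" where
  "free_type_W = {M \<in> free_inf_div. \<exists>L\<in>prob_pos. is_free_mult_conv L wigner M}"


section \<open>Bercovici--Pata bijection and type G distributions\<close>

primrec conv_power :: "real measure \<Rightarrow> nat \<Rightarrow> real measure" where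
  "conv_power L 0 = dirac0"
| "conv_power L (Suc n) = convolution (conv_power L n) L"

definition classical_inf_div :: "real measure set" where
  "classical_inf_div = {M \<in> prob_R. \<forall>n\<ge>1. \<exists>L\<in>prob_R. M = conv_power L n}"

definition has_classical_triplet :: "real measure \<Rightarrow> real \<Rightarrow> real measure \<Rightarrow> real \<Rightarrow> bool" where
  "has_classical_triplet M a \<nu> b \<longleftrightarrow> a \<ge> 0 \<and> levy_measure \<nu> \<and>
     (\<forall>t. char M t = exp (\<i> * of_real (b * t) - of_real (a * t\<^sup>2 / 2) +
        (LINT x|\<nu>. iexp (t * x) - 1 - \<i> * of_real (t * x * indicator {-1..1} x))))"

text \<open>The graph of the Bercovici--Pata bijection.\<close>

definition bercovici_pata :: "real measure \<Rightarrow> real measure \<Rightarrow> bool" where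
  "bercovici_pata M N \<longleftrightarrow> M \<in> classical_inf_div \<and> N \<in> free_inf_div \<and>
     (\<exists>a \<nu> b. has_classical_triplet M a \<nu> b \<and> has_free_triplet N a \<nu> b)"

text \<open>
  The law of \<open>V Z\<close> is expressed through the law \<open>L\<close> of \<open>V\<close>: independence of \<open>V\<close> and \<open>Z\<close> means that
  \<open>(V, Z)\<close> has the product measure as its joint law.
\<close>

definition type_G :: "real measure set" where
  "type_G = {M. \<exists>L\<in>prob_pos. distr L borel (\<lambda>v. v\<^sup>2) \<in> classical_inf_div \<and>
     M = distr (L \<Otimes>\<^sub>M density lborel (\<lambda>x. ennreal (std_normal_density x))) borel (\<lambda>(v, z). v * z)}"

definition free_type_G :: "real measure set" where
  "free_type_G = {N. \<exists>M\<in>type_G. bercovici_pata M N}"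

end

theory Submission
  imports Defs "HOL-Real_Asymp.Real_Asymp"
begin

text \<open>
  The point mass at zero belongs to both classes.  Everything else follows from one symmetric measure
  of free type \<open>G\<close> that is not of free type \<open>W\<close>.

  Let \<open>\<nu>\<close> be the Levy measure of \<open>sqrt (N\<^sub>1 + s\<^sup>2 * N\<^sub>2) * Z\<close>, where \<open>N\<^sub>1\<close> and \<open>N\<^sub>2\<close> are Poisson of rates
  \<open>p\<close> and \<open>1/2\<close>.  The measure \<open>M\<close> with free triplet \<open>(0, \<nu>, 0)\<close> exists because
  \<open>w \<mapsto> w + (\<integral> x\<^sup>2 / (w - x) d\<nu>)\<close> has a right inverse on the whole upper half-plane, to which Nevanlinna's
  representation applies.  Put \<open>c T = (\<integral> T x\<^sup>2 / (1 + T x\<^sup>2) d\<nu>)\<close>.  If \<open>M\<close> were the product of \<open>L\<close> and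
  the Wigner law, comparing S-transforms on the negative half-line would give
  \<open>(\<integral> k x / (1 + k x) dL) = c T\<close> for \<open>k = sqrt (T * c T) / (1 - c T)\<close>, first for small \<open>T\<close> and then, by
  analytic continuation, for all \<open>T > 0\<close>.  The left-hand side is concave in \<open>k\<close>, but for large \<open>s\<close> and small
  \<open>p\<close> the right-hand side is not: \<open>c\<close> has a plateau on which \<open>k\<close> grows like \<open>sqrt T\<close>, and \<open>c\<close> leaves
  it linearly in \<open>T\<close>.
\<close>

section \<open>Cauchy transforms of finite measures\<close>

text \<open>The formula for \<open>k\<close> comes from explicit values of chi at
  \<open>- c\<close>. At \<open>\<i> / sqrt T\<close> symmetry removes the real part of the Cauchy
  transform of \<open>second_moment \<nu>\<close>, which gives chi of \<open>M\<close> as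
  \<open>- \<i> * sqrt T / (1 - c)\<close>; chi of the Wigner law is
  \<open>- \<i> * sqrt c / (1 - c)\<close>. The quotient of the S-transforms is
  \<open>sqrt T / sqrt c\<close>, so chi of \<open>L\<close> is \<open>- k\<close>. The total jump
  rate \<open>p + 1 / 2\<close> is below 1, so \<open>c T < 1\<close> and \<open>k\<close> is finite
  for every \<open>T\<close>.

  The obstacle is the domain: a product identity is given only near \<open>(-\<epsilon>, 0)\<close>,
  that is for small \<open>T\<close>, while the violation of concavity is found at three fixed
  values of \<open>T\<close> with \<open>s\<close> large, where \<open>c T\<close> is near 1/2.
  Hence the continuation along the whole half-line.

  On the existence side the finite measure \<open>second_moment \<nu>\<close> takes the place of the
  triplet: convolution roots come from scaling it. Symmetry of \<open>M\<close> is obtained by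
  averaging a law with its reflection, once both are known to have the same Cauchy
  transform.\<close>

lemma holomorphic_on_lebesgue_integral:
  fixes f :: "complex \<Rightarrow> 'a \<Rightarrow> complex"
  assumes M: "finite_measure M" and S: "open S"
    and hol: "\<And>x. x \<in> space M \<Longrightarrow> (\<lambda>z. f z x) holomorphic_on S"
    and meas [measurable]: "\<And>z. f z \<in> borel_measurable M"
    and bnd: "\<And>z x. z \<in> S \<Longrightarrow> x \<in> space M \<Longrightarrow> norm (f z x) \<le> B"
  shows "(\<lambda>z. LINT x|M. f z x) holomorphic_on S"
proof -
  interpret finite_measure M by fact
  have integrable: "integrable M (f z)" if "z \<in> S" for z
    by (rule integrable_const_bound[of _ B]) (use bnd that in auto)
  have "(\<lambda>z. LINT x|M. f z x) field_differentiable at z" if z: "z \<in> S" for z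
  proof -
    obtain r where r: "r > 0" "cball z r \<subseteq> S"
      using S z open_contains_cball by blast
    define D where "D x = deriv (\<lambda>w. f w x) z" for x
    \<comment> \<open>The Cauchy estimate on discs of radius \<open>r / 2\<close>, which stay inside
      \<open>cball z r\<close> when centred in \<open>ball z (r / 2)\<close>, turns the uniform
      bound \<open>B\<close> into a Lipschitz constant. It dominates all difference quotients at
      once.\<close>
    have lip: "norm ((f w x - f z x) / (w - z)) \<le> B / (r/2)"
      if x: "x \<in> space M" and w: "w \<in> ball z (r/2)" "w \<noteq> z" for w x
    proof -
      have sub: "cball u (r/2) \<subseteq> S" if "u \<in> ball z (r/2)" for u
      proof
        fix v assume "v \<in> cball u (r/2)"
        then have "dist z v \<le> r"
          using that dist_triangle[of z v u] by (auto simp: dist_commute)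
        then show "v \<in> S" using r by auto
      qed
      have "norm ((deriv ^^ 1) (\<lambda>w. f w x) u) \<le> fact 1 * B / (r/2) ^ 1" if u: "u \<in> ball z (r/2)" for u
      proof (rule Cauchy_inequality)
        show "(\<lambda>w. f w x) holomorphic_on ball u (r/2)"
          using holomorphic_on_subset[OF hol[OF x]] sub[OF u] ball_subset_cball by blast
        show "continuous_on (cball u (r/2)) (\<lambda>w. f w x)"
          using holomorphic_on_imp_continuous_on[OF hol[OF x]] sub[OF u] continuous_on_subset by blast
        show "norm (f v x) \<le> B" if "norm (u - v) = r/2" for v
          using bnd[OF _ x] sub[OF u] that by (auto simp: dist_norm)
      qed (use r in auto)
      then have der: "norm (deriv (\<lambda>w. f w x) u) \<le> B / (r/2)" if "u \<in> ball z (r/2)" for u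
        using that by simp
      have "norm (f w x - f z x) \<le> B / (r/2) * norm (w - z)"
      proof (rule field_differentiable_bound[of "ball z (r/2)" "\<lambda>w. f w x"])
        show "((\<lambda>w. f w x) has_field_derivative deriv (\<lambda>w. f w x) u) (at u within ball z (r/2))"
          if "u \<in> ball z (r/2)" for u
          using sub[OF that] r by (intro holomorphic_derivI[OF hol[OF x] S]) auto
      qed (use w der r in auto)
      then show ?thesis
        using w by (simp add: norm_divide divide_le_eq)
    qed
    have "((\<lambda>w. ((LINT x|M. f w x) - (LINT x|M. f z x)) / (w - z)) \<longlongrightarrow> (LINT x|M. D x)) (at z)"
      unfolding tendsto_at_iff_sequentially
    proof safe
      fix W :: "nat \<Rightarrow> complex" assume W: "\<forall>i. W i \<in> UNIV - {z}" "W \<longlonglongrightarrow> z"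
      then obtain N where N: "\<And>n. n \<ge> N \<Longrightarrow> dist (W n) z < r/2"
        using r lim_sequentially[of W z] by (meson half_gt_zero)
      \<comment> \<open>The tail lies in the disc where \<open>lip\<close> applies, and dropping
        \<open>N\<close> terms keeps the limit.\<close>
      define V where "V n = W (n + N)" for n
      have V: "V n \<noteq> z" "V n \<in> ball z (r/2)" "V n \<in> S" for n
        using W(1) N[of "n + N"] r by (auto simp: V_def dist_commute)
      have Vz: "V \<longlonglongrightarrow> z" unfolding V_def by (rule LIMSEQ_ignore_initial_segment[OF W(2)])
      have Vat: "filterlim V (at z) sequentially"
        using Vz V by (auto simp: filterlim_at)
      have lim: "(\<lambda>n. (f (V n) x - f z x) / (V n - z)) \<longlonglongrightarrow> D x" if "x \<in> space M" for x
      proof -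
        have "((\<lambda>w. f w x) has_field_derivative D x) (at z)"
          unfolding D_def using hol[OF that] S z by (rule holomorphic_derivI)
        then show ?thesis
          unfolding has_field_derivative_iff using filterlim_compose[OF _ Vat] by blast
      qed
      have [measurable]: "D \<in> borel_measurable M"
        by (rule borel_measurable_LIMSEQ_metric[OF _ lim]) auto
      have "(\<lambda>n. LINT x|M. (f (V n) x - f z x) / (V n - z)) \<longlonglongrightarrow> (LINT x|M. D x)"
      proof (rule integral_dominated_convergence[where w="\<lambda>_. B / (r/2)"])
        show "AE x in M. norm ((f (V n) x - f z x) / (V n - z)) \<le> B / (r/2)" for n
          using lip V by auto
      qed (use lim in auto)
      moreover have "(LINT x|M. (f (V n) x - f z x) / (V n - z)) =
          ((LINT x|M. f (V n) x) - (LINT x|M. f z x)) / (V n - z)" for n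
        using integrable[OF V(3)] integrable[OF z] by simp
      ultimately have "(\<lambda>n. ((LINT x|M. f (W (n + N)) x) - (LINT x|M. f z x)) / (W (n + N) - z))
          \<longlonglongrightarrow> (LINT x|M. D x)"
        by (simp only: V_def)
      then show "((\<lambda>w. ((LINT x|M. f w x) - (LINT x|M. f z x)) / (w - z)) \<circ> W) \<longlonglongrightarrow> (LINT x|M. D x)"
        unfolding comp_def by (rule LIMSEQ_offset)
    qed
    then show ?thesis
      unfolding field_differentiable_def has_field_derivative_iff by blast
  qed
  then show ?thesis
    using S by (simp add: holomorphic_on_def at_within_open[OF _ S])
qed

section \<open>Resolvents and Cauchy transforms on the upper half-plane\<close>

abbreviation upper_half :: "complex set" where
  "upper_half \<equiv> {z. 0 < Im z}"

lemma open_upper_half: "open upper_half"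
  by (rule open_halfspace_Im_gt)

definition fin_borel :: "real measure \<Rightarrow> bool" where
  "fin_borel M \<longleftrightarrow> finite_measure M \<and> sets M = sets borel"

lemma fin_borelD:
  assumes "fin_borel M"
  shows "finite_measure M" "sets M = sets borel" "space M = UNIV"
proof -
  show "finite_measure M" and "sets M = sets borel"
    using assms unfolding fin_borel_def by (rule conjunct1, rule conjunct2)
  show "space M = UNIV"
    using sets_eq_imp_space_eq[of M borel, OF \<open>sets M = sets borel\<close>] by (simp only: space_borel)
qed

lemma fin_borel_real_distribution: "real_distribution M \<Longrightarrow> fin_borel M"
  unfolding fin_borel_def real_distribution_def real_distribution_axioms_def
  by (elim conjE) (intro conjI prob_space.finite_measure)

lemma borel_measurable_fin_borel:
  assumes "fin_borel M" "f \<in> borel_measurable borel"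
  shows "f \<in> borel_measurable M"
  by (subst measurable_cong_sets[OF fin_borelD(2)[OF assms(1)] refl]) (rule assms)

lemma measurable_uminus_fin_borel: "fin_borel M \<Longrightarrow> uminus \<in> measurable M borel"
  by (rule borel_measurable_fin_borel) simp_all

lemma norm_resolvent_le:
  assumes "Im z > 0"
  shows "norm (1 / (z - of_real x)) \<le> 1 / Im z"
proof -
  have "Im z \<le> norm (z - of_real x)"
    using abs_Im_le_cmod[of "z - of_real x"] by simp
  then have "1 / norm (z - of_real x) \<le> 1 / Im z"
    using assms by (intro frac_le) auto
  then show ?thesis by (simp add: norm_divide)
qed

lemma integrable_bounded:
  fixes f :: "real \<Rightarrow> 'a::{banach,second_countable_topology}"
  assumes "fin_borel M" "f \<in> borel_measurable borel" "\<And>x. norm (f x) \<le> B"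
  shows "integrable M f"
  by (rule finite_measure.integrable_const_bound[OF fin_borelD(1), of M f B])
    (use assms borel_measurable_fin_borel in auto)

lemma norm_moment_kernel_le_1:
  fixes t :: real
  shows "t \<ge> 0 \<Longrightarrow> norm (t / (1 + t)) \<le> 1"
  by (simp add: divide_le_eq)

lemma integrable_resolvent:
  assumes "fin_borel M" "Im z > 0"
  shows "integrable M (\<lambda>x. 1 / (z - of_real x))"
  by (rule integrable_bounded[OF assms(1) _ norm_resolvent_le[OF assms(2)]]) measurable

lemma cauchy_transform_norm_le:
  assumes M: "fin_borel M" and z: "Im z > 0"
  shows "norm (cauchy_transform M z) \<le> measure M (space M) / Im z"
proof -
  interpret finite_measure M using M by (rule fin_borelD)
  have "norm (cauchy_transform M z) \<le> (LINT x|M. norm (1 / (z - of_real x)))"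
    unfolding cauchy_transform_def by (rule integral_norm_bound)
  also have "\<dots> \<le> (LINT x|M. 1 / Im z)"
    by (intro integral_mono integrable_norm integrable_resolvent[OF M z] norm_resolvent_le[OF z]) simp
  finally show ?thesis by simp
qed

lemma integrable_resolvent_sq:
  assumes "fin_borel M" "Im z > 0"
  shows "integrable M (\<lambda>x. 1 / (norm (z - of_real x))\<^sup>2)"
proof (rule integrable_bounded[OF assms(1)])
  show "norm (1 / (norm (z - of_real x))\<^sup>2) \<le> (1 / Im z)\<^sup>2" for x
    using power_mono[OF norm_resolvent_le[OF assms(2), of x], of 2]
    by (simp add: norm_divide power_divide)
qed auto

lemma Im_cauchy_transform:
  assumes M: "fin_borel M" and z: "Im z > 0"
  shows "Im (cauchy_transform M z) = - Im z * (LINT x|M. 1 / (norm (z - of_real x))\<^sup>2)"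
proof -
  have "Im (cauchy_transform M z) = (LINT x|M. Im (1 / (z - of_real x)))"
    unfolding cauchy_transform_def by (rule integral_Im[OF integrable_resolvent[OF M z], symmetric])
  also have "\<dots> = (LINT x|M. - Im z * (1 / (norm (z - of_real x))\<^sup>2))"
    by (rule Bochner_Integration.integral_cong) (auto simp: Im_divide cmod_def)
  also have "\<dots> = - Im z * (LINT x|M. 1 / (norm (z - of_real x))\<^sup>2)"
    by (rule integral_mult_right_zero)
  finally show ?thesis .
qed

lemma Im_cauchy_transform_le:
  assumes M: "fin_borel M" and z: "Im z > 0"
  shows "Im (cauchy_transform M z) \<le> 0"
  using z by (simp add: Im_cauchy_transform[OF assms] mult_nonneg_nonneg)

lemma holomorphic_cauchy_transform:
  assumes M: "fin_borel M"
  shows "cauchy_transform M holomorphic_on upper_half"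
proof -
  have "cauchy_transform M field_differentiable at z" if z: "Im z > 0" for z
  proof -
    \<comment> \<open>The resolvent is bounded only away from the real axis, so the integral lemma
      is applied on a separate half-plane around each point.\<close>
    define S where "S = {w. Im w > Im z / 2}"
    have S: "open S" "z \<in> S" unfolding S_def using z by (simp_all only: open_halfspace_Im_gt) auto
    have "(\<lambda>w. LINT x|M. 1 / (w - of_real x)) holomorphic_on S"
    proof (rule holomorphic_on_lebesgue_integral[where B="1 / (Im z / 2)"])
      show "norm (1 / (w - of_real x)) \<le> 1 / (Im z / 2)" if "w \<in> S" for w x
      proof -
        have "norm (1 / (w - of_real x)) \<le> 1 / Im w"
          using that z by (intro norm_resolvent_le) (auto simp: S_def)
        also have "\<dots> \<le> 1 / (Im z / 2)" using that z by (intro frac_le) (auto simp: S_def)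
        finally show ?thesis .
      qed
      show "(\<lambda>w. 1 / (w - of_real x)) holomorphic_on S" for x
        using z by (intro holomorphic_intros) (auto simp: S_def)
      show "(\<lambda>x. 1 / (w - of_real x)) \<in> borel_measurable M" for w :: complex
        by (rule borel_measurable_fin_borel[OF M]) auto
    qed (use fin_borelD(1)[OF M] S in auto)
    then show ?thesis
      using S holomorphic_on_imp_differentiable_at unfolding cauchy_transform_def by blast
  qed
  then show ?thesis
    by (auto simp: holomorphic_on_def intro: field_differentiable_at_within)
qed

text \<open>By AM-GM the difference quotient of \<open>w \<mapsto> cauchy_transform M w\<close> is bounded by the mean of
  \<open>- Im (cauchy_transform M w) / Im w\<close> at both points.\<close>

lemma cauchy_transform_diff_less:
  assumes M: "fin_borel M" and w: "Im w1 > 0" "Im w2 > 0" "w1 \<noteq> w2"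
    and less: "Im (w1 + cauchy_transform M w1) > 0" "Im (w2 + cauchy_transform M w2) > 0"
  shows "norm (cauchy_transform M w1 - cauchy_transform M w2) < norm (w1 - w2)"
proof -
  define I where "I w = (LINT x|M. 1 / (norm (w - of_real x))\<^sup>2)" for w :: complex
  note im = Im_cauchy_transform[OF M]
  \<comment> \<open>The imaginary part of \<open>w + cauchy_transform M w\<close> is
    \<open>Im w * (1 - I w)\<close>, so its positivity is the bound \<open>I w < 1\<close>.\<close>
  have I1: "I w < 1" if "Im w > 0" "Im (w + cauchy_transform M w) > 0" for w
  proof -
    have "Im w * (1 - I w) > 0" using that im[of w] by (simp add: I_def algebra_simps)
    then show ?thesis using that by (simp add: zero_less_mult_iff)
  qed
  have diff: "cauchy_transform M w1 - cauchy_transform M w2 =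
     (LINT x|M. (w2 - w1) * (1 / (w1 - of_real x) * (1 / (w2 - of_real x))))"
  proof -
    have "cauchy_transform M w1 - cauchy_transform M w2 =
      (LINT x|M. 1 / (w1 - of_real x) - 1 / (w2 - of_real x))"
      unfolding cauchy_transform_def
      by (rule Bochner_Integration.integral_diff[symmetric]) (use integrable_resolvent M w in auto)
    also have "\<dots> = (LINT x|M. (w2 - w1) * (1 / (w1 - of_real x) * (1 / (w2 - of_real x))))"
    proof (rule Bochner_Integration.integral_cong)
      fix x
      have "w1 - of_real x \<noteq> 0" "w2 - of_real x \<noteq> 0" using w by (auto simp: complex_eq_iff)
      then show "1 / (w1 - of_real x) - 1 / (w2 - of_real x) =
          (w2 - w1) * (1 / (w1 - of_real x) * (1 / (w2 - of_real x)))"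
        by (simp add: field_simps)
    qed simp
    finally show ?thesis .
  qed
  have "norm (cauchy_transform M w1 - cauchy_transform M w2) \<le>
    (LINT x|M. norm ((w2 - w1) * (1 / (w1 - of_real x) * (1 / (w2 - of_real x)))))"
    unfolding diff by (rule integral_norm_bound)
  also have "\<dots> \<le> (LINT x|M. norm (w1 - w2) *
      ((1 / (norm (w1 - of_real x))\<^sup>2 + 1 / (norm (w2 - of_real x))\<^sup>2) / 2))"
  proof (rule integral_mono)
    show "integrable M (\<lambda>x. norm ((w2 - w1) * (1 / (w1 - of_real x) * (1 / (w2 - of_real x)))))"
    proof (rule integrable_bounded[OF M])
      show "norm (norm ((w2 - w1) * (1 / (w1 - of_real x) * (1 / (w2 - of_real x))))) \<le>
         norm (w2 - w1) * (1 / Im w1 * (1 / Im w2))" for x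
        unfolding norm_mult real_norm_def abs_mult abs_norm_cancel
        using w norm_resolvent_le by (intro mult_mono) auto
    qed auto
    show "integrable M (\<lambda>x. norm (w1 - w2) *
      ((1 / (norm (w1 - of_real x))\<^sup>2 + 1 / (norm (w2 - of_real x))\<^sup>2) / 2))"
      using integrable_resolvent_sq[OF M] w by (intro integrable_mult_right integrable_divide_zero Bochner_Integration.integrable_add) auto
    fix x
    define a b where "a = 1 / norm (w1 - of_real x)" and "b = 1 / norm (w2 - of_real x)"
    have "a * b \<le> (a\<^sup>2 + b\<^sup>2) / 2" using sum_squares_bound[of a b] by simp
    then have "norm (w1 - w2) * (a * b) \<le> norm (w1 - w2) * ((a\<^sup>2 + b\<^sup>2) / 2)"
      by (rule mult_left_mono) simp
    then show "norm ((w2 - w1) * (1 / (w1 - of_real x) * (1 / (w2 - of_real x)))) \<le>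
       norm (w1 - w2) * ((1 / (norm (w1 - of_real x))\<^sup>2 + 1 / (norm (w2 - of_real x))\<^sup>2) / 2)"
      unfolding a_def b_def norm_mult norm_divide power_divide norm_one power_one norm_minus_commute[of w2 w1] .
  qed
  also have "\<dots> = norm (w1 - w2) * ((I w1 + I w2) / 2)"
    using integrable_resolvent_sq[OF M] w by (simp add: I_def)
  also have "\<dots> < norm (w1 - w2) * 1"
    using I1[OF w(1) less(1)] I1[OF w(2) less(2)] w by (intro mult_strict_left_mono) auto
  finally show ?thesis by simp
qed

text \<open>Two distinct points with equal images would have Cauchy transforms exactly as far apart
  as the points themselves, against the strict contraction.\<close>

lemma subordination_inj:
  assumes "fin_borel M" "Im w1 > 0" "Im w2 > 0" "Im (w1 + cauchy_transform M w1) > 0"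
    and eq: "w1 + cauchy_transform M w1 = w2 + cauchy_transform M w2"
  shows "w1 = w2"
proof (rule ccontr)
  assume "w1 \<noteq> w2"
  then have "norm (cauchy_transform M w1 - cauchy_transform M w2) < norm (w1 - w2)"
    using assms(1-4) by (intro cauchy_transform_diff_less) (simp_all flip: eq)
  moreover have "cauchy_transform M w1 - cauchy_transform M w2 = w2 - w1"
    using eq by (simp add: algebra_simps)
  ultimately show False by (simp add: norm_minus_commute)
qed

text \<open>The map \<open>w \<mapsto> w + cauchy_transform M w\<close> is injective and proper over the upper half-plane, so its
  image there is both open and closed.\<close>

lemma subordination_exists:
  assumes M: "fin_borel M"
  shows "\<exists>F. F holomorphic_on upper_half \<and>
    (\<forall>z\<in>upper_half. Im (F z) > 0 \<and> F z + cauchy_transform M (F z) = z)"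
proof -
  define H where "H w = w + cauchy_transform M w" for w
  define m where "m = measure M (space M)"
  define S where "S = upper_half \<inter> H -` upper_half"
  have m: "m \<ge> 0" by (simp add: m_def)
  have hol: "H holomorphic_on upper_half"
    unfolding H_def by (intro holomorphic_intros holomorphic_cauchy_transform M)
  have cont: "continuous_on upper_half H" by (rule holomorphic_on_imp_continuous_on[OF hol])
  have S: "open S"
    unfolding S_def by (rule continuous_open_preimage[OF cont open_upper_half open_upper_half])
  have holS: "H holomorphic_on S" using hol by (rule holomorphic_on_subset) (simp add: S_def)
  have inj: "inj_on H S"
  proof (rule inj_onI)
    fix w1 w2 assume "w1 \<in> S" "w2 \<in> S" "H w1 = H w2"
    then show "w1 = w2"
      by (intro subordination_inj[OF M, of w1 w2]) (simp_all add: S_def H_def)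
  qed
  have ImH: "Im w \<ge> Im (H w)" if "Im w > 0" for w
    using Im_cauchy_transform_le[OF M that] by (simp add: H_def)
  have normH: "norm (H w - w) \<le> m / Im w" if "Im w > 0" for w
    using cauchy_transform_norm_le[OF M that] by (simp add: H_def m_def)
  have op: "open (H ` S)" by (rule open_mapping_thm3[OF holS S inj])
  have sub: "H ` S \<subseteq> upper_half" by (auto simp: S_def)
  have ne: "H ` S \<noteq> {}"
  proof -
    \<comment> \<open>At height \<open>m + 1\<close> the map moves a point by at most
      \<open>m / (m + 1)\<close>, too little to leave the upper half-plane.\<close>
    define w where "w = \<i> * of_real (m + 1)"
    have w: "Im w = m + 1" by (simp add: w_def)
    have "\<bar>Im (H w - w)\<bar> \<le> m / (m + 1)"
      using order_trans[OF abs_Im_le_cmod normH[of w]] w m by simp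
    moreover have "m / (m + 1) < m + 1"
      using m by (simp add: divide_less_eq algebra_simps add_pos_nonneg)
    ultimately have "Im (H w) > 0" using w by simp
    then have "w \<in> S" using w m by (simp add: S_def)
    then show ?thesis by blast
  qed
  have cl: "closedin (top_of_set upper_half) (H ` S)"
    unfolding closedin_closed
  proof (intro exI conjI)
    show "closed (closure (H ` S))" by simp
    show "H ` S = upper_half \<inter> closure (H ` S)"
    proof
      show "H ` S \<subseteq> upper_half \<inter> closure (H ` S)" using sub closure_subset[of "H ` S"] by (rule Int_greatest)
      show "upper_half \<inter> closure (H ` S) \<subseteq> H ` S"
      proof
        fix z assume "z \<in> upper_half \<inter> closure (H ` S)"
        then have z: "Im z > 0" "z \<in> closure (H ` S)" by auto
        from z(2) obtain Z where Z: "\<And>n. Z n \<in> H ` S" "Z \<longlonglongrightarrow> z"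
          unfolding closure_sequential by blast
        from Z(1) have "\<forall>n. \<exists>w. w \<in> S \<and> Z n = H w" by blast
        then obtain W where W: "\<And>n. W n \<in> S" "\<And>n. Z n = H (W n)" by metis
        have "(\<lambda>n. Im (Z n)) \<longlonglongrightarrow> Im z" using Z(2) by (rule tendsto_Im)
        then have "eventually (\<lambda>n. Im (Z n) > Im z / 2) sequentially"
          by (rule order_tendstoD) (use z in simp)
        then obtain N where N: "\<And>n. n \<ge> N \<Longrightarrow> Im (Z n) > Im z / 2"
          unfolding eventually_sequentially by blast
        define V where "V n = W (n + N)" for n
        have HV: "(\<lambda>n. H (V n)) \<longlonglongrightarrow> z"
          unfolding V_def W(2)[symmetric] by (rule LIMSEQ_ignore_initial_segment[OF Z(2)])
        \<comment> \<open>Properness: \<open>H\<close> does not raise imaginary parts, so preimages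
          of points near \<open>z\<close> keep a fixed distance from the real axis. There
          \<open>H w - w\<close> is bounded, so these preimages are bounded as well and have a limit
          point inside the upper half-plane.\<close>
        have ImV: "Im (V n) \<ge> Im z / 2" for n
        proof -
          have "Im (V n) > 0" using W(1)[of "n + N"] by (simp add: S_def V_def)
          from ImH[OF this] show ?thesis using N[of "n + N"] W(2)[of "n + N"] by (simp add: V_def)
        qed
        obtain B where B: "\<And>n. norm (H (V n)) \<le> B"
          using convergent_imp_bounded[OF HV] by (auto simp: bounded_iff)
        have "norm (V n) \<le> B + m / (Im z / 2)" for n
        proof -
          have "norm (V n) \<le> norm (H (V n)) + norm (H (V n) - V n)"
            using norm_triangle_sub[of "V n" "H (V n)"] by (simp only: norm_minus_commute)
          also have "norm (H (V n) - V n) \<le> m / Im (V n)"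
            using normH[of "V n"] ImV[of n] z by simp
          also have "m / Im (V n) \<le> m / (Im z / 2)"
            using ImV[of n] z m by (intro divide_left_mono) auto
          finally show ?thesis using B[of n] by simp
        qed
        then have "bounded (range V)" by (auto simp: bounded_iff)
        then obtain w r where r: "strict_mono r" "(V \<circ> r) \<longlonglongrightarrow> w"
          using bounded_imp_convergent_subsequence by blast
        have "Im z / 2 \<le> Im w"
          by (rule Lim_bounded2[OF tendsto_Im[OF r(2)]]) (use ImV in auto)
        then have w: "w \<in> upper_half" using z by simp
        have "isCont H w"
          using cont open_upper_half w by (simp add: continuous_on_eq_continuous_at)
        then have "(\<lambda>n. H ((V \<circ> r) n)) \<longlonglongrightarrow> H w" by (rule isCont_tendsto_compose[OF _ r(2)])
        moreover have "(\<lambda>n. H ((V \<circ> r) n)) \<longlonglongrightarrow> z"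
          using LIMSEQ_subseq_LIMSEQ[OF HV r(1)] by (simp add: comp_def)
        ultimately have "H w = z" by (rule LIMSEQ_unique)
        then show "z \<in> H ` S" using w z by (auto simp: S_def)
      qed
    qed
  qed
  have "convex upper_half" by (rule convex_halfspace_Im_gt)
  then have "connected upper_half" by (rule convex_connected)
  then have img: "H ` S = upper_half"
  proof -
    have "openin (top_of_set upper_half) (H ` S)"
      using op sub by (simp add: openin_open_eq[OF open_upper_half])
    then show ?thesis using cl ne \<open>connected upper_half\<close> unfolding connected_clopen by metis
  qed
  obtain F where F: "F holomorphic_on H ` S" "\<And>w. w \<in> S \<Longrightarrow> F (H w) = w"
    using holomorphic_has_inverse[OF holS S inj] by metis
  have "Im (F z) > 0 \<and> F z + cauchy_transform M (F z) = z" if "z \<in> upper_half" for z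
  proof -
    from that img obtain w where "w \<in> S" "z = H w" by blast
    then show ?thesis using F(2)[of w] by (simp add: S_def H_def)
  qed
  moreover have "F holomorphic_on upper_half" using F(1) by (simp only: img)
  ultimately show ?thesis by blast
qed

section \<open>Nevanlinna's representation of reciprocal Cauchy transforms\<close>

lemma has_bochner_integral_Cauchy:
  "has_bochner_integral lborel (\<lambda>x::real. 1 / (1 + x\<^sup>2)) pi"
proof -
  have "einterval (-\<infinity>) \<infinity> = UNIV" by (auto simp: einterval_def)
  then show ?thesis
    using integrable_inverse_1_plus_square LBINT_inverse_1_plus_square
    by (simp add: has_bochner_integral_iff interval_lebesgue_integral_def set_integrable_def
        set_lebesgue_integral_def inverse_eq_divide)
qed

lemma has_bochner_integral_Poisson:
  assumes "b > 0"
  shows "has_bochner_integral lborel (\<lambda>x::real. 1 / ((x - a)\<^sup>2 + b\<^sup>2)) (pi / b)"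
proof -
  have "has_bochner_integral lborel (\<lambda>x::real. (1 / b\<^sup>2) * (1 / (1 + x\<^sup>2))) ((1 / b\<^sup>2) * pi)"
    by (rule has_bochner_integral_mult_right) (rule has_bochner_integral_Cauchy)
  moreover have "(1 / b\<^sup>2) * (1 / (1 + x\<^sup>2)) = 1 / ((a + b * x - a)\<^sup>2 + b\<^sup>2)" for x
    using assms by (simp add: field_simps power2_eq_square)
  moreover have "(1 / b\<^sup>2) * pi = (pi / b) /\<^sub>R \<bar>b\<bar>"
    using assms by (simp add: field_simps power2_eq_square)
  ultimately show ?thesis
    using assms by (subst lborel_has_bochner_integral_real_affine_iff[of b _ _ a]) auto
qed

text \<open>The segment from \<open>-R\<close> to \<open>R\<close> is closed by the upper
  half-circle, whose length grows like \<open>R\<close> while the integrand decays like the inverse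
  square. Holomorphy slightly below the axis puts the segment inside an open convex domain.\<close>

lemma contour_real_line:
  fixes f :: "complex \<Rightarrow> complex"
  assumes "\<delta> > 0" and hol: "f holomorphic_on {z. Im z > - \<delta>}"
    and bnd: "\<And>z. Im z \<ge> 0 \<Longrightarrow> norm z \<ge> \<rho> \<Longrightarrow> norm (f z) \<le> B / (1 + (norm z)\<^sup>2)"
  shows "has_bochner_integral lborel (\<lambda>x. f (of_real x)) 0"
proof -
  define S where "S = {z. Im z > - \<delta>}"
  have S: "convex S" "open S"
    unfolding S_def by (rule convex_halfspace_Im_gt, rule open_halfspace_Im_gt)
  have contS: "continuous_on S f" using hol unfolding S_def by (rule holomorphic_on_imp_continuous_on)
  \<comment> \<open>Compactness of the half-disc of radius \<open>\<rho>\<close> extends the decay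
    bound to all of \<open>Im z \<ge> 0\<close>, with a larger constant.\<close>
  obtain B1 where B1: "\<And>z. Im z \<ge> 0 \<Longrightarrow> norm (f z) \<le> B1 / (1 + (norm z)\<^sup>2)" and "B1 \<ge> 0"
  proof -
    define C where "C = cball 0 \<rho> \<inter> {z. Im z \<ge> 0}"
    have "compact C" unfolding C_def by (intro compact_Int_closed compact_cball closed_halfspace_Im_ge)
    moreover have "C \<subseteq> S" using assms(1) by (auto simp: C_def S_def)
    ultimately have "bounded (f ` C)"
      using compact_continuous_image continuous_on_subset[OF contS] compact_imp_bounded by blast
    then obtain K where K: "\<And>z. z \<in> C \<Longrightarrow> norm (f z) \<le> K" by (auto simp: bounded_iff)
    define B1 where "B1 = max (max 0 K * (1 + \<rho>\<^sup>2)) (max 0 B)"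
    have "norm (f z) \<le> B1 / (1 + (norm z)\<^sup>2)" if z: "Im z \<ge> 0" for z
    proof (cases "norm z \<ge> \<rho>")
      case True
      have "norm (f z) \<le> B / (1 + (norm z)\<^sup>2)" by (rule bnd[OF z True])
      also have "\<dots> \<le> B1 / (1 + (norm z)\<^sup>2)"
        by (rule divide_right_mono) (auto simp: B1_def)
      finally show ?thesis .
    next
      case False
      have "norm (f z) * (1 + (norm z)\<^sup>2) \<le> max 0 K * (1 + \<rho>\<^sup>2)"
      proof (rule mult_mono)
        have "norm (f z) \<le> K" using K[of z] False z by (simp add: C_def)
        then show "norm (f z) \<le> max 0 K" by simp
        show "1 + (norm z)\<^sup>2 \<le> 1 + \<rho>\<^sup>2" using False by (simp add: power_mono)
      qed auto
      also have "\<dots> \<le> B1" by (simp add: B1_def)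
      finally show ?thesis by (simp add: pos_le_divide_eq add_pos_nonneg)
    qed
    then show ?thesis using that[of B1] by (simp add: B1_def)
  qed
  have contR: "continuous_on UNIV (\<lambda>x::real. f (of_real x))"
    by (rule continuous_on_compose2[OF contS]) (use assms(1) in \<open>auto simp: S_def intro!: continuous_intros\<close>)
  have [measurable]: "(\<lambda>x::real. f (of_real x)) \<in> borel_measurable borel"
    using contR by (rule borel_measurable_continuous_onI)
  have fx: "norm (f (of_real x)) \<le> B1 * (1 / (1 + x\<^sup>2))" for x :: real
    using B1[of "of_real x"] by simp
  have int1: "integrable lborel (\<lambda>x::real. B1 * (1 / (1 + x\<^sup>2)))"
    using has_bochner_integral_Cauchy by (intro integrable_mult_right) (simp add: has_bochner_integral_iff)
  have int: "integrable lborel (\<lambda>x. f (of_real x))"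
  proof (rule Bochner_Integration.integrable_bound[OF int1])
    show "AE x in lborel. norm (f (complex_of_real x)) \<le> norm (B1 * (1 / (1 + x\<^sup>2)))"
      using fx \<open>B1 \<ge> 0\<close> by (intro AE_I2) (simp add: abs_of_nonneg)
  qed measurable
  have part: "norm (LINT x|lborel. indicator {- real n..real n} x *\<^sub>R f (of_real x)) \<le> B1 * pi * (real n / (1 + (real n)\<^sup>2))"
    if "n \<ge> 1" for n
  proof -
    define R where "R = real n"
    have R: "R > 0" using that by (simp add: R_def)
    define L where "L = linepath (- complex_of_real R) (of_real R)"
    define A where "A = part_circlepath 0 R 0 pi"
    have fin: "pathfinish L = pathstart A" "pathfinish A = pathstart L"
      by (simp_all add: L_def A_def)
    have "path_image L \<subseteq> S"
    proof -
      have "- complex_of_real R \<in> S" "of_real R \<in> S" using assms(1) by (auto simp: S_def)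
      then show ?thesis unfolding L_def by (simp add: closed_segment_subset S(1))
    qed
    have imA: "Im z \<ge> 0 \<and> norm z = R" if "z \<in> path_image A" for z
    proof -
      from that obtain t where t: "z = of_real R * cis t" "0 \<le> t" "t \<le> pi"
        unfolding A_def path_image_part_circlepath' closed_segment_eq_real_ivl by force
      have "Im z = R * sin t" by (simp add: t(1))
      moreover have "norm z = R" using R by (simp add: t(1) norm_mult)
      ultimately show ?thesis using R sin_ge_zero[OF t(2,3)] by simp
    qed
    then have imS: "path_image A \<subseteq> S" using assms(1) by (force simp: S_def)
    have conL: "f contour_integrable_on L"
      using contS \<open>path_image L \<subseteq> S\<close> unfolding L_def path_image_linepath
      by (intro contour_integrable_continuous_linepath) (rule continuous_on_subset)
    have conA: "f contour_integrable_on A"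
      using contS imS unfolding A_def
      by (intro contour_integrable_continuous_part_circlepath) (rule continuous_on_subset)
    have vL: "valid_path L" "valid_path A" by (simp_all add: L_def A_def)
    have "(f has_contour_integral 0) (L +++ A)"
      using hol[folded S_def] S(1)
    proof (rule Cauchy_theorem_convex_simple)
      show "valid_path (L +++ A)" using vL fin by simp
      show "path_image (L +++ A) \<subseteq> S"
        using imS \<open>path_image L \<subseteq> S\<close> path_image_join_subset[of L A] by blast
    qed (use fin in simp)
    then have "contour_integral (L +++ A) f = 0" by (rule contour_integral_unique)
    then have sum0: "contour_integral L f + contour_integral A f = 0"
      using contour_integral_join[OF conL conA vL] by simp
    have "norm (contour_integral A f) \<le> B1 / (1 + R\<^sup>2) * R * \<bar>pi - 0\<bar>"
      unfolding A_def
    proof (rule contour_integral_bound_part_circlepath)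
      show "f contour_integrable_on part_circlepath 0 R 0 pi" using conA by (simp add: A_def)
      show "0 \<le> B1 / (1 + R\<^sup>2)" using \<open>B1 \<ge> 0\<close> by simp
      show "norm (f z) \<le> B1 / (1 + R\<^sup>2)" if "z \<in> path_image (part_circlepath 0 R 0 pi)" for z
        using imA[of z] that B1[of z] by (simp add: A_def)
    qed (use R in simp)
    moreover have "norm (contour_integral L f) = norm (contour_integral A f)"
      using sum0 by (metis add.commute add_eq_0_iff norm_minus_cancel)
    moreover have "contour_integral L f = (LINT x|lborel. indicator {- R..R} x *\<^sub>R f (of_real x))"
    proof -
      have "contour_integral L f = integral {- R..R} (\<lambda>x. f (of_real x))"
        unfolding L_def using R by (subst contour_integral_linepath_Reals_eq) auto
      also have "\<dots> = (LINT x:{- R..R}|lborel. f (of_real x))"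
        by (rule set_borel_integral_eq_integral(2)[symmetric])
          (simp add: set_integrable_def integrable_mult_indicator[OF _ int])
      finally show ?thesis by (simp add: set_lebesgue_integral_def)
    qed
    ultimately show ?thesis by (simp add: R_def mult.commute mult.left_commute)
  qed
  have "(\<lambda>n. LINT x|lborel. indicator {- real n..real n} x *\<^sub>R f (of_real x)) \<longlonglongrightarrow> (LINT x|lborel. f (of_real x))"
  proof (rule integral_dominated_convergence[OF _ _ int1])
    show "AE x in lborel. (\<lambda>n. indicator {- real n..real n} x *\<^sub>R f (of_real x)) \<longlonglongrightarrow> f (of_real x)"
    proof (rule AE_I2)
      fix x :: real
      obtain N where N: "\<bar>x\<bar> \<le> real N" using real_arch_simple by blast
      show "(\<lambda>n. indicator {- real n..real n} x *\<^sub>R f (of_real x)) \<longlonglongrightarrow> f (of_real x)"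
        by (rule tendsto_eventually, rule eventually_sequentiallyI[of N]) (use N in \<open>auto simp: indicator_def\<close>)
    qed
    show "AE x in lborel. norm (indicator {- real n..real n} x *\<^sub>R f (of_real x)) \<le> B1 * (1 / (1 + x\<^sup>2))" for n
    proof (rule AE_I2)
      fix x :: real
      have "norm (indicator {- real n..real n} x *\<^sub>R f (of_real x)) \<le> norm (f (of_real x))"
        by (simp add: indicator_def)
      then show "norm (indicator {- real n..real n} x *\<^sub>R f (of_real x)) \<le> B1 * (1 / (1 + x\<^sup>2))"
        using fx[of x] by linarith
    qed
  qed measurable
  moreover have "(\<lambda>n. LINT x|lborel. indicator {- real n..real n} x *\<^sub>R f (of_real x)) \<longlonglongrightarrow> 0"
  proof (rule Lim_null_comparison)
    show "eventually (\<lambda>n. norm (LINT x|lborel. indicator {- real n..real n} x *\<^sub>R f (of_real x))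
        \<le> B1 * pi * (real n / (1 + (real n)\<^sup>2))) sequentially"
      by (rule eventually_sequentiallyI[of 1]) (rule part)
    have "(\<lambda>n. real n / (1 + (real n)\<^sup>2)) \<longlonglongrightarrow> 0" by real_asymp
    then show "(\<lambda>n. B1 * pi * (real n / (1 + (real n)\<^sup>2))) \<longlonglongrightarrow> 0"
      by (rule tendsto_mult_right_zero)
  qed
  ultimately have "(LINT x|lborel. f (of_real x)) = 0" by (rule LIMSEQ_unique)
  with int show ?thesis by (simp add: has_bochner_integral_iff)
qed

text \<open>Cauchy's formula on the real line expresses \<open>G z\<close> through the pole at
  \<open>z\<close>, and the pole at \<open>cnj z\<close> contributes zero. Subtracting the conjugate
  of the second formula from the first leaves only \<open>Im (G x)\<close>, which is the Cauchy
  transform of the density \<open>- Im (G x) / pi\<close>.\<close>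

lemma half_plane_representation:
  fixes G :: "complex \<Rightarrow> complex"
  assumes "\<delta> > 0" and hol: "G holomorphic_on {z. Im z > - \<delta>}"
    and bnd1: "\<And>z. Im z \<ge> 0 \<Longrightarrow> norm (G z) * (1 + norm z) \<le> A"
    and bnd2: "\<And>z. Im z \<ge> 0 \<Longrightarrow> norm (G z - 1 / (z + \<i>)) * (1 + norm z)\<^sup>2 \<le> A"
    and neg: "\<And>x. Im (G (of_real x)) \<le> 0"
  shows "\<exists>N. real_distribution N \<and> (\<forall>z\<in>upper_half. cauchy_transform N z = G z)"
proof -
  define f where "f x = - Im (G (complex_of_real x)) / pi" for x :: real
  have A: "A \<ge> 0" using bnd1[of 0] order_trans[OF norm_ge_zero[of "G 0"]] by simp
  have contG: "continuous_on {z. Im z > - \<delta>} G" using hol by (rule holomorphic_on_imp_continuous_on)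
  have contR: "continuous_on UNIV (\<lambda>x::real. G (of_real x))"
    by (rule continuous_on_compose2[OF contG]) (use assms(1) in \<open>auto intro!: continuous_intros\<close>)
  have [measurable]: "(\<lambda>x::real. G (of_real x)) \<in> borel_measurable borel"
    using contR by (rule borel_measurable_continuous_onI)
  have fm [measurable]: "f \<in> borel_measurable borel" unfolding f_def by measurable
  have sq: "1 + t\<^sup>2 \<le> (1 + t)\<^sup>2" if "t \<ge> 0" for t :: real
    using that by (simp add: power2_eq_square algebra_simps)
  have f_nonneg: "f x \<ge> 0" for x using neg[of x] by (simp add: f_def divide_le_0_iff)

  \<comment> \<open>Total mass: \<open>G\<close> alone is only known to decay like
    \<open>1 / norm z\<close>, too slowly for \<open>contour_real_line\<close>. Subtracting
    \<open>1 / (z + \<i>)\<close>, the transform of the Cauchy law, leaves quadratic decay, and the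
    imaginary part of the subtracted term has integral \<open>- pi\<close>.\<close>
  have "has_bochner_integral lborel (\<lambda>x. G (of_real x) - 1 / (of_real x + \<i>)) 0"
  proof (rule contour_real_line[where f="\<lambda>z. G z - 1 / (z + \<i>)" and \<rho>=0 and B=A])
    show "min \<delta> 1 > 0" using assms(1) by simp
    show "(\<lambda>z. G z - 1 / (z + \<i>)) holomorphic_on {z. Im z > - min \<delta> 1}"
    proof (intro holomorphic_intros)
      show "G holomorphic_on {z. Im z > - min \<delta> 1}" by (rule holomorphic_on_subset[OF hol]) auto
      show "z + \<i> \<noteq> 0" if "z \<in> {z. Im z > - min \<delta> 1}" for z
        using that by (auto simp: complex_eq_iff)
    qed
    show "norm (G z - 1 / (z + \<i>)) \<le> A / (1 + (norm z)\<^sup>2)" if "Im z \<ge> 0" for z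
    proof -
      have "norm (G z - 1 / (z + \<i>)) * (1 + (norm z)\<^sup>2) \<le> norm (G z - 1 / (z + \<i>)) * (1 + norm z)\<^sup>2"
        by (intro mult_left_mono sq) auto
      then show ?thesis using bnd2[OF that] by (simp add: pos_le_divide_eq add_pos_nonneg)
    qed
  qed
  then have "has_bochner_integral lborel (\<lambda>x. Im (G (of_real x) - 1 / (of_real x + \<i>))) (Im 0)"
    by (rule has_bochner_integral_bounded_linear[OF bounded_linear_Im])
  then have "has_bochner_integral lborel
      (\<lambda>x. Im (G (of_real x) - 1 / (of_real x + \<i>)) - 1 / (1 + x\<^sup>2)) (Im 0 - pi)"
    by (rule has_bochner_integral_diff[OF _ has_bochner_integral_Cauchy])
  moreover have "Im (G (of_real x) - 1 / (of_real x + \<i>)) - 1 / (1 + x\<^sup>2) = Im (G (of_real x))" for x :: real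
    by (simp add: Im_divide power2_eq_square add.commute)
  ultimately have "has_bochner_integral lborel (\<lambda>x. Im (G (of_real x))) (- pi)"
    by (simp only: zero_complex.sel diff_0)
  from has_bochner_integral_mult_right[OF this, of "- 1 / pi"]
  have f_int: "has_bochner_integral lborel f 1" by (simp add: f_def[abs_def])

  define N where "N = density lborel (\<lambda>x. ennreal (f x))"
  have "emeasure N (space N) = 1"
    using f_int by (simp add: N_def emeasure_density f_nonneg has_bochner_integral_iff nn_integral_eq_integral)
  then have "real_distribution N"
    by (intro real_distribution.intro prob_spaceI real_distribution_axioms.intro) (simp_all add: N_def)
  moreover have "cauchy_transform N z = G z" if "z \<in> upper_half" for z
  proof -
    have z: "Im z > 0" using that by simp
    \<comment> \<open>The constant makes \<open>h z = 0\<close>, so that \<open>q\<close> has a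
      removable singularity. Subtracting \<open>c / (w - cnj z)\<close> instead of the constant
      \<open>G z\<close> preserves the decay of \<open>G\<close>, and what it adds on the real line
      is a multiple of the Poisson kernel, whose integral is known.\<close>
    define c where "c = G z * (z - cnj z)"
    have zc: "z - cnj z = 2 * \<i> * of_real (Im z)" by (simp add: complex_eq_iff)
    have znc: "z - cnj z \<noteq> 0" using z by (simp add: zc)
    define h where "h w = G w - c / (w - cnj z)" for w
    define q where "q w = (if w = z then deriv h z else (h w - h z) / (w - z))" for w
    define S where "S = {w. Im w > - min \<delta> (Im z)}"
    have hz: "h z = 0" using znc by (simp add: h_def c_def)
    have ne: "w - cnj z \<noteq> 0" if "w \<in> S" for w
      using that by (auto simp: S_def complex_eq_iff)
    have GS: "G holomorphic_on S" unfolding S_def by (rule holomorphic_on_subset[OF hol]) auto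
    have "h holomorphic_on S"
      unfolding h_def using GS ne by (intro holomorphic_intros) auto
    moreover have "open S" unfolding S_def by (rule open_halfspace_Im_gt)
    moreover have "z \<in> S" using z assms(1) by (auto simp: S_def)
    ultimately have q: "q holomorphic_on S"
      unfolding q_def[abs_def] by (intro pole_lemma) (auto simp: interior_open)
    define \<rho> where "\<rho> = 2 * norm z + 1"
    define C where "C = A + 2 * norm c"
    have large: "norm (w - z) \<ge> norm w / 2 \<and> norm (w - cnj z) \<ge> norm w / 2 \<and> norm w \<ge> 1" if "norm w \<ge> \<rho>" for w
    proof -
      have "norm w \<le> norm z + norm (w - z)" "norm w \<le> norm z + norm (w - cnj z)"
        using norm_triangle_sub[of w z] norm_triangle_sub[of w "cnj z"] by simp_all
      then show ?thesis using that[unfolded \<rho>_def] norm_ge_zero[of z] by linarith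
    qed
    have Glarge: "norm (G w) \<le> A / norm w" if "Im w \<ge> 0" "norm w \<ge> \<rho>" for w
    proof -
      have "norm (G w) * norm w \<le> norm (G w) * (1 + norm w)" by (intro mult_left_mono) auto
      then have "norm (G w) * norm w \<le> A" using bnd1[OF that(1)] by linarith
      moreover have "0 < norm w" using large[OF that(2)] by linarith
      ultimately show ?thesis by (simp only: pos_le_divide_eq)
    qed
    have bd4: "K / norm w / (norm w / 2) \<le> 4 * K / (1 + (norm w)\<^sup>2)"
      if "K \<ge> 0" "norm w \<ge> \<rho>" for K and w :: complex
    proof -
      have w1: "1 \<le> norm w" using large that by blast
      then have "1 \<le> (norm w)\<^sup>2" by (simp add: one_le_power)
      then have "2 * K * (1 + (norm w)\<^sup>2) \<le> 4 * K * (norm w)\<^sup>2"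
        using that(1) mult_left_mono[of 1 "(norm w)\<^sup>2" "2 * K"] by (simp add: algebra_simps)
      then have "2 * K / (norm w)\<^sup>2 \<le> 4 * K / (1 + (norm w)\<^sup>2)"
        using w1 add_pos_nonneg[of 1 "(norm w)\<^sup>2"] \<open>K \<ge> 0\<close>
        by (simp add: divide_simps mult.commute)
      then show ?thesis by (simp add: power2_eq_square mult.commute)
    qed
    have "has_bochner_integral lborel (\<lambda>x. q (of_real x)) 0"
    proof (rule contour_real_line[where \<rho>=\<rho> and B="4 * C"])
      show "min \<delta> (Im z) > 0" using z assms(1) by simp
      show "q holomorphic_on {w. Im w > - min \<delta> (Im z)}" using q by (simp add: S_def)
      fix w assume w: "Im w \<ge> 0" "norm w \<ge> \<rho>"
      have l: "norm (w - z) \<ge> norm w / 2" "norm (w - cnj z) \<ge> norm w / 2" "norm w \<ge> 1"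
        using large[OF w(2)] by auto
      have "norm (h w) \<le> norm (G w) + norm (c / (w - cnj z))"
        unfolding h_def by (rule norm_triangle_ineq4)
      also have "norm (c / (w - cnj z)) \<le> norm c / (norm w / 2)"
        unfolding norm_divide using l by (intro divide_left_mono mult_pos_pos) auto
      also have "norm (G w) \<le> A / norm w" by (rule Glarge[OF w])
      finally have hC: "norm (h w) \<le> C / norm w" by (simp add: C_def add_divide_distrib mult.commute)
      have "w \<noteq> z" using l by auto
      then have "norm (q w) = norm (h w) / norm (w - z)" by (simp add: q_def hz norm_divide)
      also have "\<dots> \<le> C / norm w / (norm w / 2)"
        using hC l by (intro frac_le order_trans[OF norm_ge_zero hC]) auto
      also have "\<dots> \<le> 4 * C / (1 + (norm w)\<^sup>2)"
        by (rule bd4[OF _ w(2)]) (use A in \<open>simp add: C_def\<close>)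
      finally show "norm (q w) \<le> 4 * C / (1 + (norm w)\<^sup>2)" .
    qed
    moreover have "has_bochner_integral lborel
        (\<lambda>x. c * of_real (1 / ((x - Re z)\<^sup>2 + (Im z)\<^sup>2))) (c * of_real (pi / Im z))"
      by (intro has_bochner_integral_mult_right has_bochner_integral_of_real has_bochner_integral_Poisson z)
    ultimately have "has_bochner_integral lborel
        (\<lambda>x. q (of_real x) + c * of_real (1 / ((x - Re z)\<^sup>2 + (Im z)\<^sup>2))) (0 + c * of_real (pi / Im z))"
      by (rule has_bochner_integral_add)
    moreover have "q (of_real x) + c * of_real (1 / ((x - Re z)\<^sup>2 + (Im z)\<^sup>2)) = G (of_real x) / (of_real x - z)" for x
    proof -
      have n: "of_real x - z \<noteq> 0" "of_real x - cnj z \<noteq> 0" using z by (auto simp: complex_eq_iff)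
      have "(of_real x - z) * (of_real x - cnj z) = of_real ((x - Re z)\<^sup>2 + (Im z)\<^sup>2)"
        by (simp add: complex_eq_iff power2_eq_square algebra_simps)
      moreover have "q (of_real x) = (G (of_real x) - c / (of_real x - cnj z)) / (of_real x - z)"
        using n by (simp add: q_def hz) (simp add: h_def)
      ultimately show ?thesis
        using n by (simp add: of_real_divide diff_divide_distrib mult.commute
            flip: of_real_add of_real_power)
    qed
    moreover have "c * of_real (pi / Im z) = 2 * \<i> * pi * G z"
      using z by (simp add: c_def zc)
    ultimately have I1: "has_bochner_integral lborel (\<lambda>x. G (of_real x) / (of_real x - z)) (2 * \<i> * pi * G z)"
      by simp
    \<comment> \<open>The pole \<open>cnj z\<close> lies below the contour. After conjugation its
      denominator becomes \<open>x - z\<close>, the same as in \<open>I1\<close>.\<close>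
    have "has_bochner_integral lborel (\<lambda>x. G (of_real x) / (of_real x - cnj z)) 0"
    proof (rule contour_real_line[where f="\<lambda>w. G w / (w - cnj z)" and \<rho>=\<rho> and B="4 * A"])
      show "min \<delta> (Im z) > 0" using z assms(1) by simp
      show "(\<lambda>w. G w / (w - cnj z)) holomorphic_on {w. Im w > - min \<delta> (Im z)}"
        using GS ne by (auto simp flip: S_def intro!: holomorphic_intros)
      fix w assume w: "Im w \<ge> 0" "norm w \<ge> \<rho>"
      have "norm (G w / (w - cnj z)) \<le> A / norm w / (norm w / 2)"
        unfolding norm_divide using Glarge[OF w] large[OF w(2)] A by (intro frac_le) auto
      also have "\<dots> \<le> 4 * A / (1 + (norm w)\<^sup>2)" by (rule bd4[OF A w(2)])
      finally show "norm (G w / (w - cnj z)) \<le> 4 * A / (1 + (norm w)\<^sup>2)" .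
    qed
    then have "has_bochner_integral lborel (\<lambda>x. cnj (G (of_real x) / (of_real x - cnj z))) (cnj 0)"
      by (rule has_bochner_integral_bounded_linear[OF bounded_linear_cnj])
    from has_bochner_integral_mult_right[OF has_bochner_integral_diff[OF I1 this], of "1 / (2 * \<i> * pi)"]
    have "has_bochner_integral lborel (\<lambda>x. 1 / (2 * \<i> * pi) *
        (G (of_real x) / (of_real x - z) - cnj (G (of_real x) / (of_real x - cnj z)))) (G z)"
      by simp
    moreover have "1 / (2 * \<i> * pi) * (G (of_real x) / (of_real x - z) - cnj (G (of_real x) / (of_real x - cnj z)))
       = f x *\<^sub>R (1 / (z - of_real x))" for x
    proof -
      have n: "of_real x - z \<noteq> 0" "z - of_real x \<noteq> 0" using z by (auto simp: complex_eq_iff)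
      have "G (of_real x) - cnj (G (of_real x)) = 2 * \<i> * of_real (Im (G (of_real x)))"
        by (simp add: complex_eq_iff)
      then have "1 / (2 * \<i> * pi) * (G (of_real x) / (of_real x - z) - cnj (G (of_real x) / (of_real x - cnj z)))
         = of_real (Im (G (of_real x))) / pi / (of_real x - z)"
        by (simp flip: diff_divide_distrib)
      also have "\<dots> = f x *\<^sub>R (1 / (z - of_real x))"
        using n by (simp add: f_def scaleR_conv_of_real field_simps)
      finally show ?thesis .
    qed
    ultimately have "has_bochner_integral lborel (\<lambda>x. f x *\<^sub>R (1 / (z - of_real x))) (G z)" by simp
    then show ?thesis
      unfolding cauchy_transform_def N_def
      by (subst integral_density) (auto simp: f_nonneg has_bochner_integral_iff)
  qed
  ultimately show ?thesis by blast
qed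

text \<open>The real part of \<open>1 - w * cauchy_transform N w\<close> at
  \<open>w = \<i> * R\<close> is the integral of \<open>x^2 / (x^2 + R^2)\<close>, which is at least
  1/2 outside \<open>[-R, R]\<close>.\<close>

lemma mass_outside_le:
  assumes N: "real_distribution N" and "R > 0"
  shows "measure N {x. \<bar>x\<bar> > R} \<le> 2 * norm (1 - \<i> * of_real R * cauchy_transform N (\<i> * of_real R))"
proof -
  interpret real_distribution N by fact
  have fb: "fin_borel N" by (rule fin_borel_real_distribution[OF N])
  have "measure N {x. \<bar>x\<bar> > R} = (LINT x|N. indicator {x. \<bar>x\<bar> > R} x)"
    by simp
  also have "\<dots> \<le> (LINT x|N. 2 * (x\<^sup>2 / (x\<^sup>2 + R\<^sup>2)))"
  proof (rule integral_mono)
    show "integrable N (\<lambda>x. indicator {x. \<bar>x\<bar> > R} x :: real)"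
      by (rule integrable_bounded[OF fb, of _ 1]) (auto simp: indicator_def)
    show "integrable N (\<lambda>x. 2 * (x\<^sup>2 / (x\<^sup>2 + R\<^sup>2)))"
    proof (rule integrable_bounded[OF fb, of _ 2])
      fix x
      have "x\<^sup>2 + R\<^sup>2 > 0" using assms(2) by (simp add: add_nonneg_pos)
      then have "x\<^sup>2 / (x\<^sup>2 + R\<^sup>2) \<le> 1" by (simp add: divide_le_eq)
      then show "norm (2 * (x\<^sup>2 / (x\<^sup>2 + R\<^sup>2))) \<le> 2" by simp
    qed measurable
    show "indicator {x. \<bar>x\<bar> > R} x \<le> 2 * (x\<^sup>2 / (x\<^sup>2 + R\<^sup>2))" for x
    proof (cases "\<bar>x\<bar> > R")
      case True
      then have "R\<^sup>2 \<le> x\<^sup>2" using assms(2) by (simp add: abs_le_square_iff[symmetric])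
      moreover have "R\<^sup>2 > 0" using assms(2) by simp
      ultimately show ?thesis using True by (simp add: pos_le_divide_eq add_nonneg_pos)
    qed (auto simp: indicator_def)
  qed
  also have "\<dots> = 2 * (LINT x|N. Re (1 - \<i> * of_real R * (1 / (\<i> * of_real R - of_real x))))"
  proof -
    have "x\<^sup>2 / (x\<^sup>2 + R\<^sup>2) = Re (1 - \<i> * of_real R * (1 / (\<i> * of_real R - of_real x)))" for x
    proof -
      have "x\<^sup>2 + R\<^sup>2 > 0" using assms(2) by (simp add: add_nonneg_pos)
      then have "1 = x\<^sup>2 / (x\<^sup>2 + R\<^sup>2) + R\<^sup>2 / (x\<^sup>2 + R\<^sup>2)"
        unfolding add_divide_distrib[symmetric] using assms(2) by simp
      moreover have "Re (1 - \<i> * of_real R * (1 / (\<i> * of_real R - of_real x))) = 1 - R\<^sup>2 / (x\<^sup>2 + R\<^sup>2)"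
        by (simp add: Re_divide power2_eq_square)
      ultimately show ?thesis by linarith
    qed
    then show ?thesis by (simp only: integral_mult_right_zero)
  qed
  also have "(LINT x|N. Re (1 - \<i> * of_real R * (1 / (\<i> * of_real R - of_real x)))) =
      Re (1 - \<i> * of_real R * cauchy_transform N (\<i> * of_real R))"
  proof -
    have i: "integrable N (\<lambda>x. 1 / (\<i> * of_real R - of_real x))"
      by (rule integrable_resolvent[OF fb]) (use assms(2) in simp)
    have "(LINT x|N. Re (1 - \<i> * of_real R * (1 / (\<i> * of_real R - of_real x)))) =
       Re (LINT x|N. 1 - \<i> * of_real R * (1 / (\<i> * of_real R - of_real x)))"
      by (rule integral_Re) (intro Bochner_Integration.integrable_diff integrable_mult_right i, simp)
    also have "(LINT x|N. 1 - \<i> * of_real R * (1 / (\<i> * of_real R - of_real x))) =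
        (LINT x|N. 1) - (LINT x|N. \<i> * of_real R * (1 / (\<i> * of_real R - of_real x)))"
    proof (rule Bochner_Integration.integral_diff)
      show "integrable N (\<lambda>x. \<i> * of_real R * (1 / (\<i> * of_real R - of_real x)))"
        by (intro integrable_mult_right i)
    qed simp
    also have "(LINT x|N. 1::complex) = 1" using prob_space by (simp add: space_eq_univ)
    also have "(LINT x|N. \<i> * of_real R * (1 / (\<i> * of_real R - of_real x))) =
        \<i> * of_real R * cauchy_transform N (\<i> * of_real R)"
      unfolding cauchy_transform_def by (rule integral_mult_right_zero)
    finally show ?thesis .
  qed
  also have "2 * \<dots> \<le> 2 * norm (1 - \<i> * of_real R * cauchy_transform N (\<i> * of_real R))"
    by (intro mult_left_mono complex_Re_le_cmod) simp
  finally show ?thesis .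
qed

text \<open>Nevanlinna: the measure is a weak limit of the laws with densities \<open>- Im (1 / F (x + \<i> y)) / pi\<close>.\<close>

lemma reciprocal_cauchy_exists:
  fixes F :: "complex \<Rightarrow> complex"
  assumes hol: "F holomorphic_on upper_half"
    and Im_F: "\<And>z. Im z > 0 \<Longrightarrow> Im (F z) \<ge> Im z"
    and F_near: "\<And>z. Im z > 0 \<Longrightarrow> norm (F z - z) \<le> K / Im z"
  shows "\<exists>N. real_distribution N \<and> (\<forall>z\<in>upper_half. cauchy_transform N z = 1 / F z)"
proof -
  have K: "K \<ge> 0" using order_trans[OF norm_ge_zero F_near[of \<i>]] by simp
  \<comment> \<open>The shift by \<open>\<i> * y\<close> makes the reciprocal holomorphic across the
    real axis, down to height \<open>- y\<close>, as the half-plane representation requires.\<close>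
  have ex: "\<exists>N. real_distribution N \<and> (\<forall>z\<in>upper_half. cauchy_transform N z = 1 / F (z + \<i> * of_real y))"
    if y: "y > 0" for y
  proof -
    define d where "d = y + K / y"
    \<comment> \<open>With \<open>w = z + \<i> * y\<close>, the number \<open>d\<close> bounds the
      distance from \<open>F w\<close> to \<open>z\<close>, and \<open>norm (F w) \<ge> y\<close>
      converts the constants \<open>1\<close> and \<open>d\<close> into multiples of
      \<open>norm (F w)\<close>; this gives \<open>1 + norm z \<le> A * norm (F w)\<close>. The
      number \<open>C\<close> bounds the distance from \<open>F w\<close> to
      \<open>z + \<i>\<close>.\<close>
    define A where "A = 1 / y + 1 + d / y"
    define C where "C = 1 + y + K / y"
    have A: "A > 0" and C: "C > 0" using y K by (auto simp: A_def C_def d_def add_pos_nonneg)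
    have lower: "norm (F (z + \<i> * of_real y)) \<ge> y \<and> 1 + norm z \<le> A * norm (F (z + \<i> * of_real y))
        \<and> norm (z + \<i> - F (z + \<i> * of_real y)) \<le> C \<and> 1 + norm z \<le> 2 * norm (z + \<i>)"
      if z: "Im z \<ge> 0" for z
    proof -
      define w where "w = z + \<i> * of_real y"
      have w: "Im w = Im z + y" "Im w > 0" using z y by (simp_all add: w_def)
      have F1: "norm (F w) \<ge> y"
        using order_trans[OF Im_F[OF w(2)] order_trans[OF abs_ge_self abs_Im_le_cmod]] w z by linarith
      have "norm (F w - w) \<le> K / Im w" by (rule F_near[OF w(2)])
      also have "\<dots> \<le> K / y" using K y w z by (intro divide_left_mono mult_pos_pos) auto
      finally have F2: "norm (F w - w) \<le> K / y" .
      have wz: "norm (w - z) = y" using y by (simp add: w_def norm_mult)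
      have "norm z \<le> norm (F w) + norm (F w - w) + norm (w - z)"
        using norm_triangle_ineq4[of "F w" "F w - w"] norm_triangle_ineq4[of w "w - z"] by simp
      then have "1 + norm z \<le> 1 + norm (F w) + d" using F2 wz unfolding d_def by linarith
      also have "\<dots> \<le> A * norm (F w)"
      proof -
        have q: "1 \<le> norm (F w) / y" using F1 y by (simp add: le_divide_eq)
        have "d * 1 \<le> d * (norm (F w) / y)"
          using K y q by (intro mult_left_mono) (auto simp: d_def)
        moreover have "A * norm (F w) = norm (F w) / y + norm (F w) + d * (norm (F w) / y)"
          unfolding A_def by (simp add: distrib_right)
        ultimately show ?thesis using q by linarith
      qed
      finally have 1: "1 + norm z \<le> A * norm (F w)" .
      have "norm (z + \<i> - F w) \<le> norm (\<i> - \<i> * of_real y) + norm (F w - w)"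
        using norm_triangle_ineq4[of "\<i> - \<i> * of_real y" "F w - w"] by (simp add: w_def algebra_simps)
      also have "norm (\<i> - \<i> * of_real y) \<le> 1 + y"
        using norm_triangle_ineq4[of \<i> "\<i> * of_real y"] y by (simp add: norm_mult)
      finally have 2: "norm (z + \<i> - F w) \<le> C" using F2 by (simp add: C_def)
      have "norm z \<le> norm (z + \<i>)"
        unfolding cmod_def using z by (simp add: power_mono)
      moreover have "1 \<le> norm (z + \<i>)" using abs_Im_le_cmod[of "z + \<i>"] z by simp
      ultimately show ?thesis using F1 1 2 by (simp add: w_def)
    qed
    show ?thesis
    proof (rule half_plane_representation[where A="A + 2 * A * C" and \<delta>=y])
      show "(\<lambda>z. 1 / F (z + \<i> * of_real y)) holomorphic_on {z. - y < Im z}"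
      proof (intro holomorphic_intros)
        have "F \<circ> (\<lambda>z. z + \<i> * of_real y) holomorphic_on {z. - y < Im z}"
          by (rule holomorphic_on_compose_gen[OF _ hol]) (auto intro!: holomorphic_intros)
        then show "(\<lambda>z. F (z + \<i> * of_real y)) holomorphic_on {z. - y < Im z}" by (simp add: comp_def)
        show "F (z + \<i> * of_real y) \<noteq> 0" if "z \<in> {z. - y < Im z}" for z
          using Im_F[of "z + \<i> * of_real y"] that by auto
      qed
      show "norm (1 / F (z + \<i> * of_real y)) * (1 + norm z) \<le> A + 2 * A * C" if z: "Im z \<ge> 0" for z
      proof -
        have "norm (1 / F (z + \<i> * of_real y)) * (1 + norm z) \<le> A"
          using lower[OF z] y A by (simp add: norm_divide divide_le_eq mult.commute)
        then show ?thesis using A C mult_pos_pos[of A C] by linarith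
      qed
      show "norm (1 / F (z + \<i> * of_real y) - 1 / (z + \<i>)) * (1 + norm z)\<^sup>2 \<le> A + 2 * A * C"
        if z: "Im z \<ge> 0" for z
      proof -
        define f where "f = F (z + \<i> * of_real y)"
        note l = lower[OF z, folded f_def]
        have "norm f > 0" "norm (z + \<i>) > 0" using l y norm_ge_zero[of z] by linarith+
        then have n: "f \<noteq> 0" "z + \<i> \<noteq> 0" by auto
        have "(1 + norm z)\<^sup>2 \<le> (A * norm f) * (2 * norm (z + \<i>))"
          unfolding power2_eq_square using l A by (intro mult_mono) auto
        then have "norm (z + \<i> - f) * (1 + norm z)\<^sup>2 \<le> C * ((A * norm f) * (2 * norm (z + \<i>)))"
          using l C by (intro mult_mono) auto
        moreover have "1 / f - 1 / (z + \<i>) = (z + \<i> - f) / (f * (z + \<i>))"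
          using n by (simp add: field_simps)
        ultimately have "norm (1 / f - 1 / (z + \<i>)) * (1 + norm z)\<^sup>2 \<le> 2 * A * C"
          using n by (simp add: norm_divide norm_mult divide_le_eq mult_ac)
        then show ?thesis using A unfolding f_def by linarith
      qed
      show "Im (1 / F (of_real x + \<i> * of_real y)) \<le> 0" for x
        using Im_F[of "of_real x + \<i> * of_real y"] y by (simp add: Im_divide divide_nonneg_nonneg)
    qed (fact y)
  qed
  define Y where "Y n = 1 / real (Suc n)" for n
  have Y: "Y n > 0" "Y n \<le> 1" for n by (auto simp: Y_def)
  have "\<forall>n. \<exists>N. real_distribution N \<and> (\<forall>z\<in>upper_half. cauchy_transform N z = 1 / F (z + \<i> * of_real (Y n)))"
    using ex Y(1) by blast
  then obtain \<mu> where \<mu>: "\<And>n. real_distribution (\<mu> n)"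
    and ct: "\<And>n z. Im z > 0 \<Longrightarrow> cauchy_transform (\<mu> n) z = 1 / F (z + \<i> * of_real (Y n))"
    by (auto dest!: choice)
  have "tight \<mu>"
    unfolding tight_def
  proof (intro conjI allI impI \<mu>)
    fix e :: real assume e: "e > 0"
    \<comment> \<open>The mass outside \<open>[-R, R]\<close> will be at most
      \<open>2 * (K + 1) / R\<close>: the \<open>K\<close> comes from \<open>F_near\<close> at a
      height above 1, the added 1 from the shift \<open>Y n \<le> 1\<close>.\<close>
    define R where "R = 1 + 2 * (K + 1) / e"
    have R: "R > 1" using e K by (simp add: R_def)
    have Re: "2 * (K + 1) / R < e"
      using e K R by (simp add: R_def field_simps)
    show "\<exists>a b. a < b \<and> (\<forall>n. 1 - e < measure (\<mu> n) {a<..b})"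
    proof (intro exI conjI allI)
      \<comment> \<open>Tightness asks for a half-open interval; the extra 1 keeps the endpoint
        \<open>-R\<close> inside.\<close>
      show "- R - 1 < R" using R by simp
      fix n
      interpret real_distribution "\<mu> n" by (rule \<mu>)
      define w where "w = \<i> * of_real R + \<i> * of_real (Y n)"
      have w: "Im w = R + Y n" "Im w > 0" using Y[of n] R by (simp_all add: w_def)
      have Fw: "norm (F w) \<ge> R"
        using order_trans[OF Im_F[OF w(2)] order_trans[OF abs_ge_self abs_Im_le_cmod]] w Y[of n] by linarith
      have n0: "F w \<noteq> 0" using Fw R by auto
      have "norm (F w - \<i> * of_real R) \<le> norm (F w - w) + norm (\<i> * of_real (Y n))"
        using norm_triangle_ineq[of "F w - w" "\<i> * of_real (Y n)"] by (simp add: w_def)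
      also have "norm (F w - w) \<le> K / Im w" by (rule F_near[OF w(2)])
      also have "\<dots> \<le> K / 1" using K R w Y[of n] by (intro divide_left_mono mult_pos_pos) auto
      finally have "norm (F w - \<i> * of_real R) \<le> K + 1" using Y[of n] by (simp add: norm_mult)
      then have "norm ((F w - \<i> * of_real R) / F w) \<le> (K + 1) / R"
        unfolding norm_divide using Fw R K by (intro frac_le) auto
      also have "(F w - \<i> * of_real R) / F w = 1 - \<i> * of_real R * cauchy_transform (\<mu> n) (\<i> * of_real R)"
        using n0 R by (subst ct) (auto simp: w_def diff_divide_distrib)
      finally have "measure (\<mu> n) {x. \<bar>x\<bar> > R} \<le> 2 * ((K + 1) / R)"
        using mass_outside_le[OF \<mu>, of R n] R by linarith
      then have "measure (\<mu> n) {x. \<bar>x\<bar> > R} < e" using Re by simp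
      moreover have "measure (\<mu> n) (UNIV - {x. \<bar>x\<bar> > R}) = 1 - measure (\<mu> n) {x. \<bar>x\<bar> > R}"
        using prob_compl[of "{x. \<bar>x\<bar> > R}"] by simp
      moreover have "measure (\<mu> n) (UNIV - {x. \<bar>x\<bar> > R}) \<le> measure (\<mu> n) {- R - 1<..R}"
        by (rule finite_measure_mono) auto
      ultimately show "1 - e < measure (\<mu> n) {- R - 1<..R}" by linarith
    qed
  qed
  then obtain r M where r: "strict_mono r" "real_distribution M" "weak_conv_m (\<mu> \<circ> id \<circ> r) M"
    using tight_imp_convergent_subsubsequence[OF _ strict_mono_id] by blast
  have "cauchy_transform M z = 1 / F z" if z: "Im z > 0" for z
  proof -
    have "(\<lambda>n. cauchy_transform ((\<mu> \<circ> id \<circ> r) n) z) \<longlonglongrightarrow> cauchy_transform M z"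
      unfolding cauchy_transform_def
    proof (rule weak_conv_imp_integral_bdd_continuous_conv[OF _ r(2,3)])
      show "isCont (\<lambda>x. 1 / (z - of_real x)) x" for x
        using z by (intro continuous_intros) (auto simp: complex_eq_iff)
      show "norm (1 / (z - of_real x)) \<le> 1 / Im z" for x by (rule norm_resolvent_le[OF z])
    qed (simp add: \<mu>)
    moreover have "(\<lambda>n. cauchy_transform ((\<mu> \<circ> id \<circ> r) n) z) \<longlonglongrightarrow> 1 / F z"
    proof -
      have "(\<lambda>n. Y (r n)) \<longlonglongrightarrow> 0"
        using LIMSEQ_subseq_LIMSEQ[OF LIMSEQ_Suc[OF lim_inverse_n'] r(1)] by (simp add: Y_def comp_def)
      then have "(\<lambda>n. z + \<i> * of_real (Y (r n))) \<longlonglongrightarrow> z + \<i> * of_real 0"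
        by (intro tendsto_intros)
      then have l: "(\<lambda>n. z + \<i> * of_real (Y (r n))) \<longlonglongrightarrow> z" by simp
      have "isCont F z"
        using holomorphic_on_imp_continuous_on[OF hol] open_upper_half z
        by (simp add: continuous_on_eq_continuous_at)
      then have "(\<lambda>n. F (z + \<i> * of_real (Y (r n)))) \<longlonglongrightarrow> F z"
        by (rule isCont_tendsto_compose[OF _ l])
      then have "(\<lambda>n. 1 / F (z + \<i> * of_real (Y (r n)))) \<longlonglongrightarrow> 1 / F z"
        by (intro tendsto_intros) (use Im_F[OF z] z in auto)
      then show ?thesis by (simp add: ct[OF z])
    qed
    ultimately show ?thesis by (rule LIMSEQ_unique)
  qed
  then show ?thesis using r(2) by auto
qed

section \<open>Freely infinitely divisible laws with finite variance\<close>

text \<open>The measure \<open>\<tau>\<close> is \<open>x\<^sup>2\<close> times the free Levy measure of \<open>M\<close>, plus the semicircular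
  component as an atom at zero.\<close>

definition additive_generator :: "real measure \<Rightarrow> real measure \<Rightarrow> bool" where
  "additive_generator M \<tau> \<longleftrightarrow> real_distribution M \<and> fin_borel \<tau> \<and>
     (\<forall>z\<in>upper_half. Im (recip_cauchy M z) > 0 \<and>
        recip_cauchy M z + cauchy_transform \<tau> (recip_cauchy M z) = z)"

section \<open>Reflection, symmetrization and existence of laws with a given generator\<close>

lemma reflected_cauchy_transform:
  assumes M: "fin_borel M" and z: "Im z > 0"
  shows "cauchy_transform (distr M borel uminus) z = - cnj (cauchy_transform M (- cnj z))"
proof -
  have m: "uminus \<in> measurable M borel" by (rule borel_measurable_fin_borel[OF M]) simp
  have "cauchy_transform (distr M borel uminus) z = (LINT x|M. 1 / (z + of_real x))"
    unfolding cauchy_transform_def by (subst integral_distr[OF m]) auto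
  also have "\<dots> = (LINT x|M. - cnj (1 / (- cnj z - of_real x)))"
  proof (rule Bochner_Integration.integral_cong)
    fix x
    have "cnj (1 / (- cnj z - of_real x)) = 1 / (- z - of_real x)" by simp
    moreover have "- z - of_real x = - (z + of_real x)" by simp
    ultimately show "1 / (z + of_real x) = - cnj (1 / (- cnj z - of_real x))"
      by (simp only: divide_minus_right minus_minus)
  qed simp
  also have "\<dots> = - cnj (cauchy_transform M (- cnj z))"
    unfolding cauchy_transform_def by (simp only: Bochner_Integration.integral_minus Bochner_Integration.integral_cnj)
  finally show ?thesis .
qed

lemma distr_uminus_eqI:
  assumes M: "real_distribution M" and even: "\<And>t. char M (- t) = char M t"
  shows "distr M borel uminus = M"
proof -
  interpret real_distribution M by fact
  have m: "uminus \<in> measurable M borel"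
    by (rule measurable_uminus_fin_borel[OF fin_borel_real_distribution[OF M]])
  have "real_distribution (distr M borel uminus)" using m by (rule real_distribution_distr)
  moreover have "char (distr M borel uminus) = char M"
  proof
    fix t
    have "char (distr M borel uminus) t = (CLINT x|M. iexp (t * - x))"
      unfolding char_def by (subst integral_distr[OF m]) auto
    also have "\<dots> = char M (- t)" unfolding char_def by simp
    finally show "char (distr M borel uminus) t = char M t" by (simp add: even)
  qed
  ultimately show ?thesis by (intro Levy_uniqueness M)
qed

text \<open>The law of \<open>X\<close> with an independent fair sign. As an image of a product
  probability space it is a probability measure from the outset; it turns a law with the same Cauchy
  transform as its reflection into a symmetric law with that transform.\<close>

definition symmetrize :: "real measure \<Rightarrow> real measure" where
  "symmetrize M = distr (measure_pmf (bernoulli_pmf (1 / 2)) \<Otimes>\<^sub>M M) borel (\<lambda>(b, x). if b then x else - x)"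

lemma
  assumes M: "real_distribution M"
  shows real_distribution_symmetrize: "real_distribution (symmetrize M)"
    and integral_symmetrize: "\<And>f :: real \<Rightarrow> complex. f \<in> borel_measurable borel \<Longrightarrow> (\<And>x. norm (f x) \<le> B) \<Longrightarrow>
      (LINT x|symmetrize M. f x) = ((LINT x|M. f x) + (LINT x|distr M borel uminus. f x)) / 2"
proof -
  interpret real_distribution M by fact
  interpret P: pair_prob_space "measure_pmf (bernoulli_pmf (1 / 2))" M
    by (intro pair_prob_space.intro pair_sigma_finite.intro) unfold_locales
  let ?P = "measure_pmf (bernoulli_pmf (1 / 2)) \<Otimes>\<^sub>M M"
  have m [measurable]: "(\<lambda>(b, x). if b then x else - x) \<in> borel_measurable ?P"
  proof -
    have [measurable_cong]: "sets M = sets borel" by simp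
    have "Measurable.pred (measure_pmf (bernoulli_pmf (1 / 2)) \<Otimes>\<^sub>M M) fst"
      by measurable
    then show ?thesis unfolding case_prod_beta by measurable
  qed
  show "real_distribution (symmetrize M)"
    unfolding symmetrize_def by (rule P.real_distribution_distr[OF m])
  fix f :: "real \<Rightarrow> complex" assume f [measurable]: "f \<in> borel_measurable borel" and B: "\<And>x. norm (f x) \<le> B"
  have um: "uminus \<in> measurable M borel" by (rule measurable_uminus_fin_borel[OF fin_borel_real_distribution[OF M]])
  have int: "integrable ?P (\<lambda>p. f (case p of (b, x) \<Rightarrow> if b then x else - x))"
    by (rule P.P.integrable_const_bound[where B=B]) (use B in auto)
  have "(LINT x|symmetrize M. f x) = (LINT p|?P. f (case p of (b, x) \<Rightarrow> if b then x else - x))"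
    unfolding symmetrize_def by (rule integral_distr[OF m f])
  also have "\<dots> = (LINT b|bernoulli_pmf (1 / 2). LINT x|M. f (if b then x else - x))"
    using P.integral_fst'[OF int] by simp
  also have "\<dots> = (\<Sum>b\<in>UNIV. pmf (bernoulli_pmf (1 / 2)) b *\<^sub>R (LINT x|M. f (if b then x else - x)))"
    by (rule integral_measure_pmf) auto
  also have "\<dots> = ((LINT x|M. f x) + (LINT x|M. f (- x))) / 2"
    by (simp add: UNIV_bool scaleR_conv_of_real add_divide_distrib)
  also have "(LINT x|M. f (- x)) = (LINT x|distr M borel uminus. f x)"
    by (rule integral_distr[OF um f, symmetric])
  finally show "(LINT x|symmetrize M. f x) = ((LINT x|M. f x) + (LINT x|distr M borel uminus. f x)) / 2" .
qed

lemma symmetrize_in_prob_sym: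
  assumes M: "real_distribution M"
  shows "symmetrize M \<in> prob_sym"
proof -
  interpret real_distribution M by fact
  have um: "uminus \<in> measurable M borel" by (rule measurable_uminus_fin_borel[OF fin_borel_real_distribution[OF M]])
  have eq: "char (symmetrize M) t = (char M t + char M (- t)) / 2" for t
  proof -
    have "char (symmetrize M) t = ((LINT x|M. iexp (t * x)) + (LINT x|distr M borel uminus. iexp (t * x))) / 2"
      unfolding char_def by (rule integral_symmetrize[OF M, where B=1]) auto
    also have "(LINT x|distr M borel uminus. iexp (t * x)) = (LINT x|M. iexp (t * - x))"
      by (rule integral_distr[OF um]) auto
    finally show ?thesis by (simp add: char_def)
  qed
  have "char (symmetrize M) (- t) = char (symmetrize M) t" for t
    unfolding eq[of "- t"] eq[of t] by (simp add: add.commute)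
  then show ?thesis
    using distr_uminus_eqI real_distribution_symmetrize[OF M] by (simp add: prob_sym_def prob_R_def)
qed

text \<open>The right inverse \<open>F\<close> from \<open>subordination_exists\<close> raises
  imaginary parts and differs from the identity by a Cauchy transform, so it meets both hypotheses
  of \<open>reciprocal_cauchy_exists\<close>.\<close>

lemma additive_generator_exists:
  assumes \<tau>: "fin_borel \<tau>"
  shows "\<exists>M. additive_generator M \<tau>"
    and "distr \<tau> borel uminus = \<tau> \<Longrightarrow> \<exists>M\<in>prob_sym. additive_generator M \<tau>"
proof -
  obtain F where hol: "F holomorphic_on upper_half"
    and F: "\<And>z. Im z > 0 \<Longrightarrow> Im (F z) > 0" "\<And>z. Im z > 0 \<Longrightarrow> F z + cauchy_transform \<tau> (F z) = z"
    using subordination_exists[OF \<tau>] by auto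
  have Im_F: "Im (F z) \<ge> Im z" if "Im z > 0" for z
    using Im_cauchy_transform_le[OF \<tau> F(1)[OF that]] arg_cong[OF F(2)[OF that], of Im] by simp
  have "norm (F z - z) \<le> measure \<tau> (space \<tau>) / Im z" if z: "Im z > 0" for z
  proof -
    have "norm (F z - z) = norm (cauchy_transform \<tau> (F z))"
      using arg_cong[OF F(2)[OF z], of "\<lambda>u. norm (F z - u)"] by simp
    also have "\<dots> \<le> measure \<tau> (space \<tau>) / Im (F z)" by (rule cauchy_transform_norm_le[OF \<tau> F(1)[OF z]])
    also have "\<dots> \<le> measure \<tau> (space \<tau>) / Im z"
      using Im_F[OF z] z by (intro divide_left_mono mult_pos_pos) auto
    finally show ?thesis .
  qed
  from reciprocal_cauchy_exists[OF hol Im_F this]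
  obtain N where N: "real_distribution N" "\<And>z. Im z > 0 \<Longrightarrow> cauchy_transform N z = 1 / F z"
    by auto
  have gen: "additive_generator M \<tau>"
    if "real_distribution M" "\<And>z. Im z > 0 \<Longrightarrow> cauchy_transform M z = 1 / F z" for M
    using that \<tau> F by (simp add: additive_generator_def recip_cauchy_def)
  show "\<exists>M. additive_generator M \<tau>" using gen[OF N] by blast
  show "\<exists>M\<in>prob_sym. additive_generator M \<tau>" if sym: "distr \<tau> borel uminus = \<tau>"
  proof (rule bexI[OF _ symmetrize_in_prob_sym[OF N(1)]], rule gen)
    show "real_distribution (symmetrize N)" by (rule real_distribution_symmetrize[OF N(1)])
    fix z :: complex assume z: "Im z > 0"
    have zc: "Im (- cnj z) > 0" using z by simp
    have w: "Im (- cnj (F z)) > 0" using F(1)[OF z] by simp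
    have "cauchy_transform \<tau> (- cnj (F z)) = - cnj (cauchy_transform \<tau> (F z))"
      using reflected_cauchy_transform[OF \<tau> w] sym by simp
    then have e: "- cnj (F z) + cauchy_transform \<tau> (- cnj (F z)) = - cnj z"
      using arg_cong[OF F(2)[OF z], of "\<lambda>u. - cnj u"] by simp
    \<comment> \<open>Both sides are mapped to \<open>- cnj z\<close> by
      \<open>w + cauchy_transform \<tau> w\<close>, by the symmetry of \<open>\<tau>\<close>.
      Injectivity makes them equal, and hence \<open>N\<close> and its reflection have the same
      Cauchy transform.\<close>
    have "F (- cnj z) = - cnj (F z)"
    proof (rule subordination_inj[OF \<tau> F(1)[OF zc] w])
      show "Im (F (- cnj z) + cauchy_transform \<tau> (F (- cnj z))) > 0" by (simp only: F(2)[OF zc] zc)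
      show "F (- cnj z) + cauchy_transform \<tau> (F (- cnj z)) = - cnj (F z) + cauchy_transform \<tau> (- cnj (F z))"
        by (simp only: F(2)[OF zc] e)
    qed
    then have "cauchy_transform (distr N borel uminus) z = 1 / F z"
      using reflected_cauchy_transform[OF fin_borel_real_distribution[OF N(1)] z] N(2)[OF zc] by simp
    moreover have "cauchy_transform (symmetrize N) z =
        (cauchy_transform N z + cauchy_transform (distr N borel uminus) z) / 2"
      unfolding cauchy_transform_def
      by (rule integral_symmetrize[OF N(1) _ norm_resolvent_le[OF z]]) measurable
    ultimately show "cauchy_transform (symmetrize N) z = 1 / F z"
      by (simp only: N(2)[OF z] add_divide_distrib[symmetric]) simp
  qed
qed

section \<open>Free cumulants, convolution powers and triplets from a generator\<close>

lemma additive_generatorD: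
  assumes "additive_generator M \<tau>"
  shows "real_distribution M" "fin_borel \<tau>"
    "\<And>z. Im z > 0 \<Longrightarrow> Im (recip_cauchy M z) > 0"
    "\<And>z. Im z > 0 \<Longrightarrow> recip_cauchy M z + cauchy_transform \<tau> (recip_cauchy M z) = z"
  using assms by (simp_all add: additive_generator_def)

text \<open>The definition of a generator gives only one order of composition; injectivity supplies
  the other.\<close>

lemma recip_cauchy_subordination:
  assumes gen: "additive_generator M \<tau>" and w: "Im w > 0" "Im (w + cauchy_transform \<tau> w) > 0"
  shows "recip_cauchy M (w + cauchy_transform \<tau> w) = w"
proof (rule subordination_inj[OF additive_generatorD(2)[OF gen] additive_generatorD(3)[OF gen w(2)] w(1)])
  note e = additive_generatorD(4)[OF gen w(2)]
  show "Im (recip_cauchy M (w + cauchy_transform \<tau> w)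
      + cauchy_transform \<tau> (recip_cauchy M (w + cauchy_transform \<tau> w))) > 0"
    using w(2) by (simp only: e)
qed (rule additive_generatorD(4)[OF gen w(2)])

lemma trunc_cone_mono: "R \<le> R' \<Longrightarrow> z \<in> trunc_cone \<eta> R' \<Longrightarrow> z \<in> trunc_cone \<eta> R"
  by (auto simp: trunc_cone_def)

lemma right_inverse_on_generator:
  assumes gen: "additive_generator M \<tau>"
  shows "\<exists>R>0. right_inverse_on M 1 R (\<lambda>w. w + cauchy_transform \<tau> w)"
proof -
  note \<tau> = additive_generatorD(2)[OF gen]
  define m where "m = measure \<tau> (space \<tau>)"
  \<comment> \<open>Above this height the Cauchy transform has modulus below \<open>R\<close>, so
    the candidate inverse stays in the upper half-plane.\<close>
  define R where "R = m + 1"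
  have m: "m \<ge> 0" by (simp add: m_def)
  have R: "R > 0" using m by (simp add: R_def)
  have small: "norm (cauchy_transform \<tau> w) < R" if "Im w > R" for w
  proof -
    have "norm (cauchy_transform \<tau> w) \<le> m / Im w"
      using cauchy_transform_norm_le[OF \<tau>, of w] that R by (simp add: m_def)
    also have "\<dots> \<le> m / 1"
      using that m R by (intro divide_left_mono mult_pos_pos) (auto simp: R_def)
    finally show ?thesis by (simp add: R_def)
  qed
  have pos: "Im (w + cauchy_transform \<tau> w) > 0" if "Im w > R" for w
    using small[OF that] abs_Im_le_cmod[of "cauchy_transform \<tau> w"] that by simp
  have sub: "trunc_cone 1 R \<subseteq> upper_half" using R by (auto simp: trunc_cone_def)
  have "right_inverse_on M 1 R (\<lambda>w. w + cauchy_transform \<tau> w)"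
    unfolding right_inverse_on_def
  proof (intro conjI ballI)
    show "(\<lambda>w. w + cauchy_transform \<tau> w) holomorphic_on trunc_cone 1 R"
      by (intro holomorphic_intros holomorphic_on_subset[OF holomorphic_cauchy_transform[OF \<tau>] sub])
    fix w assume "w \<in> trunc_cone 1 R"
    then have w: "Im w > R" "Im w > 0" using R by (auto simp: trunc_cone_def)
    show "Im (w + cauchy_transform \<tau> w) > 0" by (rule pos[OF w(1)])
    show "recip_cauchy M (w + cauchy_transform \<tau> w) = w"
      by (rule recip_cauchy_subordination[OF gen w(2) pos[OF w(1)]])
  next
    let ?F = "inf at_infinity (principal (trunc_cone 1 R))"
    have "((\<lambda>w. cauchy_transform \<tau> w / w) \<longlongrightarrow> 0) ?F"
    proof (rule Lim_null_comparison)
      show "\<forall>\<^sub>F w in ?F. norm (cauchy_transform \<tau> w / w) \<le> R * norm (inverse w)"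
        unfolding eventually_inf_principal
        by (intro always_eventually allI impI)
          (auto simp: trunc_cone_def norm_mult norm_inverse divide_inverse intro!: mult_right_mono less_imp_le[OF small])
      have "((\<lambda>w::complex. R * norm (inverse w)) \<longlongrightarrow> R * norm (0::complex)) at_infinity"
        by (intro tendsto_intros tendsto_inverse_0)
      then show "((\<lambda>w::complex. R * norm (inverse w)) \<longlongrightarrow> 0) ?F"
        by (simp add: filterlim_inf tendsto_mono[OF inf_le1])
    qed
    then have "((\<lambda>w. 1 + cauchy_transform \<tau> w / w) \<longlongrightarrow> 1 + 0) ?F" by (intro tendsto_intros)
    moreover have "\<forall>\<^sub>F w in ?F. 1 + cauchy_transform \<tau> w / w = (w + cauchy_transform \<tau> w) / w"
      unfolding eventually_inf_principal
      by (intro always_eventually allI impI) (use R in \<open>auto simp: trunc_cone_def add_divide_distrib\<close>)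
    ultimately show "((\<lambda>w. (w + cauchy_transform \<tau> w) / w) \<longlongrightarrow> 1) ?F"
      by (subst (asm) tendsto_cong) auto
  qed (use R in auto)
  then show ?thesis using R by blast
qed

text \<open>The definite description in \<open>recip_cauchy_inv\<close> ranges over all cones and
  right inverses. Any competing value \<open>w\<close> satisfies
  \<open>recip_cauchy M w = 1 / z\<close>, and the generator equation recovers \<open>w\<close> from
  this, so all competitors agree.\<close>

lemma free_cumulant_generator:
  assumes gen: "additive_generator M \<tau>"
  shows "\<exists>R0>0. \<forall>z. 1 / z \<in> trunc_cone 1 R0 \<longrightarrow>
    z \<in> free_cumulant_dom M \<and> free_cumulant M z = z * cauchy_transform \<tau> (1 / z)"
proof -
  obtain R where R: "R > 0" and inv: "right_inverse_on M 1 R (\<lambda>w. w + cauchy_transform \<tau> w)"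
    using right_inverse_on_generator[OF gen] by blast
  have "z \<in> free_cumulant_dom M \<and> free_cumulant M z = z * cauchy_transform \<tau> (1 / z)"
    if z: "1 / z \<in> trunc_cone 1 R" for z
  proof
    show "z \<in> free_cumulant_dom M"
      unfolding free_cumulant_dom_def using inv z by blast
    have "recip_cauchy_inv M (1 / z) = 1 / z + cauchy_transform \<tau> (1 / z)"
      unfolding recip_cauchy_inv_def
    proof (rule the_equality)
      show "\<exists>\<eta> R g. right_inverse_on M \<eta> R g \<and> 1 / z \<in> trunc_cone \<eta> R \<and>
          1 / z + cauchy_transform \<tau> (1 / z) = g (1 / z)"
        using inv z by blast
      fix w assume "\<exists>\<eta> R g. right_inverse_on M \<eta> R g \<and> 1 / z \<in> trunc_cone \<eta> R \<and> w = g (1 / z)"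
      then have "Im w > 0" "recip_cauchy M w = 1 / z" by (auto simp: right_inverse_on_def)
      then show "w = 1 / z + cauchy_transform \<tau> (1 / z)"
        using additive_generatorD(4)[OF gen, of w] by simp
    qed
    moreover have "z \<noteq> 0" using z R by (auto simp: trunc_cone_def)
    ultimately show "free_cumulant M z = z * cauchy_transform \<tau> (1 / z)"
      by (simp add: free_cumulant_def algebra_simps)
  qed
  then show ?thesis using R by blast
qed

lemma is_free_add_conv_generator:
  assumes gen: "additive_generator M1 \<tau>1" "additive_generator M2 \<tau>2" "additive_generator M \<tau>"
    and add: "\<And>w. Im w > 0 \<Longrightarrow> cauchy_transform \<tau> w = cauchy_transform \<tau>1 w + cauchy_transform \<tau>2 w"
  shows "is_free_add_conv M1 M2 M"
proof -
  obtain R1 R2 R3 where R: "R1 > 0" "R2 > 0" "R3 > 0"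
    and c1: "\<And>z. 1 / z \<in> trunc_cone 1 R1 \<Longrightarrow> z \<in> free_cumulant_dom M1 \<and> free_cumulant M1 z = z * cauchy_transform \<tau>1 (1 / z)"
    and c2: "\<And>z. 1 / z \<in> trunc_cone 1 R2 \<Longrightarrow> z \<in> free_cumulant_dom M2 \<and> free_cumulant M2 z = z * cauchy_transform \<tau>2 (1 / z)"
    and c3: "\<And>z. 1 / z \<in> trunc_cone 1 R3 \<Longrightarrow> z \<in> free_cumulant_dom M \<and> free_cumulant M z = z * cauchy_transform \<tau> (1 / z)"
    using free_cumulant_generator[OF gen(1)] free_cumulant_generator[OF gen(2)] free_cumulant_generator[OF gen(3)]
    by metis
  define R where "R = max R1 (max R2 R3)"
  have "z \<in> free_cumulant_dom M1 \<and> z \<in> free_cumulant_dom M2 \<and> z \<in> free_cumulant_dom M \<and>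
      free_cumulant M z = free_cumulant M1 z + free_cumulant M2 z" if z: "1 / z \<in> trunc_cone 1 R" for z
  proof -
    have i: "1 / z \<in> trunc_cone 1 R1" "1 / z \<in> trunc_cone 1 R2" "1 / z \<in> trunc_cone 1 R3"
      by (rule trunc_cone_mono[OF _ z]; simp add: R_def)+
    have "Im (1 / z) > 0" using i(1) R(1) by (simp add: trunc_cone_def del: Im_divide)
    then show ?thesis using c1[OF i(1)] c2[OF i(2)] c3[OF i(3)] add[of "1 / z"]
      by (simp add: distrib_left)
  qed
  moreover have "R > 0" using R by (simp add: R_def)
  ultimately have "\<exists>\<eta>>0. \<exists>R>0. \<forall>z. 1 / z \<in> trunc_cone \<eta> R \<longrightarrow>
        z \<in> free_cumulant_dom M1 \<and> z \<in> free_cumulant_dom M2 \<and> z \<in> free_cumulant_dom M \<and>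
        free_cumulant M z = free_cumulant M1 z + free_cumulant M2 z"
    by (intro exI[of _ 1] conjI exI[of _ R]) simp_all
  then show ?thesis
    using gen by (simp add: is_free_add_conv_def prob_R_def additive_generatorD(1))
qed

lemma
  assumes M: "fin_borel M" and "c \<ge> 0"
  shows fin_borel_scaled: "fin_borel (density M (\<lambda>_. ennreal c))"
    and cauchy_transform_scaled: "cauchy_transform (density M (\<lambda>_. ennreal c)) z = of_real c * cauchy_transform M z"
proof -
  interpret finite_measure M by (rule fin_borelD[OF M])
  have "emeasure (density M (\<lambda>_. ennreal c)) (space M) = ennreal c * emeasure M (space M)"
    by (simp add: emeasure_density_const)
  also have "\<dots> < \<infinity>"
    using emeasure_finite[of "space M"] unfolding infinity_ennreal_def less_top
    by (simp add: ennreal_mult_less_top)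
  finally show "fin_borel (density M (\<lambda>_. ennreal c))"
    unfolding fin_borel_def using fin_borelD(2)[OF M] by (auto intro!: finite_measureI)
  have m: "(\<lambda>x. 1 / (z - complex_of_real x)) \<in> borel_measurable M"
    by (rule borel_measurable_fin_borel[OF M]) measurable
  show "cauchy_transform (density M (\<lambda>_. ennreal c)) z = of_real c * cauchy_transform M z"
    unfolding cauchy_transform_def using assms(2)
    by (subst integral_density[OF m]) (auto simp: scaleR_conv_of_real simp del: times_divide_eq_right)
qed

text \<open>Cauchy transforms are linear in the measure, so the \<open>n\<close>-th convolution root
  is generated by \<open>\<tau>\<close> scaled by \<open>1 / n\<close>, and the product of
  \<open>k\<close> roots by \<open>\<tau>\<close> scaled by \<open>k / n\<close>.\<close>

lemma free_inf_div_generator: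
  assumes gen: "additive_generator M \<tau>"
  shows "M \<in> free_inf_div"
proof -
  note \<tau> = additive_generatorD(2)[OF gen]
  have "\<exists>L\<in>prob_R. is_free_add_power L n M" if "n \<ge> 1" for n
  proof (cases "n = 1")
    case True
    then show ?thesis
      using is_free_add_power.one[of M] additive_generatorD(1)[OF gen] by (auto simp: prob_R_def)
  next
    case False
    define sc where "sc c = density \<tau> (\<lambda>_. ennreal c)" for c
    obtain L where L: "additive_generator L (sc (1 / n))"
      using additive_generator_exists(1)[OF fin_borel_scaled[OF \<tau>]] unfolding sc_def by fastforce
    have step: "is_free_add_conv K L K'"
      if "additive_generator K (sc (real k / n))" "additive_generator K' \<sigma>"
        "\<And>w. cauchy_transform \<sigma> w = of_real (real (Suc k) / n) * cauchy_transform \<tau> w" for K K' k \<sigma>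
    proof (rule is_free_add_conv_generator[OF that(1) L that(2)])
      show "cauchy_transform \<sigma> w = cauchy_transform (sc (real k / n)) w + cauchy_transform (sc (1 / n)) w" for w
        unfolding that(3) sc_def by (simp add: cauchy_transform_scaled[OF \<tau>] add_divide_distrib distrib_right)
    qed
    have pow: "\<exists>K. is_free_add_power L (Suc k) K \<and> additive_generator K (sc (real (Suc k) / n))" for k
    proof (induction k)
      case 0
      then show ?case
        using is_free_add_power.one[of L] L additive_generatorD(1)[OF L] by (auto simp: prob_R_def)
    next
      case (Suc k)
      then obtain K where K: "is_free_add_power L (Suc k) K" "additive_generator K (sc (real (Suc k) / n))"
        by blast
      obtain K' where K': "additive_generator K' (sc (real (Suc (Suc k)) / n))"
        using additive_generator_exists(1)[OF fin_borel_scaled[OF \<tau>]] unfolding sc_def by fastforce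
      have "is_free_add_conv K L K'"
        by (rule step[OF K(2) K']) (simp add: sc_def cauchy_transform_scaled[OF \<tau>])
      then show ?case using is_free_add_power.step[OF K(1)] K' by blast
    qed
    \<comment> \<open>The chain of existential choices stops at \<open>n - 1\<close> factors. The
      last convolution uses \<open>gen\<close>, so that it ends in \<open>M\<close> itself and not
      in another law with the same generator.\<close>
    define j where "j = n - 2"
    have j: "n = Suc (Suc j)" using False \<open>n \<ge> 1\<close> unfolding j_def by linarith
    obtain K where K: "is_free_add_power L (Suc j) K" "additive_generator K (sc (real (Suc j) / n))"
      using pow by blast
    have "is_free_add_conv K L M"
      by (rule step[OF K(2) gen]) (simp add: j)
    then have "is_free_add_power L n M" unfolding j by (rule is_free_add_power.step[OF K(1)])
    then show ?thesis using additive_generatorD(1)[OF L] by (auto simp: prob_R_def)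
  qed
  then show ?thesis
    using additive_generatorD(1)[OF gen] by (simp add: free_inf_div_def prob_R_def)
qed

lemma integral_odd_eq_0:
  fixes g :: "real \<Rightarrow> 'a::{banach,second_countable_topology}"
  assumes M: "fin_borel M" and sym: "distr M borel uminus = M"
    and g: "g \<in> borel_measurable borel" and odd: "\<And>x. g (- x) = - g x"
  shows "(LINT x|M. g x) = 0"
proof -
  have um: "uminus \<in> measurable M borel" by (rule borel_measurable_fin_borel[OF M]) simp
  have "(LINT x|M. g x) = (LINT x|distr M borel uminus. g x)" by (simp only: sym)
  also have "\<dots> = (LINT x|M. g (- x))" by (rule integral_distr[OF um g])
  also have "\<dots> = - (LINT x|M. g x)" by (simp add: odd)
  finally have "2 *\<^sub>R (LINT x|M. g x) = 0" by (simp add: scaleR_2 eq_neg_iff_add_eq_0)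
  then show ?thesis by simp
qed

abbreviation second_moment :: "real measure \<Rightarrow> real measure" where
  "second_moment \<nu> \<equiv> density \<nu> (\<lambda>x. ennreal (x\<^sup>2))"

lemma
  assumes \<nu>: "fin_borel \<nu>" and sq: "integrable \<nu> (\<lambda>x. x\<^sup>2)"
  shows fin_borel_second_moment: "fin_borel (second_moment \<nu>)"
    and cauchy_transform_second_moment:
      "cauchy_transform (second_moment \<nu>) w = (LINT x|\<nu>. of_real (x\<^sup>2) / (w - of_real x))"
proof -
  have m2: "(\<lambda>x. x\<^sup>2) \<in> borel_measurable \<nu>" "(\<lambda>x. ennreal (x\<^sup>2)) \<in> borel_measurable \<nu>"
    using sq by auto
  have "emeasure (second_moment \<nu>) (space \<nu>) = (\<integral>\<^sup>+x. ennreal (x\<^sup>2) \<partial>\<nu>)"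
    using m2 by (simp add: emeasure_density cong: nn_integral_cong)
  also have "\<dots> < \<infinity>" using sq by (simp add: nn_integral_eq_integral)
  finally show "fin_borel (second_moment \<nu>)"
    unfolding fin_borel_def using fin_borelD(2)[OF \<nu>] by (auto intro!: finite_measureI)
  have m: "(\<lambda>x. 1 / (w - complex_of_real x)) \<in> borel_measurable \<nu>"
    by (rule borel_measurable_fin_borel[OF \<nu>]) measurable
  show "cauchy_transform (second_moment \<nu>) w = (LINT x|\<nu>. of_real (x\<^sup>2) / (w - of_real x))"
    unfolding cauchy_transform_def using m2
    by (subst integral_density[OF m]) (auto simp: scaleR_conv_of_real)
qed

text \<open>The integrand of the triplet formula differs from \<open>z * x^2 / (1 / z - x)\<close>
  by \<open>z * x\<close> outside \<open>[-1, 1]\<close>. This difference is odd, and integrable by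
  the second moment, so symmetry removes it.\<close>

lemma has_free_triplet_generator:
  assumes \<nu>: "fin_borel \<nu>" "levy_measure \<nu>" and sym: "distr \<nu> borel uminus = \<nu>"
    and sq: "integrable \<nu> (\<lambda>x. x\<^sup>2)"
    and gen: "additive_generator M (second_moment \<nu>)"
  shows "has_free_triplet M 0 \<nu> 0"
proof -
  interpret finite_measure \<nu> by (rule fin_borelD[OF \<nu>(1)])
  obtain R0 where R0: "R0 > 0" "\<And>z. 1 / z \<in> trunc_cone 1 R0 \<Longrightarrow>
      z \<in> free_cumulant_dom M \<and>
      free_cumulant M z = z * cauchy_transform (second_moment \<nu>) (1 / z)"
    using free_cumulant_generator[OF gen] by blast
  have "z * cauchy_transform (second_moment \<nu>) (1 / z) =
      (LINT x|\<nu>. 1 / (1 - z * of_real x) - 1 - z * of_real x * of_real (indicator {-1..1} x))"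
    if z: "1 / z \<in> trunc_cone 1 R0" for z
  proof -
    have iz1: "Im (1 / z) > 0"
      using z R0(1) unfolding trunc_cone_def mem_Collect_eq by linarith
    have "z \<noteq> 0"
    proof
      assume "z = 0"
      then show False using iz1 by simp
    qed
    note iz = iz1 this
    define h where "h x = of_real (x * (1 - indicator {-1..1} x)) * z" for x :: real
    define k where "k x = z * (of_real (x\<^sup>2) / (1 / z - of_real x))" for x :: real
    have k_eq: "k = (\<lambda>x. z * (of_real (x\<^sup>2) * (1 / (1 / z - of_real x))))"
      by (simp add: k_def[abs_def])
    have kI: "integrable \<nu> k"
      unfolding k_eq
    proof (rule integrable_mult_right, rule Bochner_Integration.integrable_bound[where f="\<lambda>x. x\<^sup>2 * (1 / Im (1 / z))"])
      show "integrable \<nu> (\<lambda>x. x\<^sup>2 * (1 / Im (1 / z)))" by (intro integrable_mult_left sq)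
      show "(\<lambda>x. complex_of_real (x\<^sup>2) * (1 / (1 / z - complex_of_real x))) \<in> borel_measurable \<nu>"
        by (rule borel_measurable_fin_borel[OF \<nu>(1)]) measurable
      show "AE x in \<nu>. norm (complex_of_real (x\<^sup>2) * (1 / (1 / z - complex_of_real x))) \<le> norm (x\<^sup>2 * (1 / Im (1 / z)))"
      proof (intro AE_I2)
        fix x
        have "norm (complex_of_real (x\<^sup>2) * (1 / (1 / z - complex_of_real x)))
            = x\<^sup>2 * norm (1 / (1 / z - complex_of_real x))"
          by (simp only: norm_mult norm_of_real abs_power2)
        also have "\<dots> \<le> x\<^sup>2 * (1 / Im (1 / z))" by (intro mult_left_mono norm_resolvent_le iz) simp
        also have "\<dots> \<le> norm (x\<^sup>2 * (1 / Im (1 / z)))"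
          unfolding real_norm_def by (rule abs_ge_self)
        finally show "norm (complex_of_real (x\<^sup>2) * (1 / (1 / z - complex_of_real x))) \<le> norm (x\<^sup>2 * (1 / Im (1 / z)))" .
      qed
    qed
    have hI: "integrable \<nu> h"
      unfolding h_def
    proof (rule integrable_mult_left, rule integrable_of_real, rule Bochner_Integration.integrable_bound[OF sq])
      show "(\<lambda>x. x * (1 - indicator {-1..1} x)) \<in> borel_measurable \<nu>"
        by (rule borel_measurable_fin_borel[OF \<nu>(1)]) measurable
      show "AE x in \<nu>. norm (x * (1 - indicator {-1..1} x)) \<le> norm (x\<^sup>2)"
      proof (rule AE_I2)
        fix x :: real
        have "\<bar>x\<bar> \<le> \<bar>x\<bar> * \<bar>x\<bar>" if "x \<notin> {-1..1}"
        proof -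
          have "1 \<le> \<bar>x\<bar>" using that by auto
          from mult_left_mono[OF this, of "\<bar>x\<bar>"] show ?thesis by simp
        qed
        then show "norm (x * (1 - indicator {-1..1} x)) \<le> norm (x\<^sup>2)"
          by (auto simp: indicator_def power2_eq_square abs_mult)
      qed
    qed
    have "(LINT x|\<nu>. h x) = 0"
    proof (rule integral_odd_eq_0[OF \<nu>(1) sym])
      show "h \<in> borel_measurable borel" unfolding h_def by measurable
      show "h (- x) = - h x" for x by (auto simp: h_def indicator_def)
    qed
    moreover have "z * cauchy_transform (second_moment \<nu>) (1 / z) = (LINT x|\<nu>. k x)"
      unfolding cauchy_transform_second_moment[OF \<nu>(1) sq] k_def
      by (rule integral_mult_right_zero[symmetric])
    moreover have "1 / (1 - z * of_real x) - 1 - z * of_real x * of_real (indicator {-1..1} x) = k x + h x" for x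
    proof -
      have "1 / z - of_real x \<noteq> 0"
      proof
        assume "1 / z - of_real x = 0"
        then have "1 / z = of_real x" by simp
        then have "Im (1 / z) = 0" by (simp only: Im_complex_of_real)
        then show False using iz(1) by linarith
      qed
      then have n: "1 - z * of_real x \<noteq> 0" using iz(2) by (auto simp: field_simps)
      have "1 / z - of_real x = (1 - z * of_real x) / z" using iz(2) by (simp add: field_simps)
      then have "k x = (z * of_real x)\<^sup>2 / (1 - z * of_real x)"
        using iz(2) by (simp add: k_def power2_eq_square)
      moreover have "(z * of_real x)\<^sup>2 / (1 - z * of_real x) = 1 / (1 - z * of_real x) - 1 - z * of_real x"
        using n by (simp add: field_simps power2_eq_square)
      ultimately show ?thesis by (simp add: h_def algebra_simps)
    qed
    moreover have "(LINT x|\<nu>. k x + h x) = (LINT x|\<nu>. k x) + (LINT x|\<nu>. h x)"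
      by (rule Bochner_Integration.integral_add[OF kI hI])
    ultimately show ?thesis by (simp only: add_0_right)
  qed
  then have "\<exists>\<eta>>0. \<exists>R>0. \<forall>z. 1 / z \<in> trunc_cone \<eta> R \<longrightarrow>
      z \<in> free_cumulant_dom M \<and>
      free_cumulant M z = of_real 0 * z + of_real 0 * z\<^sup>2 +
        (LINT x|\<nu>. 1 / (1 - z * of_real x) - 1 - z * of_real x * of_real (indicator {-1..1} x))"
    using R0 by (intro exI[of _ 1] conjI exI[of _ R0]) simp_all
  then show ?thesis using \<nu>(2) by (simp only: has_free_triplet_def) simp
qed

lemma additive_generator_dirac0:
  assumes "fin_borel \<tau>" "\<And>z. cauchy_transform \<tau> z = 0"
  shows "additive_generator dirac0 \<tau>"
proof -
  have "real_distribution dirac0"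
    by (intro real_distribution.intro prob_space_return real_distribution_axioms.intro) auto
  moreover have "recip_cauchy dirac0 z = z" for z
    unfolding recip_cauchy_def cauchy_transform_def by (subst integral_return) auto
  ultimately show ?thesis using assms by (simp add: additive_generator_def)
qed

section \<open>The functions psi and chi\<close>

lemma eq_dirac0I:
  assumes M: "real_distribution M" and 0: "AE x in M. x = 0"
  shows "M = dirac0"
proof -
  interpret real_distribution M by fact
  have "M = distr M borel (\<lambda>x. x)" by (rule distr_id2[symmetric]) simp
  also have "\<dots> = distr M borel (\<lambda>x. 0)" by (rule distr_cong_AE) (use 0 in auto)
  also have "\<dots> = dirac0" by (rule distr_const) simp
  finally show ?thesis .
qed

text \<open>The integrals of \<open>w * f / (1 - w * f)\<close> over a law are real only for real \<open>w\<close>, and strictly monotone there.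
  With \<open>f x = x\<close> this covers measures on the half-line, with \<open>f x = x\<^sup>2\<close> symmetric measures.\<close>

context
  fixes M :: "real measure" and f :: "real \<Rightarrow> real"
  assumes M: "real_distribution M" and f: "f \<in> borel_measurable borel"
    and f_nonneg: "AE x in M. f x \<ge> 0" and f_nz: "\<not> (AE x in M. f x = 0)"
begin

interpretation real_distribution M by (rule M)

lemma moment_transform_real:
  assumes w: "Re w < 0" and real: "Im (LINT x|M. w * of_real (f x) / (1 - w * of_real (f x))) = 0"
  shows "Im w = 0"
proof (rule ccontr)
  assume "Im w \<noteq> 0"
  have fm [measurable]: "f \<in> borel_measurable M"
    by (rule borel_measurable_fin_borel[OF fin_borel_real_distribution[OF M] f])
  \<comment> \<open>The kernel is bounded by this ratio because \<open>norm (1 - w * t)\<close> is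
    at least \<open>1 + (- Re w) * t\<close> for \<open>t \<ge> 0\<close>.\<close>
  define B where "B = norm w / (- Re w)"
  have bound: "norm (1 - w * of_real t) \<ge> 1" "norm (w * of_real t / (1 - w * of_real t)) \<le> B"
    if "t \<ge> 0" for t
  proof -
    have "Re (1 - w * of_real t) = 1 + (- Re w) * t" by simp
    moreover have "(- Re w) * t \<ge> 0" using w that by (intro mult_nonneg_nonneg) auto
    ultimately have r: "norm (1 - w * of_real t) \<ge> 1 + (- Re w) * t"
      using complex_Re_le_cmod[of "1 - w * of_real t"] by linarith
    then show 1: "norm (1 - w * of_real t) \<ge> 1" using \<open>(- Re w) * t \<ge> 0\<close> by linarith
    have "norm (w * of_real t) = B * ((- Re w) * t)"
      using w that by (simp add: B_def norm_mult)
    also have "\<dots> \<le> B * norm (1 - w * of_real t)"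
    proof (rule mult_left_mono)
      show "B \<ge> 0" unfolding B_def using w by (intro divide_nonneg_pos) auto
    qed (use r in linarith)
    finally show "norm (w * of_real t / (1 - w * of_real t)) \<le> B"
      using less_le_trans[OF zero_less_one 1] by (simp only: norm_divide pos_divide_le_eq)
  qed
  have int: "integrable M (\<lambda>x. w * of_real (f x) / (1 - w * of_real (f x)))"
    by (rule integrable_const_bound[where B=B]) (use f_nonneg bound(2) in \<open>auto elim: eventually_mono\<close>)
  have "(LINT x|M. Im (w * of_real (f x) / (1 - w * of_real (f x)))) = 0"
    using real integral_Im[OF int] by simp
  \<comment> \<open>The imaginary part is \<open>Im w\<close> times a function of constant sign, so
    a real integral with nonreal \<open>w\<close> would force \<open>f\<close> to vanish almost
    everywhere.\<close>
  moreover have im: "Im (w * of_real (f x) / (1 - w * of_real (f x))) =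
      Im w * (f x / (norm (1 - w * of_real (f x)))\<^sup>2)" for x
    by (simp add: Im_divide cmod_def) (simp add: algebra_simps)
  ultimately have z: "(LINT x|M. f x / (norm (1 - w * of_real (f x)))\<^sup>2) = 0"
    using \<open>Im w \<noteq> 0\<close> by (simp only: integral_mult_right_zero mult_eq_0_iff) simp
  have "integrable M (\<lambda>x. Im w * (f x / (norm (1 - w * of_real (f x)))\<^sup>2))"
    using integrable_Im[OF int] unfolding im .
  from integrable_mult_right[OF this, of "1 / Im w"]
  have i2: "integrable M (\<lambda>x. f x / (norm (1 - w * of_real (f x)))\<^sup>2)"
    using \<open>Im w \<noteq> 0\<close> by simp
  have "AE x in M. 0 \<le> f x / (norm (1 - w * of_real (f x)))\<^sup>2"
    using f_nonneg by eventually_elim (simp add: divide_nonneg_nonneg)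
  then have "AE x in M. f x / (norm (1 - w * of_real (f x)))\<^sup>2 = 0"
    using integral_nonneg_eq_0_iff_AE[OF i2] z by simp
  with f_nonneg have "AE x in M. f x = 0"
  proof eventually_elim
    case (elim x)
    then show ?case using bound(1)[of "f x"] by auto
  qed
  then show False using f_nz by simp
qed

lemma integrable_moment_transform:
  assumes "t > 0"
  shows "integrable M (\<lambda>x. t * f x / (1 + t * f x))"
proof (rule integrable_const_bound[where B=1])
  show "AE x in M. norm (t * f x / (1 + t * f x)) \<le> 1"
    using f_nonneg by eventually_elim (use assms in \<open>simp only: norm_moment_kernel_le_1 mult_nonneg_nonneg less_imp_le\<close>)
  have [measurable]: "f \<in> borel_measurable M"
    by (rule borel_measurable_fin_borel[OF fin_borel_real_distribution[OF M] f])
  show "(\<lambda>x. t * f x / (1 + t * f x)) \<in> borel_measurable M" by measurable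
qed

lemma moment_transform_strict_mono:
  assumes "0 < s" "s < t"
  shows "(LINT x|M. s * f x / (1 + s * f x)) < (LINT x|M. t * f x / (1 + t * f x))"
proof -
  note i = integrable_moment_transform[of s] integrable_moment_transform[of t]
  have diff: "t * f x / (1 + t * f x) - s * f x / (1 + s * f x) = (t - s) * f x / ((1 + t * f x) * (1 + s * f x))"
    if "f x \<ge> 0" for x
  proof -
    have "t * f x \<ge> 0" "s * f x \<ge> 0" using that assms by auto
    then have "1 + t * f x \<noteq> 0" "1 + s * f x \<noteq> 0" by linarith+
    then show ?thesis by (simp add: divide_simps) (simp add: algebra_simps)
  qed
  have nn: "AE x in M. 0 \<le> t * f x / (1 + t * f x) - s * f x / (1 + s * f x)"
    using f_nonneg
  proof eventually_elim
    case (elim x)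
    then show ?case unfolding diff[OF elim] using assms by (intro divide_nonneg_nonneg mult_nonneg_nonneg) auto
  qed
  have "(LINT x|M. t * f x / (1 + t * f x) - s * f x / (1 + s * f x)) \<noteq> 0"
  proof
    assume "(LINT x|M. t * f x / (1 + t * f x) - s * f x / (1 + s * f x)) = 0"
    then have "AE x in M. t * f x / (1 + t * f x) - s * f x / (1 + s * f x) = 0"
      using integral_nonneg_eq_0_iff_AE[OF Bochner_Integration.integrable_diff[OF i(2,1)] nn] assms by simp
    with f_nonneg have "AE x in M. f x = 0"
    proof eventually_elim
      case (elim x)
      have "t * f x \<ge> 0" "s * f x \<ge> 0" using elim assms by auto
      then have "1 + t * f x \<noteq> 0" "1 + s * f x \<noteq> 0" by linarith+
      then show ?case using elim(2) assms unfolding diff[OF elim(1)] by simp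
    qed
    then show False using f_nz by simp
  qed
  moreover have "0 \<le> (LINT x|M. t * f x / (1 + t * f x) - s * f x / (1 + s * f x))"
    using nn by (rule integral_nonneg_AE)
  ultimately show ?thesis
    using Bochner_Integration.integral_diff[OF i(2,1)] assms by simp
qed

lemma moment_transform_of_real:
  "(LINT x|M. (- of_real t) * of_real (f x) / (1 - (- of_real t) * of_real (f x)) :: complex)
     = - of_real (LINT x|M. t * f x / (1 + t * f x))"
proof -
  have "(- complex_of_real t) * of_real (f x) / (1 - (- of_real t) * of_real (f x)) =
     - complex_of_real (t * f x / (1 + t * f x))" for x by simp
  then show ?thesis by (simp only: Bochner_Integration.integral_minus integral_complex_of_real)
qed

lemma moment_transform_unique:
  assumes w: "Re w < 0" and "t > 0"
    and eq: "(LINT x|M. w * of_real (f x) / (1 - w * of_real (f x))) = - of_real (LINT x|M. t * f x / (1 + t * f x))"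
  shows "w = - of_real t"
proof -
  have "Im w = 0" by (rule moment_transform_real[OF w]) (simp add: eq)
  then have w': "w = - of_real (- Re w)" by (simp add: complex_eq_iff)
  have "(LINT x|M. (- Re w) * f x / (1 + (- Re w) * f x)) = (LINT x|M. t * f x / (1 + t * f x))"
    using eq moment_transform_of_real[of "- Re w"] unfolding w'[symmetric]
    by (simp only: neg_equal_iff_equal of_real_eq_iff)
  then have "- Re w = t"
    using moment_transform_strict_mono[of "- Re w" t] moment_transform_strict_mono[of t "- Re w"] w \<open>t > 0\<close>
    by (cases "- Re w" t rule: linorder_cases) linarith+
  then show ?thesis using w' by simp
qed

end

section \<open>Values of chi on the negative half-line\<close>

lemma prob_posD:
  assumes "L \<in> prob_pos"
  shows "real_distribution L" "AE x in L. x \<ge> 0"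
proof -
  show L: "real_distribution L" using assms by (simp add: prob_pos_def prob_R_def)
  interpret real_distribution L by fact
  have "AE x in L. x \<in> {0..}"
    using assms by (subst AE_in_set_eq_1) (auto simp: prob_pos_def)
  then show "AE x in L. x \<ge> 0" by simp
qed

lemma prob_symD:
  assumes "M \<in> prob_sym"
  shows "real_distribution M" "distr M borel uminus = M"
  using assms by (simp_all add: prob_sym_def prob_R_def)

text \<open>\<open>chi_region\<close> tests for the half-line case first; this excludes that branch
  for a nontrivial symmetric law.\<close>

lemma prob_sym_not_pos:
  assumes M: "M \<in> prob_sym" "M \<noteq> dirac0"
  shows "M \<notin> prob_pos"
proof
  assume pos: "M \<in> prob_pos"
  note s = prob_symD[OF M(1)]
  interpret real_distribution M by (rule s)
  have um: "uminus \<in> measurable M borel" by (rule measurable_uminus_fin_borel[OF fin_borel_real_distribution[OF s(1)]])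
  have "AE x in distr M borel uminus. x \<ge> 0" using prob_posD(2)[OF pos] by (simp only: s(2))
  then have "AE x in M. - x \<ge> 0" by (subst (asm) AE_distr_iff[OF um]) auto
  with prob_posD(2)[OF pos] have "AE x in M. x = 0" by eventually_elim simp
  then show False using eq_dirac0I[OF s(1)] M(2) by simp
qed

text \<open>Averaging the kernel over \<open>x\<close> and \<open>-x\<close> leaves a kernel in
  \<open>z^2\<close> and \<open>x^2\<close>, which brings symmetric laws under the preceding lemmas
  with \<open>f x = x^2\<close>. The second form is the link to the Cauchy transform, and so to
  generators.\<close>

lemma psi_transform_sym:
  assumes M: "M \<in> prob_sym" and z: "Im z < 0"
  shows "psi_transform M z = (LINT x|M. z\<^sup>2 * of_real (x\<^sup>2) / (1 - z\<^sup>2 * of_real (x\<^sup>2)))"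
    and "psi_transform M z = (1 / z) * cauchy_transform M (1 / z) - 1"
proof -
  note s = prob_symD[OF M]
  interpret real_distribution M by (rule s)
  note fb = fin_borel_real_distribution[OF s(1)]
  have z0: "z \<noteq> 0" using z by auto
  have iz: "Im (1 / z) > 0"
  proof -
    have "(Re z)\<^sup>2 + (Im z)\<^sup>2 > 0" using z by (simp add: add_nonneg_pos)
    then show ?thesis using z by (simp add: Im_divide divide_neg_pos)
  qed
  have n: "1 - z * of_real x \<noteq> 0" for x
  proof
    assume e: "1 - z * of_real x = 0"
    then have "Im (z * of_real x) = 0" by (simp add: complex_eq_iff)
    then have "x = 0" using z by simp
    then show False using e by simp
  qed
  have res: "1 / (1 / z - of_real x) = z / (1 - z * of_real x)" for x
    using z0 n[of x] by (simp add: field_simps)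
  have frac: "z * of_real x / (1 - z * of_real x) = (1 / z) * (1 / (1 / z - of_real x)) - 1" for x
    unfolding res using z0 n[of x] by (simp add: field_simps)
  note i = integrable_resolvent[OF fb iz]
  show "psi_transform M z = (1 / z) * cauchy_transform M (1 / z) - 1"
  proof -
    have "psi_transform M z = (LINT x|M. (1 / z) * (1 / (1 / z - of_real x)) - 1)"
      unfolding psi_transform_def frac ..
    also have "\<dots> = (LINT x|M. (1 / z) * (1 / (1 / z - of_real x))) - (LINT x|M. 1)"
      by (rule Bochner_Integration.integral_diff[OF integrable_mult_right[OF i]]) simp
    also have "(LINT x|M. 1::complex) = 1" using prob_space by (simp add: space_eq_univ)
    also have "(LINT x|M. (1 / z) * (1 / (1 / z - of_real x))) = (1 / z) * cauchy_transform M (1 / z)"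
      unfolding cauchy_transform_def by (rule integral_mult_right_zero)
    finally show ?thesis .
  qed
  have I: "integrable M (\<lambda>x. z * of_real x / (1 - z * of_real x))"
    unfolding frac by (intro Bochner_Integration.integrable_diff integrable_mult_right i) simp
  have n2: "1 - z\<^sup>2 * of_real (x\<^sup>2) = (1 - z * of_real x) * (1 - z * of_real (- x))" for x
    by (simp add: power2_eq_square algebra_simps)
  define g where "g x = z * of_real x / (1 - z\<^sup>2 * of_real (x\<^sup>2))" for x
  have split: "z * of_real x / (1 - z * of_real x) = z\<^sup>2 * of_real (x\<^sup>2) / (1 - z\<^sup>2 * of_real (x\<^sup>2)) + g x" for x
  proof -
    have "z\<^sup>2 * of_real (x\<^sup>2) + z * of_real x = (z * of_real x) * (1 - z * of_real (- x))"
      by (simp add: power2_eq_square algebra_simps)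
    then show ?thesis
      unfolding g_def n2 add_divide_distrib[symmetric] using n[of "- x"]
      by (simp only: mult_divide_mult_cancel_right not_False_eq_True)
  qed
  have odd: "g (- x) = - g x" for x by (simp add: g_def)
  have um: "uminus \<in> measurable M borel" by (rule borel_measurable_fin_borel[OF fb]) simp
  have I': "integrable M (\<lambda>x. z * of_real (- x) / (1 - z * of_real (- x)))"
    using integrable_distr[OF um, of "\<lambda>x. z * of_real x / (1 - z * of_real x)"] I unfolding s(2) by simp
  have gI: "integrable M g"
  proof -
    \<comment> \<open>Half the difference of the kernel at \<open>x\<close> and at
      \<open>-x\<close>: the even part cancels, and both terms are integrable by symmetry of
      \<open>M\<close>.\<close>
    have "g x = (1 / 2) * (z * of_real x / (1 - z * of_real x) - z * of_real (- x) / (1 - z * of_real (- x)))" for x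
      using split[of x] split[of "- x"] odd[of x] by simp
    then have "g = (\<lambda>x. (1 / 2) * (z * of_real x / (1 - z * of_real x) - z * of_real (- x) / (1 - z * of_real (- x))))"
      by blast
    then show ?thesis by (simp only: integrable_mult_right[OF Bochner_Integration.integrable_diff[OF I I']])
  qed
  have "(LINT x|M. g x) = 0"
    by (rule integral_odd_eq_0[where g=g, OF fb s(2) _ odd]) (simp add: g_def[abs_def])
  moreover have "(LINT x|M. z * of_real x / (1 - z * of_real x) - g x) = psi_transform M z - (LINT x|M. g x)"
    unfolding psi_transform_def by (rule Bochner_Integration.integral_diff[OF I gI])
  moreover have "z * of_real x / (1 - z * of_real x) - g x = z\<^sup>2 * of_real (x\<^sup>2) / (1 - z\<^sup>2 * of_real (x\<^sup>2))" for x
    using split[of x] by simp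
  ultimately show "psi_transform M z = (LINT x|M. z\<^sup>2 * of_real (x\<^sup>2) / (1 - z\<^sup>2 * of_real (x\<^sup>2)))" by simp
qed

lemma psi_transform_sym_imag:
  assumes M: "M \<in> prob_sym" and y: "y > 0"
  shows "psi_transform M (- \<i> * of_real y) = - of_real (LINT x|M. y\<^sup>2 * x\<^sup>2 / (1 + y\<^sup>2 * x\<^sup>2))"
proof -
  have "psi_transform M (- \<i> * of_real y) =
      (LINT x|M. (- of_real (y\<^sup>2)) * of_real (x\<^sup>2) / (1 - (- of_real (y\<^sup>2)) * of_real (x\<^sup>2)))"
    using psi_transform_sym(1)[OF M, of "- \<i> * of_real y"] y by (simp add: power_mult_distrib)
  also have "(\<lambda>x::real. (- of_real (y\<^sup>2)) * of_real (x\<^sup>2) / (1 - (- of_real (y\<^sup>2)) * of_real (x\<^sup>2)) :: complex) =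
      (\<lambda>x. - complex_of_real (y\<^sup>2 * x\<^sup>2 / (1 + y\<^sup>2 * x\<^sup>2)))" by (rule ext) simp
  finally show ?thesis by (simp only: Bochner_Integration.integral_minus integral_complex_of_real)
qed

text \<open>On the wedge \<open>chi_region M\<close> the square has negative real part, so
  \<open>moment_transform_unique\<close> determines \<open>z^2\<close>, and \<open>Im z < 0\<close>
  selects the root.\<close>

lemma chi_transform_sym:
  assumes M: "M \<in> prob_sym" "M \<noteq> dirac0" and y: "y > 0"
    and u: "(LINT x|M. y\<^sup>2 * x\<^sup>2 / (1 + y\<^sup>2 * x\<^sup>2)) = u"
  shows "chi_transform M (- of_real u) = - \<i> * of_real y"
  unfolding chi_transform_def the_inv_into_def
proof (rule the_equality)
  have reg: "chi_region M = {z. Im z < 0 \<and> \<bar>Re z\<bar> < \<bar>Im z\<bar>}"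
    using prob_sym_not_pos[OF M] by (simp add: chi_region_def)
  show "- \<i> * of_real y \<in> chi_region M \<and> psi_transform M (- \<i> * of_real y) = - of_real u"
    using psi_transform_sym_imag[OF M(1) y] u y by (simp add: reg)
  fix z assume z: "z \<in> chi_region M \<and> psi_transform M z = - of_real u"
  then have Im: "Im z < 0" and Re: "\<bar>Re z\<bar> < \<bar>Im z\<bar>" by (auto simp: reg)
  have "z\<^sup>2 = - of_real (y\<^sup>2)"
  proof (rule moment_transform_unique[OF prob_symD(1)[OF M(1)], of "\<lambda>x. x\<^sup>2"])
    have "\<bar>Re z\<bar>\<^sup>2 < \<bar>Im z\<bar>\<^sup>2" using Re by (intro power_strict_mono) auto
    then show "Re (z\<^sup>2) < 0" by (simp add: Re_power2)
    show "\<not> (AE x in M. x\<^sup>2 = 0)"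
    proof
      assume "AE x in M. x\<^sup>2 = 0"
      then have "AE x in M. x = 0" by simp
      then show False using eq_dirac0I[OF prob_symD(1)[OF M(1)]] M(2) by simp
    qed
    show "(LINT x|M. z\<^sup>2 * of_real (x\<^sup>2) / (1 - z\<^sup>2 * of_real (x\<^sup>2))) =
        - of_real (LINT x|M. y\<^sup>2 * x\<^sup>2 / (1 + y\<^sup>2 * x\<^sup>2))"
      using psi_transform_sym(1)[OF M(1) Im] z u by simp
    show "0 < y\<^sup>2" using y by simp
  qed simp_all
  then have "(z - \<i> * of_real y) * (z + \<i> * of_real y) = 0"
    by (simp add: power2_eq_square algebra_simps)
  then have "z = \<i> * of_real y \<or> z = - (\<i> * of_real y)" by (simp add: eq_neg_iff_add_eq_0)
  then show "z = - \<i> * of_real y" using Im y by auto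
qed

text \<open>Membership in \<open>S_dom\<close> supplies a preimage in the left half-plane; since the
  value is real, \<open>moment_transform_real\<close> places it on the negative half-line.\<close>

lemma chi_transform_pos:
  assumes L: "L \<in> prob_pos" "L \<noteq> dirac0" and u: "- of_real u \<in> S_dom L"
  shows "\<exists>k>0. chi_transform L (- of_real u) = - of_real k \<and> (LINT x|L. k * x / (1 + k * x)) = u"
proof -
  note Ld = prob_posD[OF L(1)]
  have reg: "chi_region L = {z. Re z < 0}" using L(1) by (simp add: chi_region_def)
  have nz: "\<not> (AE x in L. x = 0)" using eq_dirac0I[OF Ld(1)] L(2) by blast
  have id: "(\<lambda>x::real. x) \<in> borel_measurable borel" by simp
  note uniq = moment_transform_unique[OF Ld(1) id Ld(2) nz]
    and rl = moment_transform_real[OF Ld(1) id Ld(2) nz]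
    and ofr = moment_transform_of_real[OF Ld(1) id Ld(2) nz]
  obtain w where w: "Re w < 0" "psi_transform L w = - of_real u"
    using u by (auto simp: S_dom_def reg)
  have "Im w = 0" by (rule rl[OF w(1)]) (use w(2) in \<open>simp add: psi_transform_def\<close>)
  define k where "k = - Re w"
  have wk: "w = - of_real k" and k: "k > 0" using w \<open>Im w = 0\<close> by (simp_all add: k_def complex_eq_iff)
  have ku: "(LINT x|L. k * x / (1 + k * x)) = u"
    using w(2) ofr[of k] unfolding wk psi_transform_def by (simp only: neg_equal_iff_equal of_real_eq_iff)
  have "chi_transform L (- of_real u) = - of_real k"
    unfolding chi_transform_def the_inv_into_def
  proof (rule the_equality)
    show "- of_real k \<in> chi_region L \<and> psi_transform L (- of_real k) = - of_real u"
      using w(2) k by (simp add: wk reg)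
    fix z assume z: "z \<in> chi_region L \<and> psi_transform L z = - of_real u"
    show "z = - of_real k"
    proof (rule uniq)
      show "(LINT x|L. z * of_real x / (1 - z * of_real x)) = - of_real (LINT x|L. k * x / (1 + k * x))"
        using z by (simp add: psi_transform_def ku)
    qed (use z k reg in auto)
  qed
  then show ?thesis using k ku by blast
qed

section \<open>The Wigner law\<close>

lemma emeasure_density_lborel_singleton:
  assumes [measurable]: "d \<in> borel_measurable borel"
  shows "emeasure (density lborel d) {a::real} = 0"
proof -
  have "emeasure (density lborel d) {a} = (\<integral>\<^sup>+x. d x * indicator {a} x \<partial>lborel)"
    by (rule emeasure_density) auto
  also have "\<dots> = (\<integral>\<^sup>+(x::real). 0 \<partial>lborel)"
  proof (rule nn_integral_cong_AE)
    show "AE x in lborel. d x * indicator {a} x = 0"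
      using AE_lborel_singleton[of a] by eventually_elim simp
  qed
  finally show ?thesis by simp
qed

lemma wigner_density_eq:
  "1 / (2 * pi) * sqrt (4 - x\<^sup>2) * indicator {-2<..<2} x = indicator {-2..2} x * (sqrt (4 - x\<^sup>2) / (2 * pi))"
  by (cases "x = 2 \<or> x = -2") (auto simp: indicator_def)

lemma sqrt_4_minus_nonneg: "indicator {-2..2} x * (sqrt (4 - x\<^sup>2) / (2 * pi)) \<ge> (0::real)"
  using abs_le_square_iff[of x 2] by (auto simp: indicator_def)

lemma has_bochner_integral_wigner:
  fixes g :: "real \<Rightarrow> real"
  assumes g: "g \<in> borel_measurable borel" "\<And>x. 0 \<le> g x"
    and I: "((\<lambda>x. sqrt (4 - x\<^sup>2) * g x) has_integral I) {-2..2}"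
  shows "has_bochner_integral wigner g (I / (2 * pi))"
proof (rule has_bochner_integral_nn_integral)
  show "g \<in> borel_measurable wigner" using g(1) by (simp add: wigner_def)
  have I': "((\<lambda>x. indicator {-2..2} x * (sqrt (4 - x\<^sup>2) / (2 * pi)) * g x) has_integral I / (2 * pi)) {-2..2}"
  proof (rule has_integral_eq[OF _ has_integral_divide[OF I, of "2 * pi"]])
    show "sqrt (4 - x\<^sup>2) * g x / (2 * pi) = indicator {-2..2} x * (sqrt (4 - x\<^sup>2) / (2 * pi)) * g x"
      if "x \<in> {-2..2}" for x using that by simp
  qed
  have nn: "0 \<le> indicator {-2..2} x * (sqrt (4 - x\<^sup>2) / (2 * pi)) * g x" for x
    by (intro mult_nonneg_nonneg[OF sqrt_4_minus_nonneg g(2)])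
  show "0 \<le> I / (2 * pi)" by (rule has_integral_nonneg[OF I']) (rule nn)
  have "(\<integral>\<^sup>+x. ennreal (g x) \<partial>wigner) =
      (\<integral>\<^sup>+x. ennreal (1 / (2 * pi) * sqrt (4 - x\<^sup>2) * indicator {-2<..<2} x) * ennreal (g x) \<partial>lborel)"
    unfolding wigner_def by (rule nn_integral_density) (use g in measurable)
  also have "\<dots> = (\<integral>\<^sup>+x. ennreal (indicator {-2..2} x * (sqrt (4 - x\<^sup>2) / (2 * pi)) * g x) \<partial>lborel)"
    unfolding wigner_density_eq ennreal_mult[OF sqrt_4_minus_nonneg g(2)] ..
  also have "\<dots> = ennreal (I / (2 * pi))"
  proof (rule nn_integral_has_integral_lborel[OF _ nn])
    show "((\<lambda>x. indicator {-2..2} x * (sqrt (4 - x\<^sup>2) / (2 * pi)) * g x) has_integral I / (2 * pi)) UNIV"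
      by (rule has_integral_eq[OF _ iffD2[OF has_integral_restrict_UNIV I']]) simp
  qed (use g in measurable)
  finally show "(\<integral>\<^sup>+x. ennreal (g x) \<partial>wigner) = ennreal (I / (2 * pi))" .
qed (simp add: g(2))

lemma semicircle_facts:
  fixes x :: real
  assumes x: "x \<in> {-2<..<2}"
  defines "s \<equiv> sqrt (4 - x\<^sup>2)"
  shows "x\<^sup>2 < 4" "s > 0" "s\<^sup>2 = 4 - x\<^sup>2"
    and "((\<lambda>x. arcsin (x / 2)) has_real_derivative inverse (s / 2) * (1 / 2)) (at x)"
proof -
  show "x\<^sup>2 < 4" using x abs_square_less_1[of "x / 2"] by (simp add: power_divide abs_less_iff)
  then show s: "s > 0" "s\<^sup>2 = 4 - x\<^sup>2" by (simp_all add: s_def)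
  have "1 - (x / 2)\<^sup>2 = (s / 2)\<^sup>2" using s(2) by (simp add: power_divide field_simps)
  then have a: "sqrt (1 - (x / 2)\<^sup>2) = s / 2" using s by simp
  show "((\<lambda>x. arcsin (x / 2)) has_real_derivative inverse (s / 2) * (1 / 2)) (at x)"
    by (rule DERIV_chain2[where f=arcsin and g="\<lambda>x. x / 2", OF DERIV_arcsin[of "x / 2", unfolded a]])
      (use x in \<open>auto intro!: derivative_eq_intros\<close>)
qed

lemma real_distribution_wigner: "real_distribution wigner"
proof -
  have "((\<lambda>x. sqrt (4 - x\<^sup>2)) has_integral
      ((2 * sqrt (4 - 2\<^sup>2) / 2 + 2 * arcsin (2 / 2)) - ((-2) * sqrt (4 - (-2)\<^sup>2) / 2 + 2 * arcsin ((-2) / 2)))) {-2..2}"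
  proof (rule fundamental_theorem_of_calculus_interior)
    show "continuous_on {-2..2} (\<lambda>x. x * sqrt (4 - x\<^sup>2) / 2 + 2 * arcsin (x / 2))"
      by (intro continuous_intros) auto
    fix x :: real assume x: "x \<in> {-2<..<2}"
    define s where "s = sqrt (4 - x\<^sup>2)"
    note semicircle_facts[OF x]
    then have "x\<^sup>2 < 4" and s: "s > 0" "s\<^sup>2 = 4 - x\<^sup>2"
      and 1: "((\<lambda>x. arcsin (x / 2)) has_real_derivative inverse (s / 2) * (1 / 2)) (at x)"
      unfolding s_def by blast+
    have "((\<lambda>x. sqrt (4 - x\<^sup>2)) has_real_derivative inverse s / 2 * (- (2 * x))) (at x)"
      unfolding s_def using \<open>x\<^sup>2 < 4\<close>
      by (intro DERIV_chain2[where f=sqrt and g="\<lambda>x. 4 - x\<^sup>2", OF DERIV_real_sqrt])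
        (auto intro!: derivative_eq_intros)
    from DERIV_add[OF DERIV_cdivide[OF DERIV_mult[OF DERIV_ident this], of 2] DERIV_cmult[OF 1, of 2]]
    have "((\<lambda>x. x * sqrt (4 - x\<^sup>2) / 2 + 2 * arcsin (x / 2)) has_real_derivative
        (s + x * (- (2 * x) * (inverse s / 2))) / 2 + 2 * (1 / 2 * inverse (s / 2))) (at x)"
      by (simp add: s_def mult_ac)
    moreover have "(s + x * (- (2 * x) * (inverse s / 2))) / 2 + 2 * (1 / 2 * inverse (s / 2)) = s"
    proof -
      have "x * x = 4 - s * s" using s(2) by (simp add: power2_eq_square)
      then show ?thesis using s(1) by (simp add: field_simps)
    qed
    ultimately show "((\<lambda>x. x * sqrt (4 - x\<^sup>2) / 2 + 2 * arcsin (x / 2)) has_vector_derivative sqrt (4 - x\<^sup>2)) (at x)"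
      by (simp add: s_def has_real_derivative_iff_has_vector_derivative)
  qed simp
  then have "has_bochner_integral wigner (\<lambda>x. 1 :: real) (2 * pi / (2 * pi))"
    by (intro has_bochner_integral_wigner) simp_all
  then have i: "integrable wigner (\<lambda>x. 1::real)" and l: "(LINT x|wigner. 1) = (1::real)"
    by (simp_all add: has_bochner_integral_iff)
  have "(\<integral>\<^sup>+x. ennreal 1 \<partial>wigner) = ennreal (LINT x|wigner. 1)"
    by (rule nn_integral_eq_integral[OF i]) simp
  also have "\<dots> = ennreal 1" by (simp only: l)
  finally have "(\<integral>\<^sup>+x. ennreal 1 \<partial>wigner) = ennreal 1" .
  then have "prob_space wigner"
    by (intro prob_spaceI) (simp only: nn_integral_const ennreal_1 mult_1)
  then show ?thesis
    by (intro real_distribution.intro real_distribution_axioms.intro) (simp_all add: wigner_def)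
qed

lemma wigner_resolvent:
  assumes v: "v > 0"
  shows "(LINT x|wigner. 1 / (1 + v\<^sup>2 * x\<^sup>2)) = (sqrt (1 + 4 * v\<^sup>2) - 1) / (2 * v\<^sup>2)"
proof -
  define r where "r = sqrt (1 + 4 * v\<^sup>2)"
  \<comment> \<open>An antiderivative of the integrand below. With \<open>w = sqrt (4 - x^2)\<close>
    and \<open>q^2 = 1 + v^2 * x^2\<close> one has
    \<open>w / q^2 = (r^2 / (w * q^2) - 1 / w) / v^2\<close>, and the two arcsines have derivatives
    \<open>r / (w * q^2)\<close> and \<open>1 / w\<close>.\<close>
  define \<Phi> where "\<Phi> x = (1 / v\<^sup>2) * (r * arcsin (r * x / (2 * sqrt (1 + v\<^sup>2 * x\<^sup>2))) - arcsin (x / 2))" for x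
  have r: "r > 0" "r\<^sup>2 = 1 + 4 * v\<^sup>2" unfolding r_def by (simp_all add: add_pos_nonneg)
  have pos: "1 + v\<^sup>2 * x\<^sup>2 > 0" for x by (intro add_pos_nonneg) auto
  \<comment> \<open>The argument of the first arcsine has modulus 1 exactly at the ends of the
    support, so \<open>\<Phi>\<close> is continuous on the closed interval and differentiable
    inside.\<close>
  have key: "1 - (r * x / (2 * sqrt (1 + v\<^sup>2 * x\<^sup>2)))\<^sup>2 = (4 - x\<^sup>2) / (4 * (1 + v\<^sup>2 * x\<^sup>2))" for x
  proof -
    have "(r * x / (2 * sqrt (1 + v\<^sup>2 * x\<^sup>2)))\<^sup>2 = (1 + 4 * v\<^sup>2) * x\<^sup>2 / (4 * (1 + v\<^sup>2 * x\<^sup>2))"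
      using pos[of x] by (simp add: power_divide power_mult_distrib r(2))
    then show ?thesis using pos[of x] by (simp add: field_simps)
  qed
  have "((\<lambda>x. sqrt (4 - x\<^sup>2) * (1 / (1 + v\<^sup>2 * x\<^sup>2))) has_integral (\<Phi> 2 - \<Phi> (-2))) {-2..2}"
  proof (rule fundamental_theorem_of_calculus_interior)
    have bound: "-1 \<le> r * x / (2 * sqrt (1 + v\<^sup>2 * x\<^sup>2)) \<and> r * x / (2 * sqrt (1 + v\<^sup>2 * x\<^sup>2)) \<le> 1"
      if "x \<in> {-2..2}" for x
    proof -
      have "x\<^sup>2 \<le> 4" using abs_le_square_iff[of x 2] that by auto
      then have "(r * x / (2 * sqrt (1 + v\<^sup>2 * x\<^sup>2)))\<^sup>2 \<le> 1"
      proof -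
        have "0 \<le> (4 - x\<^sup>2) / (4 * (1 + v\<^sup>2 * x\<^sup>2))"
          using \<open>x\<^sup>2 \<le> 4\<close> pos[of x] by (intro divide_nonneg_pos) auto
        then show ?thesis using key[of x] by linarith
      qed
      then have "\<bar>r * x / (2 * sqrt (1 + v\<^sup>2 * x\<^sup>2))\<bar> \<le> 1" by (simp only: abs_square_le_1)
      then show ?thesis by linarith
    qed
    have "sqrt (1 + v\<^sup>2 * x\<^sup>2) \<noteq> 0" for x using pos[of x] by simp
    then show "continuous_on {-2..2} \<Phi>"
      unfolding \<Phi>_def using bound by (intro continuous_intros) auto
    fix x :: real assume x: "x \<in> {-2<..<2}"
    define s where "s = sqrt (4 - x\<^sup>2)"
    define q where "q = sqrt (1 + v\<^sup>2 * x\<^sup>2)"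
    note semicircle_facts[OF x]
    then have "x\<^sup>2 < 4" and s: "s > 0" "s\<^sup>2 = 4 - x\<^sup>2"
      and 1: "((\<lambda>x. arcsin (x / 2)) has_real_derivative inverse (s / 2) * (1 / 2)) (at x)"
      unfolding s_def by blast+
    have q: "q > 0" "q\<^sup>2 = 1 + v\<^sup>2 * x\<^sup>2" using pos[of x] by (simp_all add: q_def)
    have b: "sqrt (1 - (r * x / (2 * q))\<^sup>2) = s / (2 * q)"
    proof -
      have "1 - (r * x / (2 * q))\<^sup>2 = (s / (2 * q))\<^sup>2"
        using key[of x] q s(2) by (simp add: q_def power_divide power_mult_distrib)
      then show ?thesis using s q by simp
    qed
    have dq: "((\<lambda>x. sqrt (1 + v\<^sup>2 * x\<^sup>2)) has_real_derivative inverse q / 2 * (v\<^sup>2 * (2 * x))) (at x)"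
      unfolding q_def by (rule DERIV_chain2[where f=sqrt and g="\<lambda>x. 1 + v\<^sup>2 * x\<^sup>2", OF DERIV_real_sqrt[OF pos]]) (auto intro!: derivative_eq_intros)
    have dp: "((\<lambda>x. r * x / (2 * sqrt (1 + v\<^sup>2 * x\<^sup>2))) has_real_derivative
        (r * (2 * q) - r * x * (2 * (inverse q / 2 * (v\<^sup>2 * (2 * x))))) / ((2 * q) * (2 * q))) (at x)"
    proof -
      have "((\<lambda>x. r * x) has_real_derivative r) (at x)" by (auto intro!: derivative_eq_intros)
      from DERIV_divide[OF this DERIV_cmult[OF dq, of 2]] show ?thesis
        using q(1) unfolding q_def[symmetric] by simp
    qed
    have p1: "-1 < r * x / (2 * q)" "r * x / (2 * q) < 1"
    proof -
      have "1 - (r * x / (2 * q))\<^sup>2 > 0"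
        using key[of x] pos[of x] \<open>x\<^sup>2 < 4\<close> by (simp add: q_def)
      then have "\<bar>r * x / (2 * q)\<bar> < 1" unfolding abs_square_less_1[symmetric] by linarith
      then show "-1 < r * x / (2 * q)" "r * x / (2 * q) < 1" by linarith+
    qed
    have 2: "((\<lambda>x. arcsin (r * x / (2 * sqrt (1 + v\<^sup>2 * x\<^sup>2)))) has_real_derivative inverse (s / (2 * q)) *
        ((r * (2 * q) - r * x * (2 * (inverse q / 2 * (v\<^sup>2 * (2 * x))))) / ((2 * q) * (2 * q)))) (at x)"
      by (rule DERIV_chain2[where f=arcsin and g="\<lambda>x. r * x / (2 * sqrt (1 + v\<^sup>2 * x\<^sup>2))",
          OF DERIV_arcsin[OF p1, unfolded b, unfolded q_def] dp, folded q_def])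
    have 3: "(\<Phi> has_real_derivative (1 / v\<^sup>2) * (r * (inverse (s / (2 * q)) *
        ((r * (2 * q) - r * x * (2 * (inverse q / 2 * (v\<^sup>2 * (2 * x))))) / ((2 * q) * (2 * q)))) - inverse (s / 2) * (1 / 2))) (at x)"
      unfolding \<Phi>_def by (intro DERIV_cmult DERIV_diff 1 2)
    have "(r * (2 * q) - r * x * (2 * (inverse q / 2 * (v\<^sup>2 * (2 * x))))) / ((2 * q) * (2 * q)) = r / (2 * q * q\<^sup>2)"
    proof -
      have "r * (2 * q) - r * x * (2 * (inverse q / 2 * (v\<^sup>2 * (2 * x)))) = 2 * r * (q - (v\<^sup>2 * x\<^sup>2) * inverse q)"
        by (simp add: power2_eq_square algebra_simps)
      also have "v\<^sup>2 * x\<^sup>2 = q\<^sup>2 - 1" using q(2) by simp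
      also have "2 * r * (q - (q\<^sup>2 - 1) * inverse q) = 2 * r / q"
        using q(1) by (simp add: field_simps power2_eq_square)
      finally show ?thesis using q(1) by (simp add: power2_eq_square)
    qed
    then have "(1 / v\<^sup>2) * (r * (inverse (s / (2 * q)) *
        ((r * (2 * q) - r * x * (2 * (inverse q / 2 * (v\<^sup>2 * (2 * x))))) / ((2 * q) * (2 * q)))) - inverse (s / 2) * (1 / 2))
       = (1 / v\<^sup>2) * (r * (inverse (s / (2 * q)) * (r / (2 * q * q\<^sup>2))) - inverse (s / 2) * (1 / 2))"
      by simp
    also have "\<dots> = (1 / v\<^sup>2) * ((r\<^sup>2 - q\<^sup>2) / (s * q\<^sup>2))"
      using q(1) s(1) by (simp add: field_simps power2_eq_square)
    also have "r\<^sup>2 - q\<^sup>2 = v\<^sup>2 * s\<^sup>2" unfolding r(2) q(2) s(2) by (simp add: algebra_simps)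
    also have "(1 / v\<^sup>2) * (v\<^sup>2 * s\<^sup>2 / (s * q\<^sup>2)) = s * (1 / q\<^sup>2)"
      using v s(1) by (simp add: power2_eq_square)
    also have "\<dots> = sqrt (4 - x\<^sup>2) * (1 / (1 + v\<^sup>2 * x\<^sup>2))" by (simp add: s_def q(2))
    finally show "(\<Phi> has_vector_derivative sqrt (4 - x\<^sup>2) * (1 / (1 + v\<^sup>2 * x\<^sup>2))) (at x)"
      using 3 by (simp only: has_real_derivative_iff_has_vector_derivative)
  qed simp
  then have "has_bochner_integral wigner (\<lambda>x. 1 / (1 + v\<^sup>2 * x\<^sup>2)) ((\<Phi> 2 - \<Phi> (-2)) / (2 * pi))"
    using pos by (intro has_bochner_integral_wigner) (auto intro: less_imp_le)
  moreover have "\<Phi> 2 - \<Phi> (-2) = pi * (r - 1) / v\<^sup>2"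
  proof -
    have "sqrt (1 + v\<^sup>2 * 2\<^sup>2) = r" "sqrt (1 + v\<^sup>2 * (-2)\<^sup>2) = r" by (simp_all add: r_def mult.commute)
    then have "\<Phi> 2 = (1 / v\<^sup>2) * (r * (pi / 2) - pi / 2)" "\<Phi> (-2) = (1 / v\<^sup>2) * (r * (- (pi / 2)) - (- (pi / 2)))"
      using r(1) by (simp_all add: \<Phi>_def)
    then show ?thesis using v by (simp add: field_simps)
  qed
  ultimately show ?thesis using v by (simp add: has_bochner_integral_iff r_def)
qed

lemma wigner_in_prob_sym: "wigner \<in> prob_sym"
proof -
  define d where "d x = 1 / (2 * pi) * sqrt (4 - x\<^sup>2) * indicator {-2<..<2} x" for x :: real
  have d: "d \<in> borel_measurable lborel" "\<And>x. d x \<ge> 0" "\<And>x. d (- x) = d x"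
  proof -
    show "d \<in> borel_measurable lborel" unfolding d_def[abs_def] by measurable
    show "d x \<ge> 0" for x unfolding d_def wigner_density_eq by (rule sqrt_4_minus_nonneg)
    show "d (- x) = d x" for x by (auto simp: d_def indicator_def)
  qed
  have w: "wigner = density lborel (\<lambda>x. ennreal (d x))" by (simp add: wigner_def d_def)
  have "char wigner (- t) = char wigner t" for t
  proof -
    have c: "char wigner t = (LINT x|lborel. d x *\<^sub>R iexp (t * x))" for t
      unfolding char_def w by (rule integral_density) (use d in auto)
    have "char wigner (- t) = \<bar>-1\<bar> *\<^sub>R (LINT x|lborel. d (0 + (-1) * x) *\<^sub>R iexp (- t * (0 + (-1) * x)))"
      unfolding c by (rule lborel_integral_real_affine) simp
    also have "\<dots> = char wigner t" unfolding c by (simp add: d(3))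
    finally show ?thesis .
  qed
  then show ?thesis
    using distr_uminus_eqI[OF real_distribution_wigner] real_distribution_wigner
    by (simp add: prob_sym_def prob_R_def)
qed

lemma wigner_neq_dirac0: "wigner \<noteq> dirac0"
proof
  assume "wigner = dirac0"
  moreover have "emeasure dirac0 {0} = 1" by (simp add: emeasure_return)
  ultimately have "emeasure wigner {0} = 1" by (simp only:)
  moreover have "emeasure wigner {0} = 0"
    unfolding wigner_def by (rule emeasure_density_lborel_singleton) measurable
  ultimately show False by simp
qed

text \<open>This inverts psi of the Wigner law: \<open>sqrt u / (1 - u)\<close> is the value
  \<open>v\<close> for which \<open>1 + 4 * v^2\<close> is the square of
  \<open>(1 + u) / (1 - u)\<close>.\<close>

lemma wigner_moment_transform:
  assumes u: "0 < u" "u < 1"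
  shows "(LINT x|wigner. (sqrt u / (1 - u))\<^sup>2 * x\<^sup>2 / (1 + (sqrt u / (1 - u))\<^sup>2 * x\<^sup>2)) = u"
proof -
  interpret real_distribution wigner by (rule real_distribution_wigner)
  define v where "v = sqrt u / (1 - u)"
  have v: "v > 0" "v\<^sup>2 = u / (1 - u)\<^sup>2" using u by (simp_all add: v_def power_divide)
  have pos: "1 + v\<^sup>2 * x\<^sup>2 > 0" for x by (intro add_pos_nonneg) auto
  have "1 + 4 * v\<^sup>2 = ((1 + u) / (1 - u))\<^sup>2"
    using u by (simp add: v(2) power_divide field_simps) (simp add: power2_eq_square algebra_simps)
  then have r: "sqrt (1 + 4 * v\<^sup>2) = (1 + u) / (1 - u)" using u by simp
  have "(LINT x|wigner. v\<^sup>2 * x\<^sup>2 / (1 + v\<^sup>2 * x\<^sup>2)) = (LINT x|wigner. 1 - 1 / (1 + v\<^sup>2 * x\<^sup>2))"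
  proof (rule Bochner_Integration.integral_cong)
    show "v\<^sup>2 * x\<^sup>2 / (1 + v\<^sup>2 * x\<^sup>2) = 1 - 1 / (1 + v\<^sup>2 * x\<^sup>2)" for x
      using pos[of x] by (simp add: field_simps)
  qed simp
  also have "\<dots> = 1 - (LINT x|wigner. 1 / (1 + v\<^sup>2 * x\<^sup>2))"
  proof -
    have "integrable wigner (\<lambda>x. 1 / (1 + v\<^sup>2 * x\<^sup>2))"
      by (rule integrable_bounded[OF fin_borel_real_distribution[OF real_distribution_wigner], of _ 1])
        (auto simp: divide_le_eq pos less_imp_le)
    from Bochner_Integration.integral_diff[OF _ this, of "\<lambda>_. 1"] show ?thesis
      using prob_space by (simp add: space_eq_univ)
  qed
  also have "\<dots> = 1 - ((1 + u) / (1 - u) - 1) / (2 * v\<^sup>2)" by (simp only: wigner_resolvent[OF v(1)] r)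
  also have "\<dots> = u"
  proof -
    have "(1 + u) / (1 - u) - 1 = 2 * u / (1 - u)" using u by (simp add: field_simps)
    moreover have "2 * u / (1 - u) / (2 * v\<^sup>2) = 1 - u"
      unfolding v(2) using u by (simp add: power2_eq_square divide_simps)
    ultimately show ?thesis by simp
  qed
  finally show ?thesis by (simp only: v_def)
qed

lemma is_free_mult_conv_wignerD:
  assumes conv: "is_free_mult_conv L wigner M"
  shows "L \<in> prob_pos" "M \<in> prob_sym"
  using conv prob_sym_not_pos[OF wigner_in_prob_sym wigner_neq_dirac0]
  by (auto simp: is_free_mult_conv_def)

text \<open>At \<open>- u\<close> the S-transform identity links three values of chi,
  \<open>- \<i> * y\<close> for \<open>M\<close>, \<open>- \<i> * sqrt u / (1 - u)\<close> for the
  Wigner law and \<open>- k\<close> for \<open>L\<close>. Solving for \<open>k\<close> gives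
  \<open>k = y * sqrt u\<close>.\<close>

lemma is_free_mult_conv_wigner_moment_transform:
  assumes conv: "is_free_mult_conv L wigner M" and M: "M \<noteq> dirac0"
  shows "\<exists>\<epsilon>>0. \<forall>y u. y > 0 \<longrightarrow> 0 < u \<longrightarrow> u < \<epsilon> \<longrightarrow> (LINT x|M. y\<^sup>2 * x\<^sup>2 / (1 + y\<^sup>2 * x\<^sup>2)) = u \<longrightarrow>
     (LINT x|L. (y * sqrt u) * x / (1 + (y * sqrt u) * x)) = u"
proof -
  have Lp: "L \<in> prob_pos" and Ms: "M \<in> prob_sym" by (rule is_free_mult_conv_wignerD[OF conv])+
  have Ld: "L \<noteq> dirac0" using conv M by (auto simp: is_free_mult_conv_def)
  obtain U \<epsilon> where \<epsilon>: "\<epsilon> > 0" "complex_of_real ` {-\<epsilon><..<0} \<subseteq> U" "U \<subseteq> S_dom L"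
    and S: "\<And>z. z \<in> U \<Longrightarrow> S_transform M z = S_transform L z * S_transform wigner z"
    using conv Ld wigner_neq_dirac0 by (auto simp: is_free_mult_conv_def)
  \<comment> \<open>The bound by 1 makes \<open>v\<close> positive, so that
    \<open>wigner_moment_transform\<close> applies.\<close>
  have "(LINT x|L. (y * sqrt u) * x / (1 + (y * sqrt u) * x)) = u"
    if y: "y > 0" and u: "0 < u" "u < min \<epsilon> 1" and yu: "(LINT x|M. y\<^sup>2 * x\<^sup>2 / (1 + y\<^sup>2 * x\<^sup>2)) = u" for y u
  proof -
    have "complex_of_real (- u) \<in> U" using \<epsilon>(2) u by (intro subsetD[OF \<epsilon>(2)] imageI) auto
    then have uU: "- complex_of_real u \<in> U" by simp
    have dom: "- complex_of_real u \<in> S_dom L" using uU \<epsilon>(3) by blast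
    obtain k where k: "k > 0" "chi_transform L (- of_real u) = - of_real k" "(LINT x|L. k * x / (1 + k * x)) = u"
      using chi_transform_pos[OF Lp Ld dom] by blast
    define v where "v = sqrt u / (1 - u)"
    have v: "v > 0" using u by (simp add: v_def)
    have cw: "chi_transform wigner (- of_real u) = - \<i> * of_real v"
      by (rule chi_transform_sym[OF wigner_in_prob_sym wigner_neq_dirac0 v])
        (use wigner_moment_transform[of u] u in \<open>simp add: v_def\<close>)
    have cM: "chi_transform M (- of_real u) = - \<i> * of_real y"
      by (rule chi_transform_sym[OF Ms M y yu])
    define c where "c = (1 + - complex_of_real u) / - complex_of_real u"
    have c: "c \<noteq> 0" using u by (auto simp: c_def complex_eq_iff)
    have "- \<i> * of_real y * c = - of_real k * c * (- \<i> * of_real v * c)"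
      using S[OF uU] by (simp only: S_transform_def cM cw k(2) c_def)
    then have "(- \<i> * c) * of_real y = (- \<i> * c) * (- of_real (k * v) * c)" by (simp add: mult_ac)
    then have "of_real y = - of_real (k * v) * c" using c by (simp only: mult_cancel_left) simp
    also have "\<dots> = of_real (k * v * ((1 - u) / u))" by (simp add: c_def)
    finally have "y = k * v * ((1 - u) / u)" by (simp only: of_real_eq_iff)
    also have "\<dots> = k * (sqrt u / u)" using u by (simp add: v_def)
    finally have "y * sqrt u = k * (sqrt u * sqrt u / u)" by simp
    then have "y * sqrt u = k" using u by simp
    then show ?thesis using k(3) by simp
  qed
  then show ?thesis using \<epsilon>(1) by (intro exI[of _ "min \<epsilon> 1"]) auto
qed

section \<open>Analytic continuation of moment transforms\<close>

text \<open>The kernel equals \<open>1 - 1 / (1 + z * f x)\<close> with a denominator of modulus at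
  least 1, whence the uniform bound 2.\<close>

lemma holomorphic_moment_transform:
  assumes M: "fin_borel M" and f: "f \<in> borel_measurable borel" "\<And>x. f x \<ge> (0::real)"
  shows "(\<lambda>z. LINT x|M. z * of_real (f x) / (1 + z * of_real (f x))) holomorphic_on {z. Re z > 0}"
proof (rule holomorphic_on_lebesgue_integral[where B=2])
  have ge1: "norm (1 + z * of_real (f x)) \<ge> 1" if "Re z > 0" for z x
  proof -
    have "Re (1 + z * of_real (f x)) \<ge> 1" using that f(2)[of x] by simp
    then show ?thesis using complex_Re_le_cmod[of "1 + z * of_real (f x)"] by linarith
  qed
  then have n: "1 + z * of_real (f x) \<noteq> 0" if "Re z > 0" for z x
    using that by (metis norm_zero not_one_le_zero)
  show "open {z. Re z > 0}" by (rule open_halfspace_Re_gt)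
  show "(\<lambda>z. z * of_real (f x) / (1 + z * of_real (f x))) holomorphic_on {z. Re z > 0}" for x
    using n by (intro holomorphic_intros) auto
  show "(\<lambda>x. z * of_real (f x) / (1 + z * of_real (f x))) \<in> borel_measurable M" for z :: complex
    by (rule borel_measurable_fin_borel[OF M]) (use f(1) in measurable)
  show "norm (z * of_real (f x) / (1 + z * of_real (f x))) \<le> 2" if "z \<in> {z. Re z > 0}" for z x
  proof -
    have z: "Re z > 0" using that by simp
    have "z * of_real (f x) / (1 + z * of_real (f x)) = 1 - 1 / (1 + z * of_real (f x))"
      using n[OF z, of x] by (simp add: field_simps)
    also have "norm \<dots> \<le> norm (1::complex) + norm (1 / (1 + z * of_real (f x)))" by (rule norm_triangle_ineq4)
    also have "norm (1 / (1 + z * of_real (f x))) \<le> 1" using ge1[OF z, of x] by (simp add: norm_divide divide_le_eq)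
    finally show ?thesis by simp
  qed
qed (rule fin_borelD[OF M])

text \<open>For \<open>x \<ge> 0\<close> the kernel is concave in \<open>k\<close>. The slope
  inequality is stated with the denominators multiplied out, so that it integrates directly.\<close>

lemma moment_transform_concave:
  assumes L: "real_distribution L" "AE x in L. x \<ge> 0" and k: "0 < k1" "k1 < k2" "k2 < k3"
  defines "\<Phi> \<equiv> \<lambda>k. LINT x|L. k * x / (1 + k * x)"
  shows "(\<Phi> k3 - \<Phi> k2) * (k2 - k1) \<le> (\<Phi> k2 - \<Phi> k1) * (k3 - k2)"
proof -
  have id: "(\<lambda>x::real. x) \<in> borel_measurable borel" by simp
  have i: "integrable L (\<lambda>x. k * x / (1 + k * x))" if "k > 0" for k
  proof (rule finite_measure.integrable_const_bound[where B=1])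
    show "finite_measure L" by (rule fin_borelD[OF fin_borel_real_distribution[OF L(1)]])
    show "AE x in L. norm (k * x / (1 + k * x)) \<le> 1"
      using L(2) by eventually_elim (use that in \<open>simp only: norm_moment_kernel_le_1 mult_nonneg_nonneg less_imp_le\<close>)
    show "(\<lambda>x. k * x / (1 + k * x)) \<in> borel_measurable L"
      by (rule borel_measurable_fin_borel[OF fin_borel_real_distribution[OF L(1)]]) measurable
  qed
  have k': "k2 > 0" "k3 > 0" using k by auto
  have d: "\<Phi> b - \<Phi> a = (LINT x|L. b * x / (1 + b * x) - a * x / (1 + a * x))" if "a > 0" "b > 0" for a b
    unfolding \<Phi>_def using i that by simp
  have id: "integrable L (\<lambda>x. b * x / (1 + b * x) - a * x / (1 + a * x))" if "a > 0" "b > 0" for a b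
    using i that by (intro Bochner_Integration.integrable_diff) auto
  have "(\<Phi> k3 - \<Phi> k2) * (k2 - k1) = (LINT x|L. (k3 * x / (1 + k3 * x) - k2 * x / (1 + k2 * x)) * (k2 - k1))"
    unfolding d[OF k'] by (rule integral_mult_left_zero[symmetric])
  also have "\<dots> \<le> (LINT x|L. (k2 * x / (1 + k2 * x) - k1 * x / (1 + k1 * x)) * (k3 - k2))"
  proof (rule integral_mono_AE)
    show "AE x in L. (k3 * x / (1 + k3 * x) - k2 * x / (1 + k2 * x)) * (k2 - k1)
        \<le> (k2 * x / (1 + k2 * x) - k1 * x / (1 + k1 * x)) * (k3 - k2)"
      using L(2)
    proof eventually_elim
      case (elim x)
      have p: "1 + k1 * x > 0" "1 + k2 * x > 0" "1 + k3 * x > 0"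
        using elim k by (intro add_pos_nonneg mult_nonneg_nonneg; simp)+
      have diff: "b * x / (1 + b * x) - a * x / (1 + a * x) = (b - a) * x / ((1 + b * x) * (1 + a * x))"
        if "1 + a * x > 0" "1 + b * x > 0" for a b
        using that by (simp add: divide_simps) (simp add: algebra_simps)
      have "(k3 - k2) * x / ((1 + k3 * x) * (1 + k2 * x)) * (k2 - k1) =
          ((k3 - k2) * (k2 - k1) * x / (1 + k2 * x)) * (1 / (1 + k3 * x))" by (simp add: mult_ac)
      also have "\<dots> \<le> ((k3 - k2) * (k2 - k1) * x / (1 + k2 * x)) * (1 / (1 + k1 * x))"
        using p k elim by (intro mult_left_mono divide_left_mono divide_nonneg_pos mult_nonneg_nonneg mult_pos_pos) (auto intro: mult_right_mono)
      also have "\<dots> = (k2 - k1) * x / ((1 + k2 * x) * (1 + k1 * x)) * (k3 - k2)" by (simp add: mult_ac)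
      finally show ?case using diff[OF p(2,3)] diff[OF p(1,2)] by simp
    qed
  qed (intro integrable_mult_left id k' k(1))+
  also have "\<dots> = (\<Phi> k2 - \<Phi> k1) * (k3 - k2)"
    unfolding d[OF k(1) k'(1)] by (rule integral_mult_left_zero)
  finally show ?thesis .
qed

text \<open>Both sides are holomorphic in \<open>T\<close> near the positive half-line.\<close>

lemma moment_transform_continuation:
  fixes c :: "real \<Rightarrow> real"
  assumes \<nu>: "fin_borel \<nu>" and L: "real_distribution L" "AE x in L. x \<ge> 0"
  defines "c \<equiv> \<lambda>T. LINT x|\<nu>. T * x\<^sup>2 / (1 + T * x\<^sup>2)"
    and "\<Phi> \<equiv> \<lambda>k. LINT x|L. k * x / (1 + k * x)"
  assumes c01: "\<And>T. T > 0 \<Longrightarrow> 0 < c T \<and> c T < 1"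
    and "\<delta> > 0" and eq: "\<And>T. 0 < T \<Longrightarrow> T < \<delta> \<Longrightarrow> \<Phi> (sqrt (T * c T) / (1 - c T)) = c T"
    and "T > 0"
  shows "\<Phi> (sqrt (T * c T) / (1 - c T)) = c T"
proof -
  define C where "C z = (LINT x|\<nu>. z * of_real (x\<^sup>2) / (1 + z * of_real (x\<^sup>2)))" for z :: complex
  \<comment> \<open>\<open>max x 0\<close> turns the almost sure sign condition into one at every
    point, as \<open>holomorphic_moment_transform\<close> requires.\<close>
  define P where "P z = (LINT x|L. z * of_real (max x 0) / (1 + z * of_real (max x 0)))" for z :: complex
  define K where "K z = csqrt (z * C z) / (1 - C z)" for z
  have holC: "C holomorphic_on {z. Re z > 0}"
    unfolding C_def by (rule holomorphic_moment_transform[OF \<nu>]) auto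
  have holP: "P holomorphic_on {z. Re z > 0}"
    unfolding P_def by (rule holomorphic_moment_transform[OF fin_borel_real_distribution[OF L(1)]]) auto
  have Creal: "C (of_real t) = of_real (c t)" for t
  proof -
    have "(\<lambda>x. complex_of_real t * of_real (x\<^sup>2) / (1 + of_real t * of_real (x\<^sup>2))) =
        (\<lambda>x. complex_of_real (t * x\<^sup>2 / (1 + t * x\<^sup>2)))" by (rule ext) simp
    then show ?thesis unfolding C_def c_def by (simp only: integral_complex_of_real)
  qed
  have Preal: "P (of_real k) = of_real (\<Phi> k)" for k
  proof -
    have "P (of_real k) = (LINT x|L. complex_of_real (k * x / (1 + k * x)))"
      unfolding P_def
    proof (rule integral_cong_AE)
      show "AE x in L. complex_of_real k * of_real (max x 0) / (1 + of_real k * of_real (max x 0)) =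
          complex_of_real (k * x / (1 + k * x))"
        using L(2) by eventually_elim (simp add: max_def)
    qed (rule borel_measurable_fin_borel[OF fin_borel_real_distribution[OF L(1)]], measurable)+
    then show ?thesis unfolding \<Phi>_def by (simp only: integral_complex_of_real)
  qed
  \<comment> \<open>The domain shrinks in stages: \<open>C\<close> is holomorphic on
    \<open>W1\<close>, the square root avoids its branch cut on \<open>W2\<close>, the denominator
    of \<open>K\<close> is nonzero on \<open>W3\<close>, and on \<open>W4\<close> the values of
    \<open>K\<close> lie where \<open>P\<close> is holomorphic.\<close>
  define W1 where "W1 = {z. Re z > 0}"
  define W2 where "W2 = W1 \<inter> (\<lambda>z. z * C z) -` (- \<real>\<^sub>\<le>\<^sub>0)"
  define W3 where "W3 = W2 \<inter> C -` (- {1})"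
  define W4 where "W4 = W3 \<inter> K -` {z. Re z > 0}"
  have o1: "open W1" unfolding W1_def by (rule open_halfspace_Re_gt)
  have C1: "continuous_on W1 C" using holC unfolding W1_def by (rule holomorphic_on_imp_continuous_on)
  have o2: "open W2"
    unfolding W2_def by (rule continuous_open_preimage[OF _ o1]) (auto intro!: continuous_intros C1 closed_nonpos_Reals_complex)
  have o3: "open W3"
    unfolding W3_def
    by (rule continuous_open_preimage[OF continuous_on_subset[OF C1] o2]) (auto simp: W2_def)
  have sub: "W3 \<subseteq> {z. Re z > 0}" by (auto simp: W3_def W2_def W1_def)
  have holK: "K holomorphic_on W3"
    unfolding K_def using holomorphic_on_subset[OF holC sub]
    by (intro holomorphic_intros) (auto simp: W3_def W2_def)
  have o4: "open W4"
    unfolding W4_def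
    by (rule continuous_open_preimage[OF holomorphic_on_imp_continuous_on[OF holK] o3]) (rule open_halfspace_Re_gt)
  have holh: "(\<lambda>z. P (K z) - C z) holomorphic_on W4"
  proof (intro holomorphic_intros)
    have "P \<circ> K holomorphic_on W4"
      by (rule holomorphic_on_compose_gen[OF _ holP]) (auto simp: W4_def intro: holomorphic_on_subset[OF holK])
    then show "(\<lambda>z. P (K z)) holomorphic_on W4" by (simp add: comp_def)
    show "C holomorphic_on W4" using sub by (intro holomorphic_on_subset[OF holC]) (auto simp: W4_def)
  qed
  have Kreal: "K (of_real t) = of_real (sqrt (t * c t) / (1 - c t))" if "t > 0" for t
  proof -
    have "csqrt (of_real (t * c t)) = of_real (sqrt (t * c t))"
      using c01[OF that] that by (intro of_real_sqrt[symmetric] mult_nonneg_nonneg) auto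
    then show ?thesis by (simp add: K_def Creal)
  qed
  have realW: "complex_of_real t \<in> W4" if t: "t > 0" for t
  proof -
    note c = c01[OF t]
    have "complex_of_real t \<in> W1" using t by (simp add: W1_def)
    moreover have "complex_of_real t * C (of_real t) \<notin> \<real>\<^sub>\<le>\<^sub>0"
    proof -
      have "t * c t > 0" using t c by simp
      then show ?thesis unfolding Creal of_real_mult[symmetric] nonpos_Reals_of_real_iff by linarith
    qed
    moreover have "C (of_real t) \<noteq> 1" using c by (auto simp: Creal)
    moreover have "Re (K (of_real t)) > 0"
      unfolding Kreal[OF t] using c t by simp
    ultimately show ?thesis by (simp add: W4_def W3_def W2_def)
  qed
  \<comment> \<open>Connectedness of \<open>W4\<close> is not asserted; the component of
    \<open>T\<close> is enough because it contains the whole positive half-line.\<close>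
  define S where "S = connected_component_set W4 (of_real T)"
  have "connected (complex_of_real ` {0<..})"
    by (intro connected_continuous_image continuous_intros connected_Ioi)
  then have R: "complex_of_real ` {0<..} \<subseteq> S"
    unfolding S_def using realW \<open>T > 0\<close> by (intro connected_component_maximal) auto
  \<comment> \<open>The limit point has to lie in \<open>S\<close>, which excludes the end 0; hence
    the midpoint of the interval.\<close>
  have "P (K (of_real T)) - C (of_real T) = 0"
  proof (rule analytic_continuation[where f="\<lambda>z. P (K z) - C z" and w="of_real T" and S=S and U="complex_of_real ` {0<..<\<delta>}" and \<xi>="of_real (\<delta> / 2)"])
    show "(\<lambda>z. P (K z) - C z) holomorphic_on S"
      using holh by (rule holomorphic_on_subset) (simp add: S_def connected_component_subset)
    show "open S" unfolding S_def by (rule open_connected_component[OF o4])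
    show "connected S" unfolding S_def by (rule connected_connected_component)
    show "complex_of_real ` {0<..<\<delta>} \<subseteq> S" using R by auto
    show "complex_of_real (\<delta> / 2) \<in> S" using R \<open>\<delta> > 0\<close> by (intro subsetD[OF R] imageI) simp
    show "complex_of_real (\<delta> / 2) islimpt complex_of_real ` {0<..<\<delta>}"
      unfolding islimpt_sequential
    proof (intro exI conjI allI)
      let ?s = "\<lambda>n. \<delta> / 2 + (\<delta> / 4) / real (Suc n)"
      show "complex_of_real (?s n) \<in> complex_of_real ` {0<..<\<delta>} - {complex_of_real (\<delta> / 2)}" for n
      proof -
        have "(\<delta> / 4) / real (Suc n) \<le> (\<delta> / 4) / 1" using \<open>\<delta> > 0\<close> by (intro divide_left_mono) auto
        moreover have "(\<delta> / 4) / real (Suc n) > 0" using \<open>\<delta> > 0\<close> by simp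
        ultimately have "0 < ?s n" "?s n < \<delta>" "?s n \<noteq> \<delta> / 2" using \<open>\<delta> > 0\<close> by linarith+
        then have "?s n \<in> {0<..<\<delta>}" "?s n \<noteq> \<delta> / 2" by simp_all
        then show ?thesis by (auto simp only: of_real_eq_iff Diff_iff image_eqI singleton_iff)
      qed
      have "?s \<longlonglongrightarrow> \<delta> / 2" by real_asymp
      then show "(\<lambda>n. complex_of_real (?s n)) \<longlonglongrightarrow> complex_of_real (\<delta> / 2)" by (rule tendsto_of_real)
    qed
    show "P (K z) - C z = 0" if "z \<in> complex_of_real ` {0<..<\<delta>}" for z
    proof -
      from that obtain t where t: "z = of_real t" "0 < t" "t < \<delta>" by auto
      show ?thesis unfolding t(1) Kreal[OF t(2)] Preal Creal eq[OF t(2,3)] by simp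
    qed
    show "complex_of_real T \<in> S" using R \<open>T > 0\<close> by auto
  qed
  then show ?thesis
    unfolding Kreal[OF \<open>T > 0\<close>] Preal Creal by (simp only: right_minus_eq of_real_eq_iff)
qed

text \<open>At \<open>\<i> * s\<close> with \<open>s = 1 / sqrt T\<close> the Cauchy transform of
  the generator is \<open>- \<i> * s * c\<close>, so \<open>recip_cauchy M\<close> maps
  \<open>\<i> / y\<close> to \<open>\<i> * s\<close>. Then psi of \<open>M\<close> at
  \<open>- \<i> * y\<close> is \<open>1 / (y * s) - 1\<close>, which equals
  \<open>- c\<close>.\<close>

lemma generator_moment_transform:
  assumes \<nu>: "fin_borel \<nu>" "distr \<nu> borel uminus = \<nu>" "integrable \<nu> (\<lambda>x. x\<^sup>2)"
    and gen: "additive_generator M (second_moment \<nu>)" and M: "M \<in> prob_sym"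
    and T: "T > 0"
  defines "c \<equiv> LINT x|\<nu>. T * x\<^sup>2 / (1 + T * x\<^sup>2)"
  assumes c: "c < 1"
  defines "y \<equiv> sqrt T / (1 - c)"
  shows "(LINT x|M. y\<^sup>2 * x\<^sup>2 / (1 + y\<^sup>2 * x\<^sup>2)) = c"
proof -
  define s where "s = 1 / sqrt T"
  define \<tau> where "\<tau> = second_moment \<nu>"
  have s: "s > 0" "s\<^sup>2 = 1 / T" using T by (simp_all add: s_def power_divide)
  have y: "y > 0" "s * (1 - c) = 1 / y" using T c by (simp_all add: y_def s_def)
  have pos: "s\<^sup>2 + x\<^sup>2 > 0" for x using s(1) by (simp add: add_pos_nonneg)
  have "cauchy_transform \<tau> (\<i> * of_real s) = (LINT x|\<nu>. of_real (x\<^sup>2) / (\<i> * of_real s - of_real x))"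
    unfolding \<tau>_def by (rule cauchy_transform_second_moment[OF \<nu>(1,3)])
  \<comment> \<open>Imaginary and real part of the kernel: the first is a multiple of the integrand
    of \<open>c\<close>, the second is odd in \<open>x\<close> and integrates to zero.\<close>
  also have "\<dots> = (LINT x|\<nu>. (- \<i> * of_real s) * of_real (T * x\<^sup>2 / (1 + T * x\<^sup>2)) - of_real (x ^ 3 / (s\<^sup>2 + x\<^sup>2)))"
  proof (rule Bochner_Integration.integral_cong)
    fix x
    have e: "(\<i> * of_real s - of_real x) * (- \<i> * of_real s - of_real x) = of_real (s\<^sup>2 + x\<^sup>2)"
      by (simp add: complex_eq_iff power2_eq_square)
    have "T * x\<^sup>2 / (1 + T * x\<^sup>2) = x\<^sup>2 / (s\<^sup>2 + x\<^sup>2)"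
      using T by (simp add: s(2) field_simps)
    then have "(- \<i> * of_real s) * of_real (T * x\<^sup>2 / (1 + T * x\<^sup>2)) - of_real (x ^ 3 / (s\<^sup>2 + x\<^sup>2)) =
        of_real (x\<^sup>2) * (- \<i> * of_real s - of_real x) / of_real (s\<^sup>2 + x\<^sup>2)"
      by (simp add: power3_eq_cube power2_eq_square diff_divide_distrib algebra_simps)
    also have "\<dots> = of_real (x\<^sup>2) / (\<i> * of_real s - of_real x)"
    proof -
      have "- \<i> * of_real s - of_real x \<noteq> 0" using s(1) by (auto simp: complex_eq_iff)
      then show ?thesis unfolding e[symmetric] by (simp only: mult_divide_mult_cancel_right not_False_eq_True)
    qed
    finally show "of_real (x\<^sup>2) / (\<i> * of_real s - of_real x) =
      (- \<i> * of_real s) * of_real (T * x\<^sup>2 / (1 + T * x\<^sup>2)) - of_real (x ^ 3 / (s\<^sup>2 + x\<^sup>2))" ..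
  qed simp
  also have "\<dots> = (LINT x|\<nu>. (- \<i> * of_real s) * of_real (T * x\<^sup>2 / (1 + T * x\<^sup>2))) - (LINT x|\<nu>. of_real (x ^ 3 / (s\<^sup>2 + x\<^sup>2)))"
  proof (rule Bochner_Integration.integral_diff)
    have "integrable \<nu> (\<lambda>x. T * x\<^sup>2 / (1 + T * x\<^sup>2))"
    proof (rule integrable_bounded[OF \<nu>(1) _ norm_moment_kernel_le_1])
      show "T * x\<^sup>2 \<ge> 0" for x using T by simp
    qed measurable
    then show "integrable \<nu> (\<lambda>x. (- \<i> * of_real s) * of_real (T * x\<^sup>2 / (1 + T * x\<^sup>2)))"
      by (intro integrable_mult_right integrable_of_real)
    show "integrable \<nu> (\<lambda>x. complex_of_real (x ^ 3 / (s\<^sup>2 + x\<^sup>2)))"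
    proof (rule integrable_of_real, rule Bochner_Integration.integrable_bound[where f="\<lambda>x. 1 + x\<^sup>2"])
      show "integrable \<nu> (\<lambda>x. 1 + x\<^sup>2)"
        by (intro Bochner_Integration.integrable_add finite_measure.integrable_const fin_borelD(1)[OF \<nu>(1)] \<nu>(3))
      show "(\<lambda>x. x ^ 3 / (s\<^sup>2 + x\<^sup>2)) \<in> borel_measurable \<nu>"
        by (rule borel_measurable_fin_borel[OF \<nu>(1)]) measurable
      show "AE x in \<nu>. norm (x ^ 3 / (s\<^sup>2 + x\<^sup>2)) \<le> norm (1 + x\<^sup>2)"
      proof (rule AE_I2)
        fix x :: real
        have "\<bar>x\<bar> ^ 3 = \<bar>x\<bar> * x\<^sup>2" by (simp add: power3_eq_cube power2_eq_square)
        then have "norm (x ^ 3 / (s\<^sup>2 + x\<^sup>2)) = \<bar>x\<bar> * (x\<^sup>2 / (s\<^sup>2 + x\<^sup>2))"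
          using pos[of x] by (simp add: power_abs abs_mult)
        also have "\<dots> \<le> \<bar>x\<bar> * 1" using pos[of x] by (intro mult_left_mono) (auto simp: divide_le_eq)
        also have "\<dots> \<le> 1 + x\<^sup>2"
          using zero_le_power2[of "\<bar>x\<bar> - 1 / 2"] by (simp add: power2_eq_square algebra_simps abs_mult_self_eq)
        finally show "norm (x ^ 3 / (s\<^sup>2 + x\<^sup>2)) \<le> norm (1 + x\<^sup>2)" by simp
      qed
    qed
  qed
  also have "(LINT x|\<nu>. complex_of_real (x ^ 3 / (s\<^sup>2 + x\<^sup>2))) = 0"
    by (rule integral_odd_eq_0[OF \<nu>(1,2), of "\<lambda>x. complex_of_real (x ^ 3 / (s\<^sup>2 + x\<^sup>2))"]) simp_all
  also have "(LINT x|\<nu>. (- \<i> * of_real s) * of_real (T * x\<^sup>2 / (1 + T * x\<^sup>2))) = (- \<i> * of_real s) * of_real c"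
    unfolding c_def integral_mult_right_zero integral_complex_of_real ..
  finally have "\<i> * of_real s + cauchy_transform \<tau> (\<i> * of_real s) = \<i> * of_real (s * (1 - c))"
    by (simp add: algebra_simps)
  then have H: "\<i> * of_real s + cauchy_transform \<tau> (\<i> * of_real s) = \<i> / of_real y" unfolding y(2) by simp
  have "recip_cauchy M (\<i> / of_real y) = \<i> * of_real s"
    using recip_cauchy_subordination[OF gen[folded \<tau>_def], of "\<i> * of_real s"] s(1) y(1) unfolding H by simp
  then have G: "cauchy_transform M (\<i> / of_real y) = 1 / (\<i> * of_real s)"
    unfolding recip_cauchy_def by (metis div_by_1 divide_divide_eq_right mult_1)
  have "1 / (- \<i> * of_real y) = \<i> / of_real y" using y(1) by (simp add: field_simps)
  then have "psi_transform M (- \<i> * of_real y) = (\<i> / of_real y) * (1 / (\<i> * of_real s)) - 1"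
    using psi_transform_sym(2)[OF M, of "- \<i> * of_real y"] y(1) G by simp
  also have "\<dots> = of_real (1 / (y * s) - 1)" by simp
  also have "1 / (y * s) - 1 = - c" using y s(1) by (simp add: field_simps)
  finally have "- complex_of_real (LINT x|M. y\<^sup>2 * x\<^sup>2 / (1 + y\<^sup>2 * x\<^sup>2)) = of_real (- c)"
    unfolding psi_transform_sym_imag[OF M y(1)] .
  then show ?thesis by (simp only: of_real_minus neg_equal_iff_equal of_real_eq_iff)
qed

section \<open>Compound Poisson laws with Gaussian jumps\<close>

text \<open>The Levy measure of \<open>sqrt (N\<^sub>1 + s\<^sup>2 * N\<^sub>2) * Z\<close> for independent Poisson variables
  of rates \<open>p\<close> and \<open>q\<close> and a standard Gaussian variable \<open>Z\<close>.\<close>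

definition gauss_jumps :: "real \<Rightarrow> real \<Rightarrow> real \<Rightarrow> real measure" where
  "gauss_jumps p q s = density lborel (\<lambda>x. ennreal (p * normal_density 0 1 x + q * normal_density 0 s x))"

lemma normal_density_scale: "s > 0 \<Longrightarrow> normal_density 0 s (s * x) = std_normal_density x / s"
  by (simp add: normal_density_def std_normal_density_def power_mult_distrib real_sqrt_mult)

context
  fixes p q s :: real
  assumes pq: "p \<ge> 0" "q \<ge> 0" and s: "s > 0"
begin

lemma gauss_jumps_density_nonneg: "0 \<le> p * normal_density 0 1 x + q * normal_density 0 s x"
  using pq by (intro add_nonneg_nonneg mult_nonneg_nonneg normal_density_nonneg)

lemma fin_borel_gauss_jumps: "fin_borel (gauss_jumps p q s)"
proof -
  have "emeasure (gauss_jumps p q s) (space (gauss_jumps p q s)) =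
      (\<integral>\<^sup>+x. ennreal (p * normal_density 0 1 x + q * normal_density 0 s x) \<partial>lborel)"
    unfolding gauss_jumps_def by (subst emeasure_density) (auto intro!: nn_integral_cong)
  also have "\<dots> = ennreal (LINT x|lborel. p * normal_density 0 1 x + q * normal_density 0 s x)"
  proof (rule nn_integral_eq_integral)
    show "integrable lborel (\<lambda>x. p * normal_density 0 1 x + q * normal_density 0 s x)"
      by (intro Bochner_Integration.integrable_add integrable_mult_right integrable_normal_density)
        (use s in simp_all)
  qed (use gauss_jumps_density_nonneg in simp)
  finally show ?thesis
    unfolding fin_borel_def by (intro conjI finite_measureI) (simp_all add: gauss_jumps_def)
qed

lemma has_bochner_integral_gauss_jumps:
  fixes f :: "real \<Rightarrow> 'a::{banach,second_countable_topology}"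
  assumes f: "f \<in> borel_measurable borel"
    and i: "integrable std_normal_distribution f" "integrable std_normal_distribution (\<lambda>x. f (s * x))"
  shows "has_bochner_integral (gauss_jumps p q s) f
    (p *\<^sub>R (LINT x|std_normal_distribution. f x) + q *\<^sub>R (LINT x|std_normal_distribution. f (s * x)))"
  unfolding gauss_jumps_def
proof (rule has_bochner_integral_density)
  have d: "has_bochner_integral lborel (\<lambda>x. std_normal_density x *\<^sub>R g x) (LINT x|std_normal_distribution. g x)"
    if g: "g \<in> borel_measurable borel" "integrable std_normal_distribution g" for g :: "real \<Rightarrow> 'a"
  proof -
    have "integrable lborel (\<lambda>x. std_normal_density x *\<^sub>R g x)"
      by (rule iffD1[OF integrable_density]) (use g in auto)
    moreover have "(LINT x|std_normal_distribution. g x) = (LINT x|lborel. std_normal_density x *\<^sub>R g x)"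
      by (rule integral_density) (use g in auto)
    ultimately show ?thesis by (simp add: has_bochner_integral_iff)
  qed
  have 2: "has_bochner_integral lborel (\<lambda>x. normal_density 0 s x *\<^sub>R f x) (LINT x|std_normal_distribution. f (s * x))"
  proof (subst lborel_has_bochner_integral_real_affine_iff[of s _ _ 0])
    have "has_bochner_integral lborel (\<lambda>x. (1 / s) *\<^sub>R (std_normal_density x *\<^sub>R f (s * x)))
        ((1 / s) *\<^sub>R (LINT x|std_normal_distribution. f (s * x)))"
      by (rule has_bochner_integral_scaleR_right, rule d) (use f i in auto)
    moreover have "(1 / s) *\<^sub>R (std_normal_density x *\<^sub>R f (s * x)) = normal_density 0 s (0 + s * x) *\<^sub>R f (0 + s * x)" for x
      using s by (simp add: normal_density_scale)
    moreover have "(1 / s) *\<^sub>R (LINT x|std_normal_distribution. f (s * x)) = (LINT x|std_normal_distribution. f (s * x)) /\<^sub>R \<bar>s\<bar>"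
      using s by (simp add: divide_inverse)
    ultimately show "has_bochner_integral lborel (\<lambda>x. normal_density 0 s (0 + s * x) *\<^sub>R f (0 + s * x))
        ((LINT x|std_normal_distribution. f (s * x)) /\<^sub>R \<bar>s\<bar>)"
      by (simp only:)
  qed (use s in simp)
  have "has_bochner_integral lborel (\<lambda>x. p *\<^sub>R (std_normal_density x *\<^sub>R f x) + q *\<^sub>R (normal_density 0 s x *\<^sub>R f x))
    (p *\<^sub>R (LINT x|std_normal_distribution. f x) + q *\<^sub>R (LINT x|std_normal_distribution. f (s * x)))"
    by (intro has_bochner_integral_add has_bochner_integral_scaleR_right 2 d[OF f i(1)])
  then show "has_bochner_integral lborel (\<lambda>x. (p * normal_density 0 1 x + q * normal_density 0 s x) *\<^sub>R f x)
    (p *\<^sub>R (LINT x|std_normal_distribution. f x) + q *\<^sub>R (LINT x|std_normal_distribution. f (s * x)))"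
    by (simp add: scaleR_add_left)
qed (use f gauss_jumps_density_nonneg in auto)

lemma distr_uminus_gauss_jumps: "distr (gauss_jumps p q s) borel uminus = gauss_jumps p q s"
proof (rule measure_eqI)
  define d where "d x = ennreal (p * normal_density 0 1 x + q * normal_density 0 s x)" for x
  have [measurable]: "d \<in> borel_measurable borel" unfolding d_def by measurable
  have d: "d (- x) = d x" for x by (simp add: d_def normal_density_def)
  have gd: "gauss_jumps p q s = density lborel d" by (simp add: gauss_jumps_def d_def[abs_def])
  fix A assume "A \<in> sets (distr (gauss_jumps p q s) borel uminus)"
  then have A [measurable]: "A \<in> sets borel" by simp
  have "emeasure (distr (gauss_jumps p q s) borel uminus) A = emeasure (density lborel d) (uminus -` A)"
    unfolding gd by (subst emeasure_distr) auto
  also have "\<dots> = (\<integral>\<^sup>+x. d x * indicator (uminus -` A) x \<partial>lborel)"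
    by (rule emeasure_density) (auto intro: measurable_sets_borel[OF _ A])
  also have "\<dots> = ennreal \<bar>-1\<bar> * (\<integral>\<^sup>+x. d (0 + (-1) * x) * indicator (uminus -` A) (0 + (-1) * x) \<partial>lborel)"
    by (rule nn_integral_real_affine) (auto intro!: borel_measurable_times_ennreal borel_measurable_indicator measurable_sets_borel[OF _ A])
  also have "\<dots> = (\<integral>\<^sup>+x. d x * indicator A x \<partial>lborel)"
    by (auto simp: d indicator_def intro!: nn_integral_cong)
  also have "\<dots> = emeasure (gauss_jumps p q s) A"
    unfolding gd by (rule emeasure_density[symmetric]) auto
  finally show "emeasure (distr (gauss_jumps p q s) borel uminus) A = emeasure (gauss_jumps p q s) A" .
qed (simp add: gauss_jumps_def)

lemma levy_measure_gauss_jumps: "levy_measure (gauss_jumps p q s)"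
proof -
  interpret finite_measure "gauss_jumps p q s" by (rule fin_borelD[OF fin_borel_gauss_jumps])
  have "emeasure (gauss_jumps p q s) {0} = 0"
    unfolding gauss_jumps_def by (rule emeasure_density_lborel_singleton) measurable
  moreover have "(\<integral>\<^sup>+x. ennreal (min 1 (x\<^sup>2)) \<partial>gauss_jumps p q s) \<le> (\<integral>\<^sup>+x. 1 \<partial>gauss_jumps p q s)"
    by (rule nn_integral_mono) (simp flip: ennreal_1 del: ennreal_1)
  then have "(\<integral>\<^sup>+x. ennreal (min 1 (x\<^sup>2)) \<partial>gauss_jumps p q s) < \<infinity>"
  proof (rule le_less_trans)
    show "(\<integral>\<^sup>+x. 1 \<partial>gauss_jumps p q s) < \<infinity>"
      using emeasure_finite[of "space (gauss_jumps p q s)"]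
      unfolding infinity_ennreal_def less_top by (simp only: nn_integral_const mult_1)
  qed
  ultimately show ?thesis
    unfolding levy_measure_def by (simp add: gauss_jumps_def)
qed

lemma second_moment_gauss_jumps: "integrable (gauss_jumps p q s) (\<lambda>x. x\<^sup>2)"
proof -
  have "integrable std_normal_distribution (\<lambda>x. (s * x)\<^sup>2)"
    unfolding power_mult_distrib by (intro integrable_mult_right integrable_std_normal_distribution_moment)
  then show ?thesis
    using has_bochner_integral_gauss_jumps[of "\<lambda>x. x\<^sup>2"] integrable_std_normal_distribution_moment[of 2]
    by (simp add: has_bochner_integral_iff)
qed

end

section \<open>The Gaussian moment transform and the failure of concavity\<close>

definition gauss_moment :: "real \<Rightarrow> real" where
  "gauss_moment T = (LINT x|std_normal_distribution. T * x\<^sup>2 / (1 + T * x\<^sup>2))"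

lemma integrable_gauss_moment:
  assumes "T \<ge> 0"
  shows "integrable std_normal_distribution (\<lambda>x. T * x\<^sup>2 / (1 + T * x\<^sup>2))"
proof (rule integrable_bounded[OF fin_borel_real_distribution[OF real_dist_normal_dist] _ norm_moment_kernel_le_1])
  show "T * x\<^sup>2 \<ge> 0" for x using assms by simp
qed measurable

lemma std_normal_not_null: "\<not> (AE x in std_normal_distribution. x\<^sup>2 = 0)"
proof
  assume "AE x in std_normal_distribution. x\<^sup>2 = 0"
  then have "(LINT x|std_normal_distribution. x\<^sup>2) = 0" by (rule integral_eq_zero_AE)
  then show False using std_normal_distribution_even_moments(1)[of 1] by simp
qed

lemma gauss_moment_mono:
  assumes "0 < S" "S < T"
  shows "gauss_moment S < gauss_moment T"
  unfolding gauss_moment_def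
  by (rule moment_transform_strict_mono[OF real_dist_normal_dist, of "\<lambda>x. x\<^sup>2"])
    (use assms std_normal_not_null in auto)

lemma gauss_moment_le: "T \<ge> 0 \<Longrightarrow> gauss_moment T \<le> T"
proof -
  assume T: "T \<ge> 0"
  have "gauss_moment T \<le> (LINT x|std_normal_distribution. T * x\<^sup>2)"
    unfolding gauss_moment_def
  proof (rule integral_mono)
    show "integrable std_normal_distribution (\<lambda>x. T * x\<^sup>2)"
      by (intro integrable_mult_right integrable_std_normal_distribution_moment)
    show "T * x\<^sup>2 / (1 + T * x\<^sup>2) \<le> T * x\<^sup>2" for x
    proof -
      have t: "T * x\<^sup>2 \<ge> 0" using T by simp
      then have "T * x\<^sup>2 / (1 + T * x\<^sup>2) \<le> T * x\<^sup>2 / 1" by (intro divide_left_mono) auto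
      then show ?thesis by simp
    qed
  qed (rule integrable_gauss_moment[OF T])
  also have "\<dots> = T" using std_normal_distribution_even_moments(1)[of 1] by simp
  finally show ?thesis .
qed

lemma gauss_moment_le_1: "T \<ge> 0 \<Longrightarrow> gauss_moment T \<le> 1"
proof -
  assume T: "T \<ge> 0"
  interpret real_distribution std_normal_distribution by (rule real_dist_normal_dist)
  have "gauss_moment T \<le> (LINT x|std_normal_distribution. 1)"
    unfolding gauss_moment_def
  proof (rule integral_mono)
    show "T * x\<^sup>2 / (1 + T * x\<^sup>2) \<le> 1" for x
    proof -
      have "T * x\<^sup>2 \<ge> 0" using T by simp
      then show ?thesis by (simp add: divide_le_eq)
    qed
  qed (use integrable_gauss_moment[OF T] in auto)
  also have "\<dots> = 1" using prob_space by (simp add: space_eq_univ)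
  finally show ?thesis .
qed

lemma gauss_moment_pos: "T > 0 \<Longrightarrow> gauss_moment T > 0"
proof -
  assume T: "T > 0"
  have "0 \<le> gauss_moment (T / 2)" unfolding gauss_moment_def using T by simp
  also have "\<dots> < gauss_moment T" using T by (intro gauss_moment_mono) auto
  finally show ?thesis .
qed

text \<open>The source of the plateau: as the scale of the large jumps grows, they contribute their
  full rate at every fixed \<open>T > 0\<close>.\<close>

lemma gauss_moment_tendsto_1:
  assumes "T > 0"
  shows "(\<lambda>n. gauss_moment ((real n)\<^sup>2 * T)) \<longlonglongrightarrow> 1"
proof -
  interpret real_distribution std_normal_distribution by (rule real_dist_normal_dist)
  have "(\<lambda>n. LINT x|std_normal_distribution. ((real n)\<^sup>2 * T) * x\<^sup>2 / (1 + ((real n)\<^sup>2 * T) * x\<^sup>2))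
     \<longlonglongrightarrow> (LINT x|std_normal_distribution. 1)"
  proof (rule integral_dominated_convergence[where w="\<lambda>_. 1"])
    have "AE x in std_normal_distribution. x \<noteq> 0"
      using AE_lborel_singleton[of "0::real"] by (subst AE_density) auto
    then show "AE x in std_normal_distribution.
        (\<lambda>n. ((real n)\<^sup>2 * T) * x\<^sup>2 / (1 + ((real n)\<^sup>2 * T) * x\<^sup>2)) \<longlonglongrightarrow> 1"
    proof eventually_elim
      case (elim x)
      define a where "a = T * x\<^sup>2"
      have "a > 0" using elim assms by (simp add: a_def)
      then have "(\<lambda>n. (real n)\<^sup>2 * a / (1 + (real n)\<^sup>2 * a)) \<longlonglongrightarrow> 1" by real_asymp
      then show ?case by (simp add: a_def mult.assoc)
    qed
    show "AE x in std_normal_distribution. norm (((real n)\<^sup>2 * T) * x\<^sup>2 / (1 + ((real n)\<^sup>2 * T) * x\<^sup>2)) \<le> 1" for n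
      by (intro AE_I2 norm_moment_kernel_le_1) (use assms in simp)
  qed auto
  then show ?thesis unfolding gauss_moment_def using prob_space by (simp add: space_eq_univ)
qed

lemma gauss_jumps_moment:
  assumes "p \<ge> 0" "q \<ge> 0" "s > 0" "T \<ge> 0"
  shows "(LINT x|gauss_jumps p q s. T * x\<^sup>2 / (1 + T * x\<^sup>2)) = p * gauss_moment T + q * gauss_moment (s\<^sup>2 * T)"
proof -
  have e: "T * (s * x)\<^sup>2 / (1 + T * (s * x)\<^sup>2) = (s\<^sup>2 * T) * x\<^sup>2 / (1 + (s\<^sup>2 * T) * x\<^sup>2)" for x
    by (simp add: power_mult_distrib mult_ac)
  have "has_bochner_integral (gauss_jumps p q s) (\<lambda>x. T * x\<^sup>2 / (1 + T * x\<^sup>2))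
     (p *\<^sub>R (LINT x|std_normal_distribution. T * x\<^sup>2 / (1 + T * x\<^sup>2)) +
      q *\<^sub>R (LINT x|std_normal_distribution. T * (s * x)\<^sup>2 / (1 + T * (s * x)\<^sup>2)))"
    by (rule has_bochner_integral_gauss_jumps[OF assms(1-3)])
      (use assms integrable_gauss_moment[of T] integrable_gauss_moment[of "s\<^sup>2 * T"] in \<open>simp_all add: e\<close>)
  then show ?thesis unfolding e by (simp add: has_bochner_integral_iff gauss_moment_def)
qed

text \<open>The factor \<open>1/2\<close> is the rate \<open>q\<close> of the large jumps, hence the height of the plateau.\<close>

definition gauss_cumulant :: "real \<Rightarrow> real \<Rightarrow> real \<Rightarrow> real" where
  "gauss_cumulant p s T = p * gauss_moment T + 1 / 2 * gauss_moment (s\<^sup>2 * T)"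

text \<open>For small \<open>T\<close> this would be minus the value of
  \<open>chi_transform L\<close> at \<open>- gauss_cumulant p s T\<close>, if the law were the
  product of \<open>L\<close> and the Wigner law.\<close>

definition gauss_chi :: "real \<Rightarrow> real \<Rightarrow> real \<Rightarrow> real" where
  "gauss_chi p s T = sqrt (T * gauss_cumulant p s T) / (1 - gauss_cumulant p s T)"

lemma gauss_cumulant_not_concave:
  obtains p s T1 T2 T3 where "0 < p" "p < 1 / 4" "0 < s" "0 < T1" "T1 < T2" "T2 < T3"
    "(gauss_cumulant p s T2 - gauss_cumulant p s T1) * (gauss_chi p s T3 - gauss_chi p s T2) <
     (gauss_cumulant p s T3 - gauss_cumulant p s T2) * (gauss_chi p s T2 - gauss_chi p s T1)"
proof -
  txt \<open>Letting first \<open>s\<close> tend to infinity and then \<open>p\<close> to zero turns concavity into concavity of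
    \<open>gauss_moment T\<close> in \<open>sqrt T\<close>, which contradicts \<open>gauss_moment T \<le> T\<close> near zero.\<close>
  define h where "h = gauss_moment"
  \<comment> \<open>In the limit the three points sit at \<open>x / 2\<close>, \<open>x\<close> and
    1 on the \<open>sqrt T\<close> axis. With \<open>h T2 \<le> x^2\<close> and
    \<open>h 1 = 4 * x\<close>, concavity would require roughly \<open>2 * x^2 \<le> x^2\<close>;
    this explains the factor 4.\<close>
  define x where "x = h 1 / 4"
  define T1 T2 where "T1 = (x / 2)\<^sup>2" and "T2 = x\<^sup>2"
  have h1: "h 1 > 0" "h 1 \<le> 1" unfolding h_def by (auto intro: gauss_moment_pos gauss_moment_le_1)
  have x: "0 < x" "x \<le> 1 / 4" using h1 by (auto simp: x_def)
  have T: "0 < T1" "T1 < T2" "T2 < 1"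
    using x power_strict_mono[of "x / 2" x 2] power_strict_mono[of x 1 2] by (auto simp: T1_def T2_def)
  have sq: "sqrt T1 = x / 2" "sqrt T2 = x" using x by (auto simp: T1_def T2_def)
  define k where "k p T = sqrt (T * (p * h T + 1 / 2)) / (1 - (p * h T + 1 / 2))" for p T
  have "\<exists>p s. 0 < p \<and> p < 1 / 4 \<and> 0 < s \<and>
     (gauss_cumulant p s T2 - gauss_cumulant p s T1) * (gauss_chi p s 1 - gauss_chi p s T2) <
     (gauss_cumulant p s 1 - gauss_cumulant p s T2) * (gauss_chi p s T2 - gauss_chi p s T1)"
  proof (rule ccontr)
    assume "\<not> ?thesis"
    then have le: "(gauss_cumulant p s 1 - gauss_cumulant p s T2) * (gauss_chi p s T2 - gauss_chi p s T1) \<le>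
        (gauss_cumulant p s T2 - gauss_cumulant p s T1) * (gauss_chi p s 1 - gauss_chi p s T2)"
      if "0 < p" "p < 1 / 4" "0 < s" for p s
      using that by (meson not_le)
    \<comment> \<open>The limit in \<open>s\<close>, along the naturals. The bound
      \<open>p < 1 / 4\<close> keeps the limiting denominators \<open>1 - (p * h t + 1 / 2)\<close>
      away from zero.\<close>
    have step1: "(h 1 - h T2) * (k p T2 - k p T1) \<le> (h T2 - h T1) * (k p 1 - k p T2)" if p: "0 < p" "p < 1 / 4" for p
    proof -
      have c: "(\<lambda>n. gauss_cumulant p (real n) t) \<longlonglongrightarrow> p * h t + 1 / 2" if "t > 0" for t
      proof -
        have "(\<lambda>n. gauss_cumulant p (real n) t) \<longlonglongrightarrow> p * h t + 1 / 2 * 1"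
          unfolding gauss_cumulant_def h_def by (intro tendsto_intros gauss_moment_tendsto_1 that)
        then show ?thesis by simp
      qed
      have kk: "(\<lambda>n. gauss_chi p (real n) t) \<longlonglongrightarrow> k p t" if "t > 0" for t
      proof -
        have "p * h t \<le> p * 1" unfolding h_def using p that by (intro mult_left_mono gauss_moment_le_1) auto
        then have "1 - (p * h t + 1 / 2) \<noteq> 0" using p by linarith
        then show ?thesis
          unfolding gauss_chi_def k_def by (intro tendsto_intros c that)
      qed
      have "((p * h 1 + 1 / 2) - (p * h T2 + 1 / 2)) * (k p T2 - k p T1) \<le>
          ((p * h T2 + 1 / 2) - (p * h T1 + 1 / 2)) * (k p 1 - k p T2)"
      proof (rule tendsto_le[OF sequentially_bot])
        show "eventually (\<lambda>n. (gauss_cumulant p (real n) 1 - gauss_cumulant p (real n) T2) * (gauss_chi p (real n) T2 - gauss_chi p (real n) T1) \<le>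
          (gauss_cumulant p (real n) T2 - gauss_cumulant p (real n) T1) * (gauss_chi p (real n) 1 - gauss_chi p (real n) T2)) sequentially"
          by (rule eventually_sequentiallyI[of 1]) (rule le, use p in auto)
      qed (intro tendsto_diff tendsto_mult c kk T(1) less_trans[OF T(1,2)] zero_less_one)+
      \<comment> \<open>The plateau height cancels in the differences, leaving a common factor
        \<open>p\<close>. It has to be divided out now, since the inequality would become trivial as
        \<open>p\<close> tends to zero.\<close>
      then have "p * ((h 1 - h T2) * (k p T2 - k p T1)) \<le> p * ((h T2 - h T1) * (k p 1 - k p T2))"
        by (simp add: algebra_simps)
      then show ?thesis using p(1) by (simp only: mult_le_cancel_left_pos)
    qed
    \<comment> \<open>The limit of \<open>k p t\<close> as \<open>p\<close> tends to zero: a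
      constant times \<open>sqrt t\<close>. The sequence \<open>1 / (n + 5)\<close> used for
      \<open>p\<close> stays below 1/4 from its first term.\<close>
    define k0 where "k0 t = sqrt (t * (1 / 2)) / (1 / 2)" for t :: real
    have kl: "((\<lambda>n. k (1 / real (n + 5)) t) \<longlongrightarrow> k0 t) sequentially" for t
    proof -
      have l: "(\<lambda>n. 1 / real (n + 5) * h t) \<longlonglongrightarrow> 0" by real_asymp
      have "((\<lambda>n. k (1 / real (n + 5)) t) \<longlongrightarrow> sqrt (t * (0 + 1 / 2)) / (1 - (0 + 1 / 2))) sequentially"
        unfolding k_def by (intro tendsto_intros l) auto
      then show ?thesis by (simp add: k0_def)
    qed
    have "(h 1 - h T2) * (k0 T2 - k0 T1) \<le> (h T2 - h T1) * (k0 1 - k0 T2)"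
    proof (rule tendsto_le[OF sequentially_bot])
      show "eventually (\<lambda>n. (h 1 - h T2) * (k (1 / real (n + 5)) T2 - k (1 / real (n + 5)) T1) \<le>
         (h T2 - h T1) * (k (1 / real (n + 5)) 1 - k (1 / real (n + 5)) T2)) sequentially"
        by (intro always_eventually allI step1) auto
    qed (intro tendsto_intros kl)+
    moreover have k0: "k0 t = sqrt t * (sqrt (1 / 2) / (1 / 2))" for t
      by (simp add: k0_def real_sqrt_mult real_sqrt_divide)
    ultimately have "((h 1 - h T2) * (sqrt T2 - sqrt T1)) * (sqrt (1 / 2) / (1 / 2)) \<le>
        ((h T2 - h T1) * (sqrt 1 - sqrt T2)) * (sqrt (1 / 2) / (1 / 2))"
      unfolding k0 by (simp only: left_diff_distrib[symmetric] mult.assoc)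
    then have main: "(h 1 - h T2) * (x - x / 2) \<le> (h T2 - h T1) * (1 - x)"
      unfolding sq by (subst (asm) mult_le_cancel_right_pos) auto
    have hT: "h T2 \<le> x\<^sup>2" "h T1 \<ge> 0"
      using gauss_moment_le[of T2] gauss_moment_pos[OF T(1)] T by (auto simp: h_def T2_def)
    have "(4 * x - x\<^sup>2) * (x / 2) \<le> (h 1 - h T2) * (x / 2)"
      using hT x by (intro mult_right_mono) (auto simp: x_def)
    also have "\<dots> \<le> (h T2 - h T1) * (1 - x)" using main by (simp add: field_simps)
    also have "\<dots> \<le> x\<^sup>2 * 1" using hT x by (intro mult_mono) auto
    finally have "2 * x\<^sup>2 - x\<^sup>2 * x / 2 \<le> x\<^sup>2" by (simp add: power2_eq_square algebra_simps)
    moreover have "x\<^sup>2 * x \<le> x\<^sup>2 * (1 / 4)" using x by (intro mult_left_mono) auto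
    moreover have "x\<^sup>2 > 0" using x by simp
    ultimately show False by linarith
  qed
  then show ?thesis using that[of _ _ T1 T2 1] T by blast
qed

lemma prob_pos_iff:
  assumes "real_distribution L"
  shows "L \<in> prob_pos \<longleftrightarrow> (AE x in L. x \<ge> 0)"
proof -
  interpret real_distribution L by fact
  have "(AE x in L. x \<in> {0..}) \<longleftrightarrow> measure L {0..} = 1" by (rule AE_in_set_eq_1) simp
  then show ?thesis using assms by (simp add: prob_pos_def prob_R_def)
qed

lemma gauss_not_type_W:
  assumes p: "0 < p" "p < 1 / 4" and s: "0 < s"
    and N: "N \<in> prob_sym" "additive_generator N (second_moment (gauss_jumps p (1 / 2) s))"
    and T: "0 < T1" "T1 < T2" "T2 < T3"
    and not_concave: "(gauss_cumulant p s T2 - gauss_cumulant p s T1) * (gauss_chi p s T3 - gauss_chi p s T2) <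
     (gauss_cumulant p s T3 - gauss_cumulant p s T2) * (gauss_chi p s T2 - gauss_chi p s T1)"
  shows "N \<notin> free_type_W"
proof
  assume "N \<in> free_type_W"
  then obtain L where conv: "is_free_mult_conv L wigner N" by (auto simp: free_type_W_def)
  define \<nu> where "\<nu> = gauss_jumps p (1 / 2) s"
  have p': "0 \<le> p" "(0::real) \<le> 1 / 2" using p by auto
  have \<nu>: "fin_borel \<nu>" "distr \<nu> borel uminus = \<nu>" "integrable \<nu> (\<lambda>x. x\<^sup>2)"
    unfolding \<nu>_def
    by (rule fin_borel_gauss_jumps[OF p' s] distr_uminus_gauss_jumps[OF p' s] second_moment_gauss_jumps[OF p' s])+
  have c_eq: "(LINT x|\<nu>. T * x\<^sup>2 / (1 + T * x\<^sup>2)) = gauss_cumulant p s T" if "T > 0" for T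
    unfolding \<nu>_def gauss_cumulant_def by (rule gauss_jumps_moment[OF p' s]) (use that in simp)
  \<comment> \<open>Each Gaussian moment is at most 1, so the cumulant is at most the total rate
    \<open>p + 1 / 2\<close>, which is below 1.\<close>
  have c01: "0 < gauss_cumulant p s T \<and> gauss_cumulant p s T < 1" if "T > 0" for T
  proof -
    have "s\<^sup>2 * T > 0" using s that by simp
    then have g: "0 < gauss_moment T" "gauss_moment T \<le> 1" "0 < gauss_moment (s\<^sup>2 * T)" "gauss_moment (s\<^sup>2 * T) \<le> 1"
      using that by (auto intro: gauss_moment_pos gauss_moment_le_1)
    have "p * gauss_moment T \<le> p * 1" "p * gauss_moment T > 0"
      using g p by (auto intro!: mult_left_mono mult_pos_pos)
    then show ?thesis using g p unfolding gauss_cumulant_def by linarith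
  qed
  have mN: "(LINT x|N. (sqrt T / (1 - gauss_cumulant p s T))\<^sup>2 * x\<^sup>2 / (1 + (sqrt T / (1 - gauss_cumulant p s T))\<^sup>2 * x\<^sup>2))
      = gauss_cumulant p s T" if "T > 0" for T
    using generator_moment_transform[OF \<nu> N(2)[folded \<nu>_def] N(1) that] c01[OF that] unfolding c_eq[OF that] by simp
  have "N \<noteq> dirac0"
  proof
    assume N0: "N = dirac0"
    have "gauss_cumulant p s 1 = 0"
      using mN[OF zero_less_one] unfolding N0 by (subst (asm) integral_return) auto
    then show False using c01[of 1] by simp
  qed
  from is_free_mult_conv_wigner_moment_transform[OF conv this]
  obtain \<epsilon> where \<epsilon>: "\<epsilon> > 0" and rel: "\<And>y u. y > 0 \<Longrightarrow> 0 < u \<Longrightarrow> u < \<epsilon> \<Longrightarrow>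
      (LINT x|N. y\<^sup>2 * x\<^sup>2 / (1 + y\<^sup>2 * x\<^sup>2)) = u \<Longrightarrow> (LINT x|L. (y * sqrt u) * x / (1 + (y * sqrt u) * x)) = u"
    by blast
  note L = prob_posD[OF is_free_mult_conv_wignerD(1)[OF conv]]
  define \<Phi> where "\<Phi> k = (LINT x|L. k * x / (1 + k * x))" for k
  \<comment> \<open>By \<open>gauss_moment_le\<close> the cumulant is at most
    \<open>(p + s^2 / 2) * T\<close>, so below \<open>\<delta>\<close> it stays in the range where
    the S-transform identity is available.\<close>
  define \<delta> where "\<delta> = \<epsilon> / (p + 1 / 2 * s\<^sup>2)"
  have ps: "p + 1 / 2 * s\<^sup>2 > 0" using p by (intro add_pos_nonneg) auto
  have \<delta>: "\<delta> > 0" using \<epsilon> ps by (simp add: \<delta>_def)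
  have "\<Phi> (gauss_chi p s T) = gauss_cumulant p s T" if T: "0 < T" "T < \<delta>" for T
  proof -
    have "gauss_cumulant p s T \<le> p * T + 1 / 2 * (s\<^sup>2 * T)"
      unfolding gauss_cumulant_def using p T by (intro add_mono mult_left_mono gauss_moment_le) auto
    also have "\<dots> = (p + 1 / 2 * s\<^sup>2) * T" by (simp add: algebra_simps)
    also have "\<dots> < \<epsilon>" using T(2) ps unfolding \<delta>_def by (simp add: pos_less_divide_eq mult.commute)
    finally have "gauss_cumulant p s T < \<epsilon>" .
    from rel[OF _ _ this mN[OF T(1)]] show ?thesis
      using c01[OF T(1)] T(1) by (simp add: \<Phi>_def gauss_chi_def real_sqrt_mult)
  qed
  then have cont: "\<Phi> (gauss_chi p s T) = gauss_cumulant p s T" if "T > 0" for T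
    using moment_transform_continuation[OF \<nu>(1) L, of \<delta> T] c01 \<delta> that
    by (simp add: c_eq \<Phi>_def gauss_chi_def)
  have cmono: "gauss_cumulant p s S < gauss_cumulant p s T" if "0 < S" "S < T" for S T
    unfolding gauss_cumulant_def using that p s
    by (intro add_strict_mono mult_strict_left_mono gauss_moment_mono) auto
  have chi_mono: "gauss_chi p s S < gauss_chi p s T" if "0 < S" "S < T" for S T
    unfolding gauss_chi_def
  proof (rule frac_less)
    show "sqrt (S * gauss_cumulant p s S) < sqrt (T * gauss_cumulant p s T)"
      using that c01 cmono[OF that] by (intro real_sqrt_less_mono mult_strict_mono) (auto intro: less_imp_le)
    show "1 - gauss_cumulant p s T \<le> 1 - gauss_cumulant p s S" using cmono[OF that] by simp
    show "0 < 1 - gauss_cumulant p s T" using c01[of T] that by simp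
    show "0 \<le> sqrt (S * gauss_cumulant p s S)" using that c01[of S] by simp
  qed
  have T': "T2 > 0" "T3 > 0" using T by auto
  have "0 < gauss_chi p s T1" using T(1) c01[OF T(1)] by (simp add: gauss_chi_def)
  from moment_transform_concave[OF L this chi_mono[OF T(1,2)] chi_mono[OF T'(1) T(3)]]
  have "(gauss_cumulant p s T3 - gauss_cumulant p s T2) * (gauss_chi p s T2 - gauss_chi p s T1) \<le>
    (gauss_cumulant p s T2 - gauss_cumulant p s T1) * (gauss_chi p s T3 - gauss_chi p s T2)"
    unfolding \<Phi>_def[symmetric] cont[OF T(1)] cont[OF T'(1)] cont[OF T'(2)] .
  then show False using not_concave by linarith
qed

section \<open>Classical infinite divisibility\<close>

lemma
  fixes g :: "real \<times> real \<Rightarrow> real"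
  assumes M: "real_distribution M" and N: "real_distribution N" and g [measurable]: "g \<in> borel_measurable (borel \<Otimes>\<^sub>M borel)"
  shows real_distribution_distr_pair: "real_distribution (distr (M \<Otimes>\<^sub>M N) borel g)"
    and char_distr_pair: "char (distr (M \<Otimes>\<^sub>M N) borel g) t = (LINT x|M. LINT y|N. iexp (t * g (x, y)))"
proof -
  interpret M: real_distribution M by fact
  interpret N: real_distribution N by fact
  interpret P: pair_prob_space M N
    by (intro pair_prob_space.intro pair_sigma_finite.intro) unfold_locales
  have [measurable_cong]: "sets M = sets borel" "sets N = sets borel" by simp_all
  have m: "g \<in> borel_measurable (M \<Otimes>\<^sub>M N)" by measurable
  show "real_distribution (distr (M \<Otimes>\<^sub>M N) borel g)" by (rule P.real_distribution_distr[OF m])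
  have int: "integrable (M \<Otimes>\<^sub>M N) (\<lambda>p. iexp (t * g p))"
    by (rule P.P.integrable_const_bound[where B=1]) auto
  have "char (distr (M \<Otimes>\<^sub>M N) borel g) t = (LINT p|(M \<Otimes>\<^sub>M N). iexp (t * g p))"
    unfolding char_def by (rule integral_distr[OF m]) measurable
  then show "char (distr (M \<Otimes>\<^sub>M N) borel g) t = (LINT x|M. LINT y|N. iexp (t * g (x, y)))"
    using P.integral_fst'[OF int] by simp
qed

lemma
  assumes M: "real_distribution M" and N: "real_distribution N"
  shows real_distribution_convolution: "real_distribution (convolution M N)"
    and char_convolution: "char (convolution M N) t = char M t * char N t"
proof -
  have m: "(\<lambda>(x, y). x + y :: real) \<in> borel_measurable (borel \<Otimes>\<^sub>M borel)" by measurable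
  show "real_distribution (convolution M N)"
    unfolding convolution_def by (rule real_distribution_distr_pair[OF M N m])
  have "char (convolution M N) t = (LINT x|M. LINT y|N. iexp (t * x) * iexp (t * y))"
    unfolding convolution_def char_distr_pair[OF M N m] by (simp add: distrib_left exp_add)
  then show "char (convolution M N) t = char M t * char N t"
    unfolding char_def integral_mult_right_zero integral_mult_left_zero .
qed

lemma real_distribution_dirac0: "real_distribution dirac0"
  by (intro real_distribution.intro prob_space_return real_distribution_axioms.intro) auto

lemma char_dirac0: "char dirac0 t = 1"
  unfolding char_def by (subst integral_return) auto

lemma conv_power_char:
  assumes L: "real_distribution L"
  shows "real_distribution (conv_power L n) \<and> (\<forall>t. char (conv_power L n) t = char L t ^ n)"
proof (induction n)
  case 0
  then show ?case by (simp add: real_distribution_dirac0 char_dirac0)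
next
  case (Suc n)
  then show ?case
    using L by (simp add: real_distribution_convolution char_convolution mult.commute)
qed

text \<open>By Levy's uniqueness theorem convolution roots can be checked on characteristic
  functions.\<close>

lemma classical_inf_divI:
  assumes M: "real_distribution M"
    and root: "\<And>n. n \<ge> 1 \<Longrightarrow> \<exists>L. real_distribution L \<and> (\<forall>t. char M t = char L t ^ n)"
  shows "M \<in> classical_inf_div"
proof -
  have "\<exists>L\<in>prob_R. M = conv_power L n" if n: "n \<ge> 1" for n
  proof -
    obtain L where L: "real_distribution L" "\<And>t. char M t = char L t ^ n" using root[OF n] by blast
    have "M = conv_power L n"
      using conv_power_char[OF L(1), of n] L(2) by (intro Levy_uniqueness M) auto
    then show ?thesis using L(1) by (auto simp: prob_R_def)
  qed
  then show ?thesis using M by (simp add: classical_inf_div_def prob_R_def)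
qed

section \<open>Gaussian mixtures with Poisson variances\<close>

definition gauss_mixture :: "real measure \<Rightarrow> real measure" where
  "gauss_mixture L = distr (L \<Otimes>\<^sub>M std_normal_distribution) borel (\<lambda>(v, z). v * z)"

lemma
  assumes L: "real_distribution L"
  shows real_distribution_gauss_mixture: "real_distribution (gauss_mixture L)"
    and char_gauss_mixture: "char (gauss_mixture L) t = (LINT v|L. complex_of_real (exp (- (t * v)\<^sup>2 / 2)))"
proof -
  have m: "(\<lambda>(x, y). x * y :: real) \<in> borel_measurable (borel \<Otimes>\<^sub>M borel)" by measurable
  show "real_distribution (gauss_mixture L)"
    unfolding gauss_mixture_def by (rule real_distribution_distr_pair[OF L real_dist_normal_dist m])
  have "char (gauss_mixture L) t = (LINT v|L. char std_normal_distribution (t * v))"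
    unfolding gauss_mixture_def char_distr_pair[OF L real_dist_normal_dist m] by (simp add: char_def mult.assoc)
  then show "char (gauss_mixture L) t = (LINT v|L. complex_of_real (exp (- (t * v)\<^sup>2 / 2)))"
    by (simp only: char_std_normal_distribution)
qed

section \<open>Mixtures over two independent Poisson variables\<close>

lemma poisson_pgf:
  fixes a :: complex
  assumes p: "p > 0" and a: "norm a \<le> 1"
  shows "(LINT n|measure_pmf (poisson_pmf p). a ^ n) = exp (of_real p * (a - 1))"
proof -
  have "(\<lambda>n. exp (- of_real p) * ((of_real p * a) ^ n /\<^sub>R fact n)) sums (exp (- of_real p) * exp (of_real p * a))"
    by (intro sums_mult exp_converges)
  then have "(\<lambda>n. pmf (poisson_pmf p) n *\<^sub>R a ^ n) sums (exp (- of_real p) * exp (of_real p * a))"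
    using p by (simp add: scaleR_conv_of_real power_mult_distrib field_simps exp_of_real flip: exp_of_real)
  moreover have "integrable (measure_pmf (poisson_pmf p)) (\<lambda>n. a ^ n)"
    by (rule measure_pmf.integrable_const_bound[where B=1]) (use a in \<open>auto simp: norm_power power_le_one\<close>)
  then have i: "integrable (count_space UNIV) (\<lambda>n. pmf (poisson_pmf p) n *\<^sub>R a ^ n)"
    unfolding measure_pmf_eq_density by (subst (asm) integrable_density) auto
  have "(LINT n|measure_pmf (poisson_pmf p). a ^ n) = (LINT n|count_space UNIV. pmf (poisson_pmf p) n *\<^sub>R a ^ n)"
    unfolding measure_pmf_eq_density by (subst integral_density) auto
  ultimately have "(LINT n|measure_pmf (poisson_pmf p). a ^ n) = exp (- of_real p) * exp (of_real p * a)"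
    using sums_integral_count_space_nat[OF i] sums_unique2 by metis
  then show ?thesis by (simp add: exp_add[symmetric] algebra_simps)
qed

definition poisson_pair :: "real \<Rightarrow> real \<Rightarrow> (nat \<times> nat) measure" where
  "poisson_pair p q = measure_pmf (poisson_pmf p) \<Otimes>\<^sub>M measure_pmf (poisson_pmf q)"

lemma prob_space_poisson_pair: "prob_space (poisson_pair p q)"
proof -
  interpret P: pair_prob_space "measure_pmf (poisson_pmf p)" "measure_pmf (poisson_pmf q)"
    by (intro pair_prob_space.intro pair_sigma_finite.intro) unfold_locales
  show ?thesis unfolding poisson_pair_def by (rule P.P.prob_space_axioms)
qed

text \<open>The product of two countable discrete spaces is discrete, so every function on it is
  measurable.\<close>

lemma measurable_poisson_pair:
  "(\<lambda>x. f (fst x) (snd x)) \<in> measurable (poisson_pair p q) borel"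
proof -
  have "sets (poisson_pair p q) = sets (count_space UNIV \<Otimes>\<^sub>M count_space UNIV)"
    unfolding poisson_pair_def by (rule sets_pair_measure_cong) simp_all
  also have "\<dots> = sets (count_space UNIV)"
    by (subst pair_measure_countable) auto
  finally have e: "sets (poisson_pair p q) = sets (count_space UNIV)" .
  show ?thesis by (subst measurable_cong_sets[OF e refl]) simp
qed

lemma poisson_pair_pgf:
  fixes a b :: complex
  assumes p: "p > 0" "q > 0" and ab: "norm a \<le> 1" "norm b \<le> 1"
  shows "(LINT x|poisson_pair p q. a ^ fst x * b ^ snd x) = exp (of_real p * (a - 1) + of_real q * (b - 1))"
proof -
  interpret P: pair_prob_space "measure_pmf (poisson_pmf p)" "measure_pmf (poisson_pmf q)"
    by (intro pair_prob_space.intro pair_sigma_finite.intro) unfold_locales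
  have int: "integrable (poisson_pair p q) (\<lambda>x. a ^ fst x * b ^ snd x)"
  proof (rule P.P.integrable_const_bound[where B=1, folded poisson_pair_def])
    show "AE x in poisson_pair p q. norm (a ^ fst x * b ^ snd x) \<le> 1"
      using ab by (intro AE_I2) (simp add: norm_mult norm_power mult_le_one power_le_one)
    show "(\<lambda>x. a ^ fst x * b ^ snd x) \<in> borel_measurable (poisson_pair p q)"
      by (rule measurable_poisson_pair)
  qed
  have "(LINT x|poisson_pair p q. a ^ fst x * b ^ snd x) =
      (LINT m|measure_pmf (poisson_pmf p). LINT n|measure_pmf (poisson_pmf q). a ^ m * b ^ n)"
    using P.integral_fst'[OF int[unfolded poisson_pair_def]] by (simp add: poisson_pair_def)
  also have "\<dots> = exp (of_real p * (a - 1)) * exp (of_real q * (b - 1))"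
    unfolding integral_mult_right_zero integral_mult_left_zero
    by (simp only: poisson_pgf[OF p(1) ab(1)] poisson_pgf[OF p(2) ab(2)])
  finally show ?thesis by (simp only: exp_add)
qed

definition poisson_mix :: "real \<Rightarrow> real \<Rightarrow> real \<Rightarrow> real measure" where
  "poisson_mix p q s = distr (poisson_pair p q) borel (\<lambda>x. sqrt (real (fst x) + s\<^sup>2 * real (snd x)))"

lemma real_distribution_poisson_mix: "real_distribution (poisson_mix p q s)"
  unfolding poisson_mix_def
  by (rule prob_space.real_distribution_distr[OF prob_space_poisson_pair measurable_poisson_pair])

lemma poisson_mix_prob_pos: "poisson_mix p q s \<in> prob_pos"
  unfolding prob_pos_iff[OF real_distribution_poisson_mix]
  unfolding poisson_mix_def by (subst AE_distr_iff[OF measurable_poisson_pair]) auto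

lemma poisson_mix_square:
  "distr (poisson_mix p q s) borel (\<lambda>v. v\<^sup>2) = distr (poisson_pair p q) borel (\<lambda>x. real (fst x) + s\<^sup>2 * real (snd x))"
  unfolding poisson_mix_def by (subst distr_distr[OF _ measurable_poisson_pair]) (auto simp: comp_def)

context
  fixes p q s :: real
  assumes pq: "p > 0" "q > 0"
begin

lemma char_poisson_mix_square:
  "char (distr (poisson_mix p q s) borel (\<lambda>v. v\<^sup>2)) t =
     exp (of_real p * (iexp t - 1) + of_real q * (iexp (s\<^sup>2 * t) - 1))"
proof -
  have "char (distr (poisson_mix p q s) borel (\<lambda>v. v\<^sup>2)) t =
      (LINT x|poisson_pair p q. iexp (t * (real (fst x) + s\<^sup>2 * real (snd x))))"
    unfolding poisson_mix_square char_def by (rule integral_distr[OF measurable_poisson_pair]) measurable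
  also have "\<dots> = (LINT x|poisson_pair p q. iexp t ^ fst x * iexp (s\<^sup>2 * t) ^ snd x)"
    by (rule Bochner_Integration.integral_cong) (simp_all add: exp_of_nat_mult[symmetric] exp_add[symmetric] algebra_simps)
  also have "\<dots> = exp (of_real p * (iexp t - 1) + of_real q * (iexp (s\<^sup>2 * t) - 1))"
    by (rule poisson_pair_pgf[OF pq]) simp_all
  finally show ?thesis .
qed

lemma char_gauss_poisson_mix:
  "char (gauss_mixture (poisson_mix p q s)) t =
     exp (of_real p * (of_real (exp (- t\<^sup>2 / 2)) - 1) + of_real q * (of_real (exp (- (t * s)\<^sup>2 / 2)) - 1))"
proof -
  have "char (gauss_mixture (poisson_mix p q s)) t =
      (LINT x|poisson_pair p q. complex_of_real (exp (- (t * sqrt (real (fst x) + s\<^sup>2 * real (snd x)))\<^sup>2 / 2)))"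
    unfolding char_gauss_mixture[OF real_distribution_poisson_mix]
    unfolding poisson_mix_def by (rule integral_distr[OF measurable_poisson_pair]) measurable
  also have "\<dots> = (LINT x|poisson_pair p q. of_real (exp (- t\<^sup>2 / 2)) ^ fst x * of_real (exp (- (t * s)\<^sup>2 / 2)) ^ snd x)"
  proof (rule Bochner_Integration.integral_cong)
    fix x :: "nat \<times> nat"
    have "(t * sqrt (real (fst x) + s\<^sup>2 * real (snd x)))\<^sup>2 = t\<^sup>2 * (real (fst x) + s\<^sup>2 * real (snd x))"
      by (simp add: power_mult_distrib)
    then have "- (t * sqrt (real (fst x) + s\<^sup>2 * real (snd x)))\<^sup>2 / 2 =
        real (fst x) * (- t\<^sup>2 / 2) + real (snd x) * (- (t * s)\<^sup>2 / 2)"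
      by (simp add: power_mult_distrib algebra_simps add_divide_distrib diff_divide_distrib)
    then have "exp (- (t * sqrt (real (fst x) + s\<^sup>2 * real (snd x)))\<^sup>2 / 2) =
        exp (- t\<^sup>2 / 2) ^ fst x * exp (- (t * s)\<^sup>2 / 2) ^ snd x"
      by (simp only: exp_add exp_of_nat_mult)
    then show "complex_of_real (exp (- (t * sqrt (real (fst x) + s\<^sup>2 * real (snd x)))\<^sup>2 / 2)) =
        of_real (exp (- t\<^sup>2 / 2)) ^ fst x * of_real (exp (- (t * s)\<^sup>2 / 2)) ^ snd x"
      by (simp only: of_real_mult of_real_power)
  qed simp
  also have "\<dots> = exp (of_real p * (of_real (exp (- t\<^sup>2 / 2)) - 1) + of_real q * (of_real (exp (- (t * s)\<^sup>2 / 2)) - 1))"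
    by (rule poisson_pair_pgf[OF pq]) simp_all
  finally show ?thesis .
qed

end

text \<open>The rates enter both characteristic exponents linearly, so dividing \<open>p\<close> and
  \<open>q\<close> by \<open>n\<close> yields the \<open>n\<close>-th roots.\<close>

lemma classical_inf_div_poisson:
  assumes pq: "p > 0" "q > 0"
  shows "distr (poisson_mix p q s) borel (\<lambda>v. v\<^sup>2) \<in> classical_inf_div"
    and "gauss_mixture (poisson_mix p q s) \<in> classical_inf_div"
proof -
  have rd: "real_distribution (distr (poisson_mix p q s) borel (\<lambda>v. v\<^sup>2))" for p q
    unfolding poisson_mix_square
    by (rule prob_space.real_distribution_distr[OF prob_space_poisson_pair measurable_poisson_pair])
  have root: "exp (of_real p * A + of_real q * B) = exp (of_real (p / real n) * A + of_real (q / real n) * B) ^ n"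
    if "n \<ge> 1" for n and A B :: complex
  proof -
    have "of_nat n * (of_real (p / real n) * A + of_real (q / real n) * B) = of_real p * A + of_real q * B"
      using that by (simp add: field_simps)
    then show ?thesis by (simp only: exp_of_nat_mult[symmetric])
  qed
  show "distr (poisson_mix p q s) borel (\<lambda>v. v\<^sup>2) \<in> classical_inf_div"
  proof (rule classical_inf_divI[OF rd])
    fix n :: nat assume n: "n \<ge> 1"
    have "p / n > 0" "q / n > 0" using pq n by auto
    then show "\<exists>L. real_distribution L \<and> (\<forall>t. char (distr (poisson_mix p q s) borel (\<lambda>v. v\<^sup>2)) t = char L t ^ n)"
      using char_poisson_mix_square[OF pq] char_poisson_mix_square root[OF n] rd
      by (intro exI[of _ "distr (poisson_mix (p / n) (q / n) s) borel (\<lambda>v. v\<^sup>2)"] conjI allI) simp_all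
  qed
  show "gauss_mixture (poisson_mix p q s) \<in> classical_inf_div"
  proof (rule classical_inf_divI[OF real_distribution_gauss_mixture[OF real_distribution_poisson_mix]])
    fix n :: nat assume n: "n \<ge> 1"
    have "p / n > 0" "q / n > 0" using pq n by auto
    then show "\<exists>L. real_distribution L \<and> (\<forall>t. char (gauss_mixture (poisson_mix p q s)) t = char L t ^ n)"
      using char_gauss_poisson_mix[OF pq] char_gauss_poisson_mix root[OF n]
        real_distribution_gauss_mixture[OF real_distribution_poisson_mix]
      by (intro exI[of _ "gauss_mixture (poisson_mix (p / n) (q / n) s)"] conjI allI) simp_all
  qed
qed

lemma distr_uminus_std_normal: "distr std_normal_distribution borel uminus = std_normal_distribution"
  by (rule distr_uminus_eqI[OF real_dist_normal_dist]) (simp add: char_std_normal_distribution)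

text \<open>The compensator is odd and integrates to zero under each centred Gaussian component;
  what remains is the Gaussian characteristic function minus 1 for each jump scale.\<close>

lemma levy_khintchine_gauss_jumps:
  assumes pq: "p \<ge> 0" "q \<ge> 0" and s: "s > 0"
  shows "(LINT x|gauss_jumps p q s. iexp (t * x) - 1 - \<i> * of_real (t * x * indicator {-1..1} x)) =
     of_real p * (of_real (exp (- t\<^sup>2 / 2)) - 1) + of_real q * (of_real (exp (- (t * s)\<^sup>2 / 2)) - 1)"
proof -
  interpret Z: real_distribution std_normal_distribution by (rule real_dist_normal_dist)
  note fb = fin_borel_real_distribution[OF real_dist_normal_dist]
  define f where "f x = iexp (t * x) - 1 - \<i> * of_real (t * x * indicator {-1..1} x)" for x :: real
  have fm [measurable]: "f \<in> borel_measurable borel" unfolding f_def by measurable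
  define g where "g r x = \<i> * of_real (t * (r * x) * indicator {-1..1} (r * x))" for r x :: real
  have gb: "norm (g r x) \<le> \<bar>t\<bar>" for r x
    by (auto simp: g_def norm_mult indicator_def abs_mult intro!: mult_left_le)
  have gi: "integrable std_normal_distribution (g r)" for r
    by (rule integrable_bounded[OF fb _ gb]) (simp add: g_def[abs_def])
  have ei: "integrable std_normal_distribution (\<lambda>x. iexp (t * (r * x)))" for r
    by (rule integrable_bounded[OF fb, of _ 1]) auto
  have fr: "f (r * x) = iexp (t * (r * x)) - 1 - g r x" for r x by (simp add: f_def g_def)
  have I: "integrable std_normal_distribution (\<lambda>x. f (r * x))" for r
    unfolding fr by (intro Bochner_Integration.integrable_diff ei gi) simp
  have val: "(LINT x|std_normal_distribution. f (r * x)) = of_real (exp (- (t * r)\<^sup>2 / 2)) - 1" for r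
  proof -
    have "(LINT x|std_normal_distribution. g r x) = 0"
      by (rule integral_odd_eq_0[OF fb distr_uminus_std_normal, of "g r"])
        (auto simp: g_def[abs_def] indicator_def)
    moreover have "(LINT x|std_normal_distribution. iexp (t * (r * x))) = of_real (exp (- (t * r)\<^sup>2 / 2))"
      using fun_cong[OF char_std_normal_distribution, of "t * r"] by (simp add: char_def mult.assoc)
    ultimately show ?thesis
      unfolding fr using ei gi Z.prob_space by (simp add: Z.space_eq_univ)
  qed
  have "integrable std_normal_distribution f" using I[of 1] by simp
  from has_bochner_integral_gauss_jumps[OF pq s fm this I]
  have "(LINT x|gauss_jumps p q s. f x) = p *\<^sub>R (LINT x|std_normal_distribution. f (1 * x)) + q *\<^sub>R (LINT x|std_normal_distribution. f (s * x))"
    by (simp add: has_bochner_integral_iff)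
  then show ?thesis unfolding val by (simp add: f_def scaleR_conv_of_real)
qed

section \<open>Comparison of the two classes\<close>

lemma distr_uminus_second_moment:
  assumes \<nu>: "fin_borel \<nu>" "distr \<nu> borel uminus = \<nu>"
  shows "distr (second_moment \<nu>) borel uminus = second_moment \<nu>"
proof (rule measure_eqI)
  note sets [measurable_cong] = fin_borelD(2)[OF \<nu>(1)]
  show "sets (distr (second_moment \<nu>) borel uminus) = sets (second_moment \<nu>)"
    by (simp add: sets)
  fix A assume "A \<in> sets (distr (second_moment \<nu>) borel uminus)"
  then have A [measurable]: "A \<in> sets borel" by simp
  have um: "uminus \<in> measurable \<nu> borel" by measurable
  have "emeasure (distr (second_moment \<nu>) borel uminus) A =
      emeasure (second_moment \<nu>) (uminus -` A)"
    by (subst emeasure_distr) (auto simp: fin_borelD(3)[OF \<nu>(1)])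
  also have "\<dots> = (\<integral>\<^sup>+x. ennreal (x\<^sup>2) * indicator (uminus -` A) x \<partial>\<nu>)"
    by (rule emeasure_density) (auto simp: sets intro: measurable_sets_borel[OF _ A])
  also have "\<dots> = (\<integral>\<^sup>+x. ennreal ((- x)\<^sup>2) * indicator A (- x) \<partial>\<nu>)"
    by (auto simp: indicator_def intro!: nn_integral_cong)
  also have "\<dots> = (\<integral>\<^sup>+x. ennreal (x\<^sup>2) * indicator A x \<partial>distr \<nu> borel uminus)"
    by (rule nn_integral_distr[OF um, symmetric]) measurable
  also have "\<dots> = emeasure (second_moment \<nu>) A"
    unfolding \<nu>(2) by (rule emeasure_density[symmetric]) (auto simp: sets)
  finally show "emeasure (distr (second_moment \<nu>) borel uminus) A =
      emeasure (second_moment \<nu>) A" .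
qed

text \<open>The law \<open>L\<close> and the rates are kept general so that the statement covers
  both the Poisson mixtures and the degenerate case \<open>p = q = 0\<close> with
  \<open>L = dirac0\<close>, where the Poisson lemmas, which assume positive rates, do not
  apply.\<close>

lemma free_type_G_gauss:
  assumes pq: "p \<ge> 0" "q \<ge> 0" and s: "s > 0" and L: "L \<in> prob_pos"
    and sq: "distr L borel (\<lambda>v. v\<^sup>2) \<in> classical_inf_div" and idM: "gauss_mixture L \<in> classical_inf_div"
    and char: "\<And>t. char (gauss_mixture L) t =
      exp (of_real p * (of_real (exp (- t\<^sup>2 / 2)) - 1) + of_real q * (of_real (exp (- (t * s)\<^sup>2 / 2)) - 1))"
    and gen: "additive_generator N (second_moment (gauss_jumps p q s))"
  shows "N \<in> free_type_G"
proof -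
  note levy = levy_measure_gauss_jumps[OF pq s]
  have "gauss_mixture L \<in> type_G"
    using L sq by (auto simp: type_G_def gauss_mixture_def)
  moreover have "has_classical_triplet (gauss_mixture L) 0 (gauss_jumps p q s) 0"
    unfolding has_classical_triplet_def levy_khintchine_gauss_jumps[OF pq s] char using levy by simp
  moreover have "has_free_triplet N 0 (gauss_jumps p q s) 0"
    by (rule has_free_triplet_generator[OF fin_borel_gauss_jumps[OF pq s] levy
          distr_uminus_gauss_jumps[OF pq s] second_moment_gauss_jumps[OF pq s] gen])
  ultimately show ?thesis
    using idM free_inf_div_generator[OF gen] unfolding free_type_G_def bercovici_pata_def by blast
qed

lemma free_type_W_subset: "free_type_W \<subseteq> free_inf_div_sym"
  using is_free_mult_conv_wignerD(2) by (auto simp: free_type_W_def free_inf_div_sym_def)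

lemma exists_type_G_not_type_W: "\<exists>N\<in>free_type_G \<inter> free_inf_div_sym. N \<notin> free_type_W"
proof -
  obtain p s T1 T2 T3 where p: "0 < p" "p < 1 / 4" and s: "0 < s" and T: "0 < T1" "T1 < T2" "T2 < T3"
    and nc: "(gauss_cumulant p s T2 - gauss_cumulant p s T1) * (gauss_chi p s T3 - gauss_chi p s T2) <
     (gauss_cumulant p s T3 - gauss_cumulant p s T2) * (gauss_chi p s T2 - gauss_chi p s T1)"
    by (rule gauss_cumulant_not_concave)
  have p': "0 \<le> p" "(0::real) \<le> 1 / 2" and h: "(1 / 2 :: real) > 0" using p by auto
  note fb = fin_borel_gauss_jumps[OF p' s] and sym = distr_uminus_gauss_jumps[OF p' s]
    and sq = second_moment_gauss_jumps[OF p' s]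
  obtain N where N: "N \<in> prob_sym" "additive_generator N (second_moment (gauss_jumps p (1 / 2) s))"
    using additive_generator_exists(2)[OF fin_borel_second_moment[OF fb sq] distr_uminus_second_moment[OF fb sym]] by blast
  have "N \<in> free_type_G"
    by (rule free_type_G_gauss[OF p' s poisson_mix_prob_pos classical_inf_div_poisson[OF p(1) h]
          char_gauss_poisson_mix[OF p(1) h] N(2)])
  moreover have "N \<in> free_inf_div_sym"
    using N(1) free_inf_div_generator[OF N(2)] by (simp add: free_inf_div_sym_def)
  moreover have "N \<notin> free_type_W" by (rule gauss_not_type_W[OF p s N T nc])
  ultimately show ?thesis by blast
qed

lemma dirac0_prob: "dirac0 \<in> prob_pos" "dirac0 \<in> prob_sym"
proof -
  show "dirac0 \<in> prob_pos"
    unfolding prob_pos_iff[OF real_distribution_dirac0] by (subst AE_return) auto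
  show "dirac0 \<in> prob_sym"
    using real_distribution_dirac0 by (simp add: prob_sym_def prob_R_def distr_return)
qed

lemma classical_inf_div_dirac0: "dirac0 \<in> classical_inf_div"
  by (rule classical_inf_divI[OF real_distribution_dirac0])
    (use real_distribution_dirac0 in \<open>auto simp: char_dirac0 intro!: exI[of _ dirac0]\<close>)

lemma dirac0_type_W_and_G: "dirac0 \<in> free_type_W \<inter> free_type_G"
proof
  have z: "(0::real) \<le> 0" "(0::real) < 1" by auto
  define \<tau> where "\<tau> = second_moment (gauss_jumps 0 0 1)"
  note fb = fin_borel_gauss_jumps[OF z(1,1,2)] and sq = second_moment_gauss_jumps[OF z(1,1,2)]
  \<comment> \<open>With both rates zero there are no jumps; the generator vanishes, and
    \<open>dirac0\<close> is the law it generates.\<close>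
  have "gauss_jumps 0 0 1 = null_measure borel"
    by (rule measure_eqI) (simp_all add: gauss_jumps_def emeasure_density)
  then have "cauchy_transform \<tau> w = 0" for w
    unfolding \<tau>_def cauchy_transform_second_moment[OF fb sq] by (simp add: integral_null_measure)
  then have gen: "additive_generator dirac0 \<tau>"
    unfolding \<tau>_def by (rule additive_generator_dirac0[OF fin_borel_second_moment[OF fb sq]])
  \<comment> \<open>For the factor \<open>L = dirac0\<close> the definition of the product
    prescribes the value \<open>dirac0\<close>.\<close>
  show "dirac0 \<in> free_type_W"
    using free_inf_div_generator[OF gen] dirac0_prob wigner_in_prob_sym
    by (auto simp: free_type_W_def is_free_mult_conv_def)
  have char0: "char (gauss_mixture dirac0) t = 1" for t
    unfolding char_gauss_mixture[OF real_distribution_dirac0] by (subst integral_return) auto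
  then have mix: "gauss_mixture dirac0 = dirac0"
    by (intro Levy_uniqueness real_distribution_gauss_mixture real_distribution_dirac0) (auto simp: char_dirac0)
  have "distr dirac0 borel (\<lambda>v. v\<^sup>2) = dirac0" by (simp add: distr_return)
  then show "dirac0 \<in> free_type_G"
    using classical_inf_div_dirac0 char0 mix gen
    by (intro free_type_G_gauss[OF z(1,1,2) dirac0_prob(1)]) (simp_all add: \<tau>_def)
qed

theorem theorem26:
  shows "free_type_W \<subset> free_inf_div_sym
    \<and> free_type_W \<inter> free_type_G \<noteq> {}
    \<and> free_type_W \<noteq> free_type_G"
  using free_type_W_subset exists_type_G_not_type_W dirac0_type_W_and_G by blast

end
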